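(* Let $a\ge 3$ be a fixed integer. Then, as $b\to\infty$ through integers with $\gcd(a,b)=1$, $$\pi(a,b)=\left(\frac12-\frac{1}{2(a-1)}+o(1)\right)\pi(s(a,b)).$$ In particular, $\pi(3,b)=\frac14\pi(s(3,b))+o(\pi(s(3,b)))$ as $b\to\infty$ with $3\nmid b$.
   Context: For coprime positive integers $a,b$, let $T(a,b)=\{ax+by : x,y\in\mathbb{Z}_{\ge 0}\}$ and $s(a,b)=ab-a-b$. Let $\pi(a,b)$ denote the number of primes in $T(a,b)$ which are less than or equal to $s(a,b)$ (equivalently less than $s(a,b)$, since $s(a,b)\notin T(a,b)$), and let $\pi(x)$ denote the number of primes not exceeding $x$. *)

theory Defs
  imports
    Complex_Main
    "HOL-Computational_Algebra.Primes"
    "HOL-Library.Landau_Symbols"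
begin

definition semigroup_gen :: "nat \<Rightarrow> nat \<Rightarrow> nat set" where
  "semigroup_gen a b = {a * x + b * y | x y. True}"

text \<open>Integer-valued, since the value is negative for instance when \<open>b = 1\<close>.\<close>

definition frobenius_num :: "nat \<Rightarrow> nat \<Rightarrow> int" where
  "frobenius_num a b = int a * int b - int a - int b"

definition prime_count :: "real \<Rightarrow> nat" where
  "prime_count x = card {p :: nat. prime p \<and> real p \<le> x}"

definition prime_count_gen :: "nat \<Rightarrow> nat \<Rightarrow> nat" where
  "prime_count_gen a b =
     card {p \<in> semigroup_gen a b. prime p \<and> int p \<le> frobenius_num a b}"

end

theory Submission
  imports Defs
    "HOL-Complex_Analysis.Complex_Analysis"
    "HOL-Probability.Sinc_Integral"
    "HOL-Number_Theory.Number_Theory"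
    "HOL-Real_Asymp.Real_Asymp"
begin

text \<open>
  A prime \<open>p\<close> not dividing \<open>a\<close> lies in \<open>T(a,b)\<close> iff \<open>p \<ge> b y\<close>, where \<open>y \<in> {1, \<dots>, a - 1}\<close> is the residue
  with \<open>p \<equiv> b y (mod a)\<close>. So, up to \<open>O(1)\<close>, \<open>\<pi>(a,b)\<close> is the sum over the \<open>y\<close> coprime to \<open>a\<close> of the
  number of primes \<open>p \<equiv> b y (mod a)\<close> with \<open>b y \<le> p \<le> s(a,b)\<close>. As \<open>s(a,b) \<sim> (a - 1) b\<close>, the prime number
  theorem for arithmetic progressions makes each of these numbers
  \<open>((a - 1 - y) / \<phi>(a) + o(1)) b / ln b\<close>, and the average of the \<open>y\<close> is \<open>a / 2\<close>.

  The prime number theorem for arithmetic progressions follows from the Wiener-Ikehara theorem applied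
  to \<open>\<Sum> \<Lambda>(n) n\<^sup>-\<^sup>s\<close> over \<open>n \<equiv> r (mod a)\<close>, a combination of the logarithmic derivatives of the Dirichlet
  \<open>L\<close>-functions modulo \<open>a\<close>. The functions \<open>L(s, \<chi>)\<close> have no zeros on the line \<open>Re s = 1\<close> by the inequality
  \<open>3 + 4 cos t + cos 2t \<ge> 0\<close>, except that \<open>L(1, \<chi>) \<noteq> 0\<close> for real \<open>\<chi>\<close> needs Monsky's argument.
\<close>

section \<open>Dirichlet characters\<close>

text \<open>The residue \<open>b * y\<close> moves with \<open>b\<close>, so the limit for one fixed
  class is not enough: the error for the class at hand is bounded by the sum of the errors over all
  classes prime to \<open>a\<close>, of which there are finitely many. Summed over \<open>y\<close>,
  the main terms give a - 1 - a / 2 on the scale b / ln b, against a - 1 for all primes up to s(a,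
  b); the quotient 1 - a / (2 (a - 1)) is the constant of the theorem.

  The main obstacle is the behaviour of L(s, \<chi>) on Re s = 1. It is handled without Euler
  products or logarithms of L-functions: \<open>t\<close> times the Dirichlet series of -L'/L at 1 +
  iy + t tends, as \<open>t\<close> decreases to 0, to the order of the pole minus the order of the
  zero at 1 + iy. Inequalities between such series thus become inequalities between integers.

  Enough characters are found by linear algebra on functions modulo \<open>a\<close>, so the
  structure of the unit group does not enter.\<close>

definition dchars :: "nat \<Rightarrow> (nat \<Rightarrow> complex) set" where
  "dchars a = {\<xi>. \<xi> 1 = 1 \<and> (\<forall>m n. \<xi> (m * n) = \<xi> m * \<xi> n) \<and> (\<forall>n. \<xi> (n + a) = \<xi> n) \<and>
                   (\<forall>n. \<xi> n = 0 \<longleftrightarrow> \<not> coprime n a)}"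

definition principal_dchar :: "nat \<Rightarrow> nat \<Rightarrow> complex" where
  "principal_dchar a n = (if coprime n a then 1 else 0)"

lemma dcharsD:
  assumes "\<xi> \<in> dchars a"
  shows "\<xi> 1 = 1" "\<xi> (m * n) = \<xi> m * \<xi> n" "\<xi> (n + a) = \<xi> n" "\<xi> n = 0 \<longleftrightarrow> \<not> coprime n a"
  using assms by (auto simp: dchars_def)

lemma periodic_mod:
  fixes f :: "nat \<Rightarrow> 'b"
  assumes "\<And>n. f (n + a) = f n"
  shows "f (n mod a) = f n"
proof -
  have "f (m + k * a) = f m" for m k
  proof (induction k)
    case (Suc k)
    have "f (m + Suc k * a) = f ((m + k * a) + a)" by (simp add: algebra_simps)
    thus ?case using assms Suc by metis
  qed simp
  from this[of "n mod a" "n div a"] show ?thesis by simp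
qed

lemma periodic_cong:
  fixes f :: "nat \<Rightarrow> 'b"
  assumes "\<And>n. f (n + a) = f n" "[m = n] (mod a)"
  shows "f m = f n"
  using periodic_mod[of f a m] periodic_mod[of f a n] assms by (simp add: cong_def)

lemma dchars_cong: "\<xi> \<in> dchars a \<Longrightarrow> [m = n] (mod a) \<Longrightarrow> \<xi> m = \<xi> n"
  by (rule periodic_cong) (auto dest: dcharsD)

lemma dchars_power: "\<xi> \<in> dchars a \<Longrightarrow> \<xi> (n ^ k) = \<xi> n ^ k"
  by (induction k) (auto simp: dcharsD(2) dcharsD(1)[simplified])

lemma dchars_root: "\<xi> \<in> dchars a \<Longrightarrow> coprime n a \<Longrightarrow> \<xi> n ^ totient a = 1"
  using dchars_cong[of \<xi> a, OF _ euler_theorem[of n a]] dchars_power[of \<xi> a n "totient a"] dcharsD(1)[of \<xi> a] by simp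

lemma norm_dchars: "a > 0 \<Longrightarrow> \<xi> \<in> dchars a \<Longrightarrow> norm (\<xi> n) = (if coprime n a then 1 else 0)"
  using dchars_root[of \<xi> a n] dcharsD(4)[of \<xi> a n] power_eq_1_iff[of "\<xi> n" "totient a"] by auto

lemma principal_dchar_in: "principal_dchar a \<in> dchars a"
proof -
  have "coprime (n + a) a \<longleftrightarrow> coprime n a" for n by (metis coprime_iff_gcd_eq_1 gcd_add1)
  thus ?thesis by (auto simp: dchars_def principal_dchar_def)
qed

lemma mult_dchars: "\<xi> \<in> dchars a \<Longrightarrow> \<psi> \<in> dchars a \<Longrightarrow> (\<lambda>n. \<xi> n * \<psi> n) \<in> dchars a"
  by (auto simp: dchars_def)

lemma bij_betw_mult_mod:
  fixes a m :: nat
  assumes "a > 0" "coprime m a"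
  shows "bij_betw (\<lambda>n. m * n mod a) {..<a} {..<a}"
proof -
  have "inj_on (\<lambda>n. m * n mod a) {..<a}"
  proof (rule inj_onI)
    fix x y assume xy: "x \<in> {..<a}" "y \<in> {..<a}" "m * x mod a = m * y mod a"
    hence "[x = y] (mod a)" using assms by (simp add: cong_def [symmetric] cong_mult_lcancel_nat)
    thus "x = y" using xy by (simp add: cong_def)
  qed
  moreover have "(\<lambda>n. m * n mod a) ` {..<a} \<subseteq> {..<a}" using assms by auto
  ultimately show ?thesis by (simp add: bij_betw_def endo_inj_surj)
qed

text \<open>A unit \<open>m\<close> with \<open>\<xi> m \<noteq> 1\<close> permutes the residues, so
  the sum equals \<open>\<xi> m\<close> times itself.\<close>

lemma sum_dchars_eq_0:
  assumes a: "a > 0" and \<xi>: "\<xi> \<in> dchars a" "\<xi> \<noteq> principal_dchar a"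
  shows "(\<Sum>n<a. \<xi> n) = 0"
proof -
  obtain m where m: "coprime m a" "\<xi> m \<noteq> 1"
    using \<xi> dcharsD(4)[OF \<xi>(1)] by (auto simp: principal_dchar_def fun_eq_iff split: if_splits)
  have "(\<Sum>n<a. \<xi> n) = (\<Sum>n<a. \<xi> (m * n mod a))"
    by (rule sum.reindex_bij_betw[OF bij_betw_mult_mod[OF a m(1)], symmetric])
  also have "\<dots> = \<xi> m * (\<Sum>n<a. \<xi> n)"
    unfolding sum_distrib_left
    by (intro sum.cong refl) (simp add: periodic_mod[of \<xi>] dcharsD[OF \<xi>(1)])
  finally show ?thesis using m(2) by (simp add: algebra_simps)
qed

text \<open>A character is determined by its values below \<open>a\<close>, and these are 0 or roots
  of unity of order dividing \<open>totient a\<close>.\<close>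

lemma finite_dchars:
  assumes "a > 0" shows "finite (dchars a)"
proof -
  define Z where "Z = insert 0 {z::complex. z ^ totient a = 1}"
  have "finite Z" unfolding Z_def using assms by (auto intro!: finite_roots_unity simp: Suc_le_eq)
  hence fin: "finite ({..<a} \<rightarrow>\<^sub>E Z)" by (intro finite_PiE) auto
  have "inj_on (\<lambda>\<xi>. restrict \<xi> {..<a}) (dchars a)"
  proof (rule inj_onI)
    fix \<xi> \<psi> assume *: "\<xi> \<in> dchars a" "\<psi> \<in> dchars a" "restrict \<xi> {..<a} = restrict \<psi> {..<a}"
    show "\<xi> = \<psi>"
    proof
      fix n
      have "\<xi> (n mod a) = \<psi> (n mod a)" using *(3) assms by (metis lessThan_iff mod_less_divisor restrict_apply')
      thus "\<xi> n = \<psi> n" using *(1,2) by (simp add: periodic_mod[of _ a] dcharsD)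
    qed
  qed
  moreover have "(\<lambda>\<xi>. restrict \<xi> {..<a}) ` dchars a \<subseteq> {..<a} \<rightarrow>\<^sub>E Z"
    using dchars_root dcharsD(4) by (auto simp: Z_def PiE_def extensional_def Pi_def restrict_def)
  ultimately show ?thesis using fin by (meson finite_imageD finite_subset)
qed

section \<open>Existence of characters that separate units\<close>

definition unity_root :: "nat \<Rightarrow> complex" where
  "unity_root n = exp (2 * of_real pi * \<i> / of_nat n)"

text \<open>
  Up to the factor \<open>n\<close> these are, for \<open>x\<^sup>n \<equiv> 1\<close>, the projections onto the eigenspaces of the translation
  \<open>v \<mapsto> v (x * _)\<close>. Translations commute, so starting from an eigenvector for one \<open>g\<close> and projecting
  repeatedly yields a simultaneous eigenvector for all of them, which is a multiple of a character.
\<close>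

definition eigenproj :: "nat \<Rightarrow> nat \<Rightarrow> nat \<Rightarrow> (nat \<Rightarrow> complex) \<Rightarrow> nat \<Rightarrow> complex" where
  "eigenproj n x k v y = (\<Sum>j<n. unity_root n ^ (j * k) * v (x ^ j * y))"

lemma unity_root_power: "unity_root n ^ k = exp (2 * of_real pi * \<i> * of_nat k / of_nat n)"
  by (simp add: unity_root_def exp_of_nat_mult [symmetric] mult_ac)

lemma unity_root_power_eq_1: "n > 0 \<Longrightarrow> unity_root n ^ n = 1"
  using complex_root_unity[of n n] by (simp add: unity_root_power)

lemma unity_root_power_neq_1: "0 < k \<Longrightarrow> k < n \<Longrightarrow> unity_root n ^ k \<noteq> 1"
  using complex_root_unity_eq_1[of n k] by (auto simp: unity_root_power dest: dvd_imp_le)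

lemma root_of_unity_sum:
  assumes "j < n"
  shows "(\<Sum>k<n. unity_root n ^ (j * k)) = (if j = 0 then of_nat n else 0)"
proof (cases "j = 0")
  case False
  have "(unity_root n ^ j) ^ n = 1"
    using unity_root_power_eq_1[of n] assms by (simp add: power_mult [symmetric] mult.commute[of j] power_mult)
  hence "(\<Sum>k<n. (unity_root n ^ j) ^ k) = 0"
    using unity_root_power_neq_1[of j n] False assms by (simp add: geometric_sum)
  thus ?thesis using False by (simp add: power_mult)
qed simp

text \<open>Summing over \<open>k\<close> first leaves only the term \<open>j = 0\<close>. Hence a
  nonzero \<open>v\<close> has a nonzero component in some eigenspace, and repeated projection need
  not end in 0.\<close>

lemma sum_eigenproj:
  assumes "n > 0" shows "(\<Sum>k<n. eigenproj n x k v y) = of_nat n * v y"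
proof -
  have "(\<Sum>k<n. eigenproj n x k v y) =
        (\<Sum>j<n. (\<Sum>k<n. unity_root n ^ (j * k)) * v (x ^ j * y))"
    unfolding eigenproj_def sum_distrib_right by (rule sum.swap)
  also have "\<dots> = (\<Sum>j<n. if j = 0 then of_nat n * v y else 0)"
    by (intro sum.cong refl) (simp add: root_of_unity_sum)
  also have "\<dots> = of_nat n * v y" using assms by (simp add: sum.delta')
  finally show ?thesis .
qed

text \<open>Replacing \<open>y\<close> by \<open>x * y\<close> shifts the index \<open>j\<close> by
  one and costs one factor \<open>unity_root n ^ k\<close>. The shifted sum closes up cyclically
  because \<open>x ^ n\<close> is 1 modulo \<open>a\<close>.\<close>

lemma eigenproj_eigen:
  assumes v: "\<And>y. v (y + a) = v y" and x: "[x ^ n = 1] (mod a)" and n: "n > 0"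
  shows "eigenproj n x k v (x * y) = inverse (unity_root n ^ k) * eigenproj n x k v y"
proof -
  define h where "h = (\<lambda>j. unity_root n ^ (j * k) * v (x ^ j * y))"
  have "[x ^ n * y = 1 * y] (mod a)" using x by (rule cong_mult) simp
  hence "v (x ^ n * y) = v y" using periodic_cong[of v, OF v] by simp
  hence hn: "h n = h 0" using unity_root_power_eq_1[OF n] by (simp add: h_def power_mult)
  have "unity_root n ^ k * eigenproj n x k v (x * y) = (\<Sum>j<n. h (Suc j))"
    unfolding eigenproj_def h_def sum_distrib_left
    by (intro sum.cong refl) (simp add: power_add mult_ac)
  also have "\<dots> = (\<Sum>j<n. h j)"
    using sum.lessThan_Suc_shift[of h n] sum.lessThan_Suc[of h n] hn by simp
  also have "\<dots> = eigenproj n x k v y" by (simp add: eigenproj_def h_def)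
  finally show ?thesis by (simp add: unity_root_def field_simps)
qed

lemma eigenproj_periodic:
  assumes v: "\<And>y. v (y + a) = v y" shows "eigenproj n x k v (y + a) = eigenproj n x k v y"
proof -
  have "v (x ^ j * (y + a)) = v (x ^ j * y)" for j
    by (rule periodic_cong[of v, OF v]) (simp add: cong_def algebra_simps)
  thus ?thesis by (simp add: eigenproj_def)
qed

lemma eigenproj_support:
  assumes v: "\<And>y. v y \<noteq> 0 \<Longrightarrow> coprime y a" and "eigenproj n x k v y \<noteq> 0" shows "coprime y a"
proof (rule ccontr)
  assume "\<not> coprime y a"
  hence "v (x ^ j * y) = 0" for j using v[of "x ^ j * y"] by auto
  thus False using assms(2) by (simp add: eigenproj_def)
qed

text \<open>If \<open>v\<close> is an eigenvector of every translation by a unit, then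
  \<open>v (x * y) = c * v y\<close> with \<open>c = v x / v 1\<close>, so \<open>v / v 1\<close> is
  multiplicative. The eigenvalue at \<open>g\<close> is chosen different from 1 at the start and
  survives all later projections.\<close>

lemma separating_dchar:
  assumes a: "a > 0" and g: "coprime g a" "\<not> [g = 1] (mod a)"
  shows "\<exists>\<xi>\<in>dchars a. \<xi> g \<noteq> 1"
proof -
  define n where "n = totient a"
  have n: "n > 0" using a by (simp add: n_def)
  have root: "[x ^ n = 1] (mod a)" if "coprime x a" for x using euler_theorem[OF that] by (simp add: n_def)
  \<comment> \<open>Induction over the set \<open>X\<close> of translations made diagonal so far;
    \<open>\<omega>\<close> is the eigenvalue at \<open>g\<close>.\<close>
  have claim: "\<exists>(v :: nat \<Rightarrow> complex) y0 \<omega>. (\<forall>y. v (y + a) = v y) \<and> (\<forall>y. v y \<noteq> 0 \<longrightarrow> coprime y a) \<and> v y0 \<noteq> 0 \<and>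
           \<omega> \<noteq> 1 \<and> (\<forall>y. v (g * y) = \<omega> * v y) \<and> (\<forall>x\<in>X. \<exists>c. \<forall>y. v (x * y) = c * v y)"
    if "finite X" "\<forall>x\<in>X. coprime x a" for X
    using that
  proof (induction X)
    case empty
    \<comment> \<open>If all components with \<open>k \<noteq> 0\<close> vanished, \<delta> would be
      invariant under \<open>g\<close>, but it separates the classes of \<open>g\<close> and
      1.\<close>
    define \<delta> :: "nat \<Rightarrow> complex" where "\<delta> = (\<lambda>y. if [y = 1] (mod a) then 1 else 0)"
    have \<delta>: "\<delta> (y + a) = \<delta> y" for y by (simp add: \<delta>_def cong_def)
    have "\<exists>k\<in>{0<..<n}. \<exists>y. eigenproj n g k \<delta> y \<noteq> 0"
    proof (rule ccontr)
      assume "\<not> ?thesis"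
      hence z: "eigenproj n g k \<delta> y = 0" if "k \<in> {0<..<n}" for k y using that by blast
      have "eigenproj n g 0 \<delta> y = of_nat n * \<delta> y" for y
      proof -
        have "of_nat n * \<delta> y = (\<Sum>k<n. eigenproj n g k \<delta> y)" using sum_eigenproj[OF n] by simp
        also have "\<dots> = (\<Sum>k\<in>{0}. eigenproj n g k \<delta> y)"
          by (rule sum.mono_neutral_right) (use z n in auto)
        finally show ?thesis by simp
      qed
      moreover have "eigenproj n g 0 \<delta> (g * 1) = eigenproj n g 0 \<delta> 1"
        using eigenproj_eigen[of \<delta> a g n 0 1] \<delta> root[OF g(1)] n by simp
      ultimately have "\<delta> g = \<delta> 1" using n by simp
      thus False using g(2) by (simp add: \<delta>_def)
    qed
    then obtain k y0 where k: "0 < k" "k < n" "eigenproj n g k \<delta> y0 \<noteq> 0" by auto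
    define v where "v = eigenproj n g k \<delta>"
    have \<delta>': "coprime y a" if "\<delta> y \<noteq> 0" for y
      using that cong_imp_coprime[of "1::nat" y a] by (auto simp: \<delta>_def cong_sym_eq split: if_splits)
    have "v (y + a) = v y" for y unfolding v_def by (rule eigenproj_periodic) (rule \<delta>)
    moreover have "coprime y a" if "v y \<noteq> 0" for y
      by (rule eigenproj_support[OF \<delta>' that[unfolded v_def]])
    moreover have "v (g * y) = inverse (unity_root n ^ k) * v y" for y
      unfolding v_def by (rule eigenproj_eigen[of \<delta>, OF \<delta> root[OF g(1)] n])
    moreover have "inverse (unity_root n ^ k) \<noteq> 1" using unity_root_power_neq_1[OF k(1,2)] by simp
    moreover have "v y0 \<noteq> 0" using k(3) by (simp add: v_def)
    ultimately show ?case by blast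
  next
    case (insert x X)
    hence "\<forall>x\<in>X. coprime x a" by simp
    from insert.IH[OF this] obtain u :: "nat \<Rightarrow> complex" and y0 \<omega> where u': "(\<forall>y. u (y + a) = u y) \<and> (\<forall>y. u y \<noteq> 0 \<longrightarrow> coprime y a) \<and> u y0 \<noteq> 0 \<and>
       \<omega> \<noteq> 1 \<and> (\<forall>y. u (g * y) = \<omega> * u y) \<and> (\<forall>x\<in>X. \<exists>c. \<forall>y. u (x * y) = c * u y)"
      by (elim exE) (rule that)
    hence u: "\<And>y. u (y + a) = u y" "\<And>y. u y \<noteq> 0 \<Longrightarrow> coprime y a" "u y0 \<noteq> 0"
       "\<omega> \<noteq> 1" "\<And>y. u (g * y) = \<omega> * u y" "\<And>x. x \<in> X \<Longrightarrow> \<exists>c. \<forall>y. u (x * y) = c * u y"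
      by blast+
    have x: "coprime x a" using insert by simp
    have "\<exists>k<n. eigenproj n x k u y0 \<noteq> 0"
    proof (rule ccontr)
      assume "\<not> ?thesis"
      hence "(\<Sum>k<n. eigenproj n x k u y0) = 0" by (intro sum.neutral) auto
      thus False using u(3) n by (simp add: sum_eigenproj)
    qed
    then obtain k where k: "eigenproj n x k u y0 \<noteq> 0" by auto
    define v where "v = eigenproj n x k u"
    \<comment> \<open>Projections are sums of translations and commute with every translation, so
      eigenvalues obtained earlier are kept.\<close>
    have keep: "v (z * y) = c * v y" if "\<And>y. u (z * y) = c * u y" for z c y
    proof -
      have "u (x ^ j * (z * y)) = c * u (x ^ j * y)" for j
        using that[of "x ^ j * y"] by (simp add: mult_ac)
      thus ?thesis unfolding v_def eigenproj_def sum_distrib_left by (intro sum.cong refl) (simp add: mult_ac)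
    qed
    have "v (y + a) = v y" for y unfolding v_def by (rule eigenproj_periodic) (rule u(1))
    moreover have "coprime y a" if "v y \<noteq> 0" for y
      by (rule eigenproj_support[OF u(2) that[unfolded v_def]])
    moreover have "v (g * y) = \<omega> * v y" for y by (rule keep) (rule u(5))
    moreover have "\<exists>c. \<forall>y. v (z * y) = c * v y" if "z \<in> insert x X" for z
    proof (cases "z = x")
      case True
      have "v (x * y) = inverse (unity_root n ^ k) * v y" for y
        unfolding v_def by (rule eigenproj_eigen[of u, OF u(1) root[OF x] n])
      thus ?thesis using True by blast
    next
      case False
      thus ?thesis using u(6)[of z] that keep by blast
    qed
    moreover have "v y0 \<noteq> 0" using k by (simp add: v_def)
    ultimately show ?case using u(4) by blast
  qed
  have "finite {x. x < a \<and> coprime x a}" "\<forall>x\<in>{x. x < a \<and> coprime x a}. coprime x a" by auto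
  from claim[OF this] obtain v :: "nat \<Rightarrow> complex" and y0 \<omega> where v': "(\<forall>y. v (y + a) = v y) \<and> (\<forall>y. v y \<noteq> 0 \<longrightarrow> coprime y a) \<and> v y0 \<noteq> 0 \<and>
       \<omega> \<noteq> 1 \<and> (\<forall>y. v (g * y) = \<omega> * v y) \<and> (\<forall>x\<in>{x. x < a \<and> coprime x a}. \<exists>c. \<forall>y. v (x * y) = c * v y)"
    by (elim exE) (rule that)
  hence v: "\<And>y. v (y + a) = v y" "\<And>y. v y \<noteq> 0 \<Longrightarrow> coprime y a"
     "v y0 \<noteq> 0" "\<omega> \<noteq> 1" "\<And>y. v (g * y) = \<omega> * v y" "\<And>x. x < a \<Longrightarrow> coprime x a \<Longrightarrow> \<exists>c. \<forall>y. v (x * y) = c * v y"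
    by blast+
  have eig: "\<exists>c. \<forall>y. v (x * y) = c * v y" if "coprime x a" for x
  proof -
    have "v (x * y) = v (x mod a * y)" for y
      by (rule periodic_cong[of v, OF v(1)]) (simp add: cong_def mod_mult_left_eq)
    moreover have "coprime (x mod a) a" "x mod a < a" using that a by auto
    ultimately show ?thesis using v(6)[of "x mod a"] by auto
  qed
  \<comment> \<open>Some value \<open>v y0\<close> is nonzero and \<open>y0\<close> is a unit, so it
    is an eigenvalue times \<open>v 1\<close>; this permits division by \<open>v 1\<close>.\<close>
  have v1: "v 1 \<noteq> 0"
  proof -
    obtain c where "v (y0 * 1) = c * v 1" using eig[OF v(2)[OF v(3)]] by blast
    thus ?thesis using v(3) by auto
  qed
  define \<xi> where "\<xi> = (\<lambda>y. v y / v 1)"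
  have mult: "\<xi> (x * y) = \<xi> x * \<xi> y" for x y
  proof (cases "coprime x a")
    case True
    then obtain c where c: "\<And>y. v (x * y) = c * v y" using eig by blast
    show ?thesis using c[of y] c[of 1] v1 by (simp add: \<xi>_def)
  next
    case False
    hence "v x = 0" "v (x * y) = 0" using v(2)[of x] v(2)[of "x * y"] by auto
    thus ?thesis by (simp add: \<xi>_def)
  qed
  have "\<xi> x = 0 \<longleftrightarrow> \<not> coprime x a" for x
  proof
    assume z: "\<xi> x = 0"
    show "\<not> coprime x a"
    proof
      assume "coprime x a"
      hence "\<xi> (x ^ n) = \<xi> 1" unfolding \<xi>_def using periodic_cong[of v, OF v(1) root] by simp
      moreover have "\<xi> (x ^ n) = 0" using z n mult[of x "x ^ (n - 1)"] by (cases n) auto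
      ultimately show False using v1 by (simp add: \<xi>_def)
    qed
  qed (use v(2)[of x] in \<open>auto simp: \<xi>_def\<close>)
  hence "\<xi> \<in> dchars a" using mult v v1 by (auto simp: dchars_def \<xi>_def)
  moreover have "\<xi> g \<noteq> 1" using v(5)[of 1] v(4) v1 by (simp add: \<xi>_def)
  ultimately show ?thesis by blast
qed

section \<open>Orthogonality of characters\<close>

text \<open>Multiplication by a character \<psi> with \<open>\<psi> n \<noteq> 1\<close> permutes
  \<open>dchars a\<close>, so the sum equals \<open>\<psi> n\<close> times itself. At a non-unit
  every term is 0.\<close>

lemma sum_over_dchars_aux:
  assumes a: "a > 0" and n: "\<not> [n = 1] (mod a)"
  shows "(\<Sum>\<xi>\<in>dchars a. \<xi> n) = 0"
proof (cases "coprime n a")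
  case True
  obtain \<psi> where \<psi>: "\<psi> \<in> dchars a" "\<psi> n \<noteq> 1" using separating_dchar[OF a True n] by blast
  define m where "m = (\<lambda>\<xi>::nat \<Rightarrow> complex. \<lambda>k. \<psi> k * \<xi> k)"
  have "inj_on m (dchars a)"
  proof (rule inj_onI)
    fix x y assume *: "x \<in> dchars a" "y \<in> dchars a" "m x = m y"
    show "x = y"
    proof
      fix k
      have "\<psi> k * x k = \<psi> k * y k" using *(3) by (simp add: m_def fun_eq_iff)
      thus "x k = y k" using dcharsD(4)[OF \<psi>(1), of k] dcharsD(4)[OF *(1), of k] dcharsD(4)[OF *(2), of k]
        by (cases "coprime k a") auto
    qed
  qed
  moreover have "m ` dchars a \<subseteq> dchars a" using mult_dchars[OF \<psi>(1)] by (auto simp: m_def)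
  ultimately have "bij_betw m (dchars a) (dchars a)"
    by (simp add: bij_betw_def endo_inj_surj finite_dchars[OF a])
  hence "(\<Sum>\<xi>\<in>dchars a. \<xi> n) = (\<Sum>\<xi>\<in>dchars a. m \<xi> n)" by (rule sum.reindex_bij_betw[symmetric])
  also have "\<dots> = \<psi> n * (\<Sum>\<xi>\<in>dchars a. \<xi> n)" by (simp add: m_def sum_distrib_left)
  finally show ?thesis using \<psi>(2) by (simp add: algebra_simps)
next
  case False
  thus ?thesis by (intro sum.neutral) (auto simp: dcharsD)
qed

lemma sum_dchars_1:
  assumes "[n = 1] (mod a)"
  shows "(\<Sum>\<xi>\<in>dchars a. \<xi> n) = of_nat (card (dchars a))"
proof -
  have "\<xi> n = 1" if "\<xi> \<in> dchars a" for \<xi> using dchars_cong[OF that assms] dcharsD(1)[OF that] by simp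
  hence "(\<Sum>\<xi>\<in>dchars a. \<xi> n) = (\<Sum>\<xi>\<in>dchars a. 1)" by (intro sum.cong refl)
  thus ?thesis by simp
qed

lemma sum_principal_dchar:
  assumes "a > 0" shows "(\<Sum>n<a. principal_dchar a n) = of_nat (totient a)"
proof -
  have "(\<Sum>n<a. principal_dchar a n) = of_nat (card {n\<in>{..<a}. coprime n a})"
    by (simp add: principal_dchar_def sum.If_cases Int_def)
  also have "card {n\<in>{..<a}. coprime n a} = totient a"
  proof (cases "a = 1")
    case False
    have "{n\<in>{..<a}. coprime n a} = totatives a"
      using assms False by (auto simp: totatives_def intro!: Nat.gr0I le_neq_implies_less)
    thus ?thesis by (simp add: totient_def)
  qed auto
  finally show ?thesis .
qed

text \<open>Both sides evaluate the double sum of \<open>\<xi> n\<close> over characters and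
  residues: summing over \<open>n\<close> first leaves only the principal character, summing over
  \<xi> first leaves only \<open>n = 1\<close>, which is below \<open>a\<close> since
  \<open>a > 1\<close>.\<close>

lemma card_dchars:
  assumes a: "a > 1" shows "card (dchars a) = totient a"
proof -
  have "complex_of_nat (totient a) = (\<Sum>\<xi>\<in>{principal_dchar a}. \<Sum>n<a. \<xi> n)" using a by (simp add: sum_principal_dchar)
  also have "\<dots> = (\<Sum>\<xi>\<in>dchars a. \<Sum>n<a. \<xi> n)"
    by (rule sum.mono_neutral_left) (use a principal_dchar_in finite_dchars sum_dchars_eq_0 in auto)
  also have "\<dots> = (\<Sum>n<a. \<Sum>\<xi>\<in>dchars a. \<xi> n)" by (rule sum.swap)
  also have "\<dots> = (\<Sum>n\<in>{1}. \<Sum>\<xi>\<in>dchars a. \<xi> n)"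
    by (rule sum.mono_neutral_right) (use a in \<open>auto intro!: sum_over_dchars_aux simp: cong_def\<close>)
  also have "\<dots> = of_nat (card (dchars a))" by (simp add: sum_dchars_1)
  finally show ?thesis by (simp only: of_nat_eq_iff)
qed

text \<open>Values at units have modulus 1, so \<open>cnj (\<xi> r)\<close> is the value of \<xi> at
  an inverse \<open>r'\<close> of \<open>r\<close>, and the sum is the sum of
  \<open>\<xi> (r' * n)\<close>.\<close>

theorem dchars_orthogonality:
  assumes a: "a > 1" and r: "coprime r a"
  shows "(\<Sum>\<xi>\<in>dchars a. cnj (\<xi> r) * \<xi> n) = (if [n = r] (mod a) then of_nat (totient a) else 0)"
proof -
  define r' where "r' = r ^ (totient a - 1)"
  have "r * r' = r ^ totient a" using a by (cases "totient a") (auto simp: r'_def)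
  hence rr: "[r * r' = 1] (mod a)" using euler_theorem[OF r] by simp
  have cnj: "cnj (\<xi> r) = \<xi> r'" if "\<xi> \<in> dchars a" for \<xi>
  proof -
    have "\<xi> r * \<xi> r' = 1" using dchars_cong[OF that rr] dcharsD[OF that] by metis
    moreover have "\<xi> r * cnj (\<xi> r) = 1" using norm_dchars[OF _ that, of r] a r
      by (simp add: complex_norm_square [symmetric])
    ultimately show ?thesis by (metis mult_cancel_left zero_neq_one mult_zero_left)
  qed
  have "(\<Sum>\<xi>\<in>dchars a. cnj (\<xi> r) * \<xi> n) = (\<Sum>\<xi>\<in>dchars a. \<xi> (r' * n))"
    by (intro sum.cong refl) (simp add: cnj dcharsD)
  moreover have "[r' * n = 1] (mod a) \<longleftrightarrow> [n = r] (mod a)"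
  proof
    assume "[n = r] (mod a)"
    hence "[r' * n = r' * r] (mod a)" by (rule cong_scalar_left)
    thus "[r' * n = 1] (mod a)" using rr by (metis cong_trans mult.commute)
  next
    assume "[r' * n = 1] (mod a)"
    hence "[r * (r' * n) = r * 1] (mod a)" by (rule cong_scalar_left)
    moreover have "[r * (r' * n) = 1 * n] (mod a)" using cong_scalar_right[OF rr, of n] by (simp add: mult.assoc)
    ultimately show "[n = r] (mod a)" by (metis cong_sym cong_trans mult_1 mult.right_neutral)
  qed
  ultimately show ?thesis using a by (simp add: sum_over_dchars_aux sum_dchars_1 card_dchars)
qed

section \<open>Dirichlet series\<close>

lemma holomorphic_series:
  fixes f :: "nat \<Rightarrow> complex \<Rightarrow> complex"
  assumes S: "open S" and f: "\<And>n. f n holomorphic_on S"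
    and bound: "\<And>x. x \<in> S \<Longrightarrow> \<exists>d>0. \<exists>h. summable h \<and> (\<forall>n. \<forall>y\<in>ball x d \<inter> S. norm (f n y) \<le> h n)"
  obtains g where "g holomorphic_on S" "\<And>x. x \<in> S \<Longrightarrow> (\<lambda>n. f n x) sums g x"
    "\<And>x. x \<in> S \<Longrightarrow> (\<lambda>n. deriv (f n) x) sums deriv g x"
proof -
  have "\<exists>g g'. \<forall>x\<in>S. (\<lambda>n. f n x) sums g x \<and> (\<lambda>n. deriv (f n) x) sums g' x \<and> (g has_field_derivative g' x) (at x)"
  proof (rule series_and_derivative_comparison_complex[OF S])
    show "(f n has_field_derivative deriv (f n) x) (at x)" if "x \<in> S" for n x
      using holomorphic_derivI[OF f S that] .
    fix x assume x: "x \<in> S"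
    from bound[OF this] obtain d h where dh: "d > 0" "summable h" "\<And>n y. y \<in> ball x d \<inter> S \<Longrightarrow> norm (f n y) \<le> h n"
      by blast
    have "h n \<ge> 0" for n using dh(3)[of x n] dh(1) x by (meson IntI centre_in_ball norm_ge_zero order_trans)
    thus "\<exists>d h. 0 < d \<and> summable h \<and> range h \<subseteq> \<real>\<^sub>\<ge>\<^sub>0 \<and> (\<forall>\<^sub>F n in sequentially. \<forall>y\<in>ball x d \<inter> S. cmod (f n y) \<le> cmod (h n))"
      using dh by (intro exI[of _ d] exI[of _ "\<lambda>n. complex_of_real (h n)"])
        (auto intro!: always_eventually summable_of_real)
  qed
  then obtain g g' where g: "\<And>x. x \<in> S \<Longrightarrow> (\<lambda>n. f n x) sums g x" "\<And>x. x \<in> S \<Longrightarrow> (\<lambda>n. deriv (f n) x) sums g' x"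
     "\<And>x. x \<in> S \<Longrightarrow> (g has_field_derivative g' x) (at x)" by blast
  show ?thesis
  proof (rule that)
    show "g holomorphic_on S" using g(3) S by (auto simp: holomorphic_on_open)
    show "(\<lambda>n. deriv (f n) x) sums deriv g x" if "x \<in> S" for x
      using g(2)[OF that] DERIV_imp_deriv[OF g(3)[OF that]] by simp
  qed (use g in auto)
qed

lemma summable_Suc_powr: "p > 1 \<Longrightarrow> summable (\<lambda>n. real (Suc n) powr - p)"
  using summable_real_powr_iff[of "- p"] summable_Suc_iff[of "\<lambda>n. real n powr - p"] by (simp del: of_nat_Suc)

lemma norm_of_nat_powr: "norm (of_nat n powr s :: complex) = real n powr Re s"
  by (subst norm_powr_real_powr) auto

section \<open>Continuation of L-functions to Re s > 0\<close>

text \<open>Mean value inequality along the real ray from \<open>n\<close>, taken as a convex subset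
  of the complex plane. The gain of one power of \<open>n\<close> is what moves convergence from Re
  s > 1 to Re s > 0.\<close>

lemma powr_diff_bound:
  assumes "n > 0" "real n \<le> x" "x \<le> real n + 1" "Re s > 0"
  shows "norm (complex_of_real x powr (- s) - of_nat n powr (- s)) \<le> norm s * real n powr (- Re s - 1)"
proof -
  define A where "A = {z. Im z = 0 \<and> Re z \<ge> real n}"
  have "norm (complex_of_real x powr (- s) - complex_of_real (real n) powr (- s)) \<le>
          norm s * real n powr (- Re s - 1) * norm (complex_of_real x - complex_of_real (real n))"
  proof (rule field_differentiable_bound[of A])
    have A_eq: "A = {z. Im z \<ge> 0} \<inter> {z. Im z \<le> 0} \<inter> {z. Re z \<ge> real n}" by (auto simp: A_def)
    show "convex A"
      unfolding A_eq by (intro convex_Int convex_halfspace_Im_ge convex_halfspace_Im_le convex_halfspace_Re_ge)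
    show "((\<lambda>z. z powr (- s)) has_field_derivative (- s * z powr (- s - 1))) (at z within A)" if "z \<in> A" for z
      using that assms by (intro has_field_derivative_at_within[OF has_field_derivative_powr])
         (auto simp: A_def complex_nonpos_Reals_iff)
    show "norm (- s * z powr (- s - 1)) \<le> norm s * real n powr (- Re s - 1)" if "z \<in> A" for z
    proof -
      have "norm (z powr (- s - 1)) = Re z powr (- Re s - 1)"
        using that assms by (subst norm_powr_real_powr) (auto simp: A_def complex_is_Real_iff)
      also have "\<dots> \<le> real n powr (- Re s - 1)" using that assms by (intro powr_mono2') (auto simp: A_def)
      finally show ?thesis by (simp add: norm_mult mult_left_mono)
    qed
  qed (use assms in \<open>auto simp: A_def\<close>)
  moreover have "norm (complex_of_real x - complex_of_real (real n)) \<le> 1"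
    unfolding of_real_diff [symmetric] norm_of_real using assms by simp
  hence "norm s * real n powr (- Re s - 1) * norm (complex_of_real x - complex_of_real (real n)) \<le> norm s * real n powr (- Re s - 1) * 1"
    by (intro mult_left_mono) auto
  ultimately show ?thesis by simp
qed

text \<open>On the ball around \<open>x\<close> of radius Re x / 2 the exponent stays below -1 by a
  fixed amount and the polynomial factor is bounded. Degree 2 in \<open>norm s\<close> also covers
  the zeta function, whose terms carry a factor s - 1 besides the factor from
  \<open>powr_diff_bound\<close>.\<close>

lemma locally_bounded_majorant:
  fixes f :: "nat \<Rightarrow> complex \<Rightarrow> complex"
  assumes bd: "\<And>n s. Re s > 0 \<Longrightarrow> norm (f n s) \<le> K * (norm s + 1)\<^sup>2 * real (Suc n) powr (- Re s - 1)"
    and K: "K \<ge> 0" and x: "Re x > 0"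
  shows "\<exists>d>0. \<exists>h. summable h \<and> (\<forall>n. \<forall>y\<in>ball x d \<inter> {s. Re s > 0}. norm (f n y) \<le> h n)"
proof (intro exI conjI allI ballI)
  define d where "d = Re x / 2"
  show "d > 0" using x by (simp add: d_def)
  show "summable (\<lambda>n. K * (norm x + d + 1)\<^sup>2 * real (Suc n) powr - (d + 1))"
    using x by (intro summable_mult summable_Suc_powr) (simp add: d_def)
  fix n y assume y: "y \<in> ball x d \<inter> {s. Re s > 0}"
  hence "norm y \<le> norm x + d" using norm_triangle_ineq2[of y x] by (simp add: dist_norm norm_minus_commute)
  moreover have "Re y \<ge> d"
    using y abs_Re_le_cmod[of "x - y"] by (auto simp: dist_norm d_def)
  ultimately have "K * (norm y + 1)\<^sup>2 * real (Suc n) powr (- Re y - 1) \<le> K * (norm x + d + 1)\<^sup>2 * real (Suc n) powr - (d + 1)"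
    using K by (intro mult_mono power_mono powr_mono zero_le_power2 mult_nonneg_nonneg powr_ge_zero) simp_all
  moreover have "norm (f n y) \<le> K * (norm y + 1)\<^sup>2 * real (Suc n) powr (- Re y - 1)" using bd y by blast
  ultimately show "norm (f n y) \<le> K * (norm x + d + 1)\<^sup>2 * real (Suc n) powr - (d + 1)" by linarith
qed

text \<open>Summation by parts: \<open>f n\<close> is a partial sum times a difference of
  consecutive powers, which is summable for Re s > 0, and the boundary term
  \<open>C m * N m s\<close> tends to 0.\<close>

lemma dirichlet_series_bounded_partial_sums:
  fixes c :: "nat \<Rightarrow> complex"
  assumes M: "\<And>n. norm (\<Sum>k<n. c k) \<le> M"
  obtains D where "D holomorphic_on {s. Re s > 0}"
    "\<And>s. Re s > 0 \<Longrightarrow> (\<lambda>n. c n * of_nat (Suc n) powr (- s)) sums D s"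
proof -
  define C where "C = (\<lambda>n. \<Sum>k<n. c k)"
  define N where "N = (\<lambda>n s. (of_nat (Suc n) :: complex) powr (- s))"
  define f where "f = (\<lambda>n s. C (Suc n) * (N n s - N (Suc n) s))"
  have M0: "M \<ge> 0" using M[of 0] by simp
  have S: "open {s. Re s > 0}" by (simp add: open_halfspace_Re_gt)
  have bd: "norm (f n s) \<le> M * (norm s + 1)\<^sup>2 * real (Suc n) powr (- Re s - 1)" if "Re s > 0" for n s
  proof -
    have "norm (N n s - N (Suc n) s) \<le> norm s * real (Suc n) powr (- Re s - 1)"
      using powr_diff_bound[of "Suc n" "real (Suc (Suc n))" s] that
      by (simp add: N_def norm_minus_commute)
    also have "norm s \<le> (norm s + 1)\<^sup>2" by (simp add: power2_eq_square algebra_simps)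
    finally have "norm (N n s - N (Suc n) s) \<le> (norm s + 1)\<^sup>2 * real (Suc n) powr (- Re s - 1)"
      by (simp add: mult_right_mono)
    thus ?thesis unfolding f_def norm_mult using M[of "Suc n"] M0
      by (simp add: C_def mult.assoc mult_mono)
  qed
  obtain D where D: "D holomorphic_on {s. Re s > 0}" "\<And>s. s \<in> {s. Re s > 0} \<Longrightarrow> (\<lambda>n. f n s) sums D s"
  proof (rule holomorphic_series[OF S, of f])
    show "f n holomorphic_on {s. Re s > 0}" for n
      unfolding f_def N_def by (intro holomorphic_intros)
    show "\<exists>d>0. \<exists>h. summable h \<and> (\<forall>n. \<forall>y\<in>ball x d \<inter> {s. Re s > 0}. norm (f n y) \<le> h n)" if "x \<in> {s. Re s > 0}" for x
      by (rule locally_bounded_majorant[OF bd M0]) (use that in auto)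
  qed auto
  have "(\<lambda>n. c n * of_nat (Suc n) powr (- s)) sums D s" if s: "Re s > 0" for s
  proof -
    have "(\<Sum>k<m. c k * N k s) = (\<Sum>k<m. f k s) + C m * N m s" for m
      by (induction m) (auto simp: f_def C_def algebra_simps)
    moreover have "(\<lambda>m. C m * N m s) \<longlonglongrightarrow> 0"
    proof (rule Lim_null_comparison)
      show "\<forall>\<^sub>F m in sequentially. norm (C m * N m s) \<le> M * real (Suc m) powr (- Re s)"
        using M by (auto simp: norm_mult N_def C_def norm_of_nat_powr simp del: of_nat_Suc intro!: always_eventually mult_right_mono)
      show "(\<lambda>m. M * real (Suc m) powr (- Re s)) \<longlonglongrightarrow> 0" using s by real_asymp
    qed
    moreover have "(\<lambda>m. \<Sum>k<m. f k s) \<longlonglongrightarrow> D s" using D(2)[of s] s by (simp add: sums_def)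
    ultimately show ?thesis unfolding sums_def N_def using tendsto_add by fastforce
  qed
  with D(1) show ?thesis by (rule that)
qed

text \<open>\<open>Z s\<close> is (s - 1) zeta(s). The \<open>n\<close>-th term compares (s - 1)
  m^(-s) for \<open>m = Suc n\<close> with the integral of (s - 1) x^(-s) over [m, m + 1], which is
  \<open>Q n s - Q (Suc n) s\<close>.\<close>

lemma zeta_continuation:
  obtains Z where "Z holomorphic_on {s. Re s > 0}" "Z 1 = 1"
    "\<And>s. Re s > 1 \<Longrightarrow> (\<lambda>n. of_nat (Suc n) powr (- s)) sums (Z s / (s - 1))"
proof -
  define N where "N = (\<lambda>n s. (of_nat (Suc n) :: complex) powr (- s))"
  define Q where "Q = (\<lambda>n s. (of_nat (Suc n) :: complex) powr (1 - s))"
  define f where "f = (\<lambda>n s. (s - 1) * N n s - Q n s + Q (Suc n) s)"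
  have S: "open {s. Re s > 0}" by (simp add: open_halfspace_Re_gt)
  have bd: "norm (f n s) \<le> 1 * (norm s + 1)\<^sup>2 * real (Suc n) powr (- Re s - 1)" if s: "Re s > 0" for n s
  proof -
    define m where "m = Suc n"
    \<comment> \<open>The increment of \<open>G\<close> from \<open>m\<close> to
      \<open>m + 1\<close> is \<open>f n s\<close>, and its derivative is (s - 1) times a difference
      of powers that \<open>powr_diff_bound\<close> controls.\<close>
    define G where "G = (\<lambda>z. z powr (1 - s) + (s - 1) * N n s * z)"
    define A where "A = {z. Im z = 0 \<and> Re z \<ge> real m \<and> Re z \<le> real m + 1}"
    have m: "m > 0" by (simp add: m_def)
    have "norm (G (of_nat (Suc m)) - G (of_nat m)) \<le> norm (s - 1) * (norm s * real m powr (- Re s - 1)) * norm (of_nat (Suc m) - of_nat m :: complex)"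
    proof (rule field_differentiable_bound[of A])
      have A_eq: "A = {z. Im z \<ge> 0} \<inter> {z. Im z \<le> 0} \<inter> {z. Re z \<ge> real m} \<inter> {z. Re z \<le> real m + 1}" by (auto simp: A_def)
      show "convex A"
        unfolding A_eq by (intro convex_Int convex_halfspace_Im_ge convex_halfspace_Im_le convex_halfspace_Re_ge convex_halfspace_Re_le)
      show "(G has_field_derivative ((s - 1) * (N n s - z powr (- s)))) (at z within A)" if "z \<in> A" for z
      proof -
        have "z \<notin> \<real>\<^sub>\<le>\<^sub>0" using that m by (auto simp: A_def complex_nonpos_Reals_iff)
        hence "(G has_field_derivative ((1 - s) * z powr (1 - s - 1) + (s - 1) * N n s)) (at z)"
          unfolding G_def by (intro DERIV_add has_field_derivative_powr DERIV_cmult_Id)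
        also have "(1 - s) * z powr (1 - s - 1) + (s - 1) * N n s = (s - 1) * (N n s - z powr (- s))"
          by (simp add: algebra_simps)
        finally show ?thesis by (rule has_field_derivative_at_within)
      qed
      show "norm ((s - 1) * (N n s - z powr (- s))) \<le> norm (s - 1) * (norm s * real m powr (- Re s - 1))" if "z \<in> A" for z
      proof -
        have "z = complex_of_real (Re z)" using that by (auto simp: A_def complex_eq_iff)
        hence "norm (N n s - z powr (- s)) \<le> norm s * real m powr (- Re s - 1)"
          using powr_diff_bound[OF m, of "Re z" s] that s by (simp add: A_def N_def m_def norm_minus_commute)
        thus ?thesis by (simp add: norm_mult mult_left_mono)
      qed
    qed (auto simp: A_def)
    also have "G (of_nat (Suc m)) - G (of_nat m) = f n s"
      by (simp add: G_def f_def Q_def N_def m_def algebra_simps)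
    also have "norm (of_nat (Suc m) - of_nat m :: complex) = 1" by simp
    also have "norm (s - 1) * (norm s * real m powr (- Re s - 1)) * 1 \<le> (norm s + 1) * ((norm s + 1) * real m powr (- Re s - 1))"
      unfolding mult_1_right using norm_triangle_ineq4[of s 1] by (intro mult_mono) auto
    finally show ?thesis by (simp add: m_def power2_eq_square mult.assoc)
  qed
  obtain E where E: "E holomorphic_on {s. Re s > 0}" "\<And>s. s \<in> {s. Re s > 0} \<Longrightarrow> (\<lambda>n. f n s) sums E s"
  proof (rule holomorphic_series[OF S, of f])
    show "f n holomorphic_on {s. Re s > 0}" for n
      unfolding f_def N_def Q_def by (intro holomorphic_intros)
    show "\<exists>d>0. \<exists>h. summable h \<and> (\<forall>n. \<forall>y\<in>ball x d \<inter> {s. Re s > 0}. norm (f n y) \<le> h n)" if "x \<in> {s. Re s > 0}" for x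
      by (rule locally_bounded_majorant[OF bd]) (use that in auto)
  qed auto
  show ?thesis
  proof (rule that[of "\<lambda>s. 1 + E s"])
    show "(\<lambda>s. 1 + E s) holomorphic_on {s. Re s > 0}" by (intro holomorphic_intros E)
    have "f n 1 = 0" for n using of_nat_neq_0[where ?'a = complex] by (simp add: f_def Q_def del: of_nat_Suc)
    hence "(\<lambda>n. 0) sums E 1" using E(2)[of 1] by simp
    thus "1 + E 1 = 1" using sums_unique2[OF sums_zero] by simp
    fix s :: complex assume s: "Re s > 1"
    have s1: "s - 1 \<noteq> 0" using s by (auto simp: complex_eq_iff)
    have Q0: "(\<lambda>m. Q m s) \<longlonglongrightarrow> 0"
    proof (rule Lim_null_comparison)
      show "\<forall>\<^sub>F m in sequentially. norm (Q m s) \<le> real (Suc m) powr (1 - Re s)"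
        by (auto simp: Q_def norm_of_nat_powr simp del: of_nat_Suc)
      show "(\<lambda>m. real (Suc m) powr (1 - Re s)) \<longlonglongrightarrow> 0" using s by real_asymp
    qed
    \<comment> \<open>the terms \<open>f k s\<close> were chosen to telescope like this while being \<open>O(k powr (- Re s - 1))\<close>\<close>
    have "(\<Sum>k<m. f k s) = (s - 1) * (\<Sum>k<m. N k s) - 1 + Q m s" for m
      by (induction m) (auto simp: f_def Q_def algebra_simps)
    hence eq: "(\<Sum>k<m. N k s) = (1 + (\<Sum>k<m. f k s) - Q m s) / (s - 1)" for m
      using s1 by (simp add: field_simps)
    have "(\<lambda>m. \<Sum>k<m. f k s) \<longlonglongrightarrow> E s" using E(2)[of s] s by (simp add: sums_def)
    hence "(\<lambda>m. (1 + (\<Sum>k<m. f k s) - Q m s) / (s - 1)) \<longlonglongrightarrow> (1 + E s - 0) / (s - 1)"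
      by (intro tendsto_intros Q0 s1)
    thus "(\<lambda>n. of_nat (Suc n) powr (- s)) sums ((1 + E s) / (s - 1))"
      unfolding sums_def eq[symmetric] by (simp add: N_def)
  qed
qed

text \<open>Complete periods sum to 0, so only an incomplete period of fewer than \<open>a\<close>
  terms remains.\<close>

lemma periodic_partial_sums_bounded:
  fixes f :: "nat \<Rightarrow> complex"
  assumes a: "a > 0" and per: "\<And>n. f (n + a) = f n" and zero: "(\<Sum>n<a. f n) = 0"
    and le: "\<And>n. norm (f n) \<le> K"
  shows "norm (\<Sum>k<n. f (Suc k)) \<le> real a * K"
proof -
  define g where "g = (\<lambda>n. f (Suc n))"
  have g0: "(\<Sum>n<a. g n) = 0"
    using sum.lessThan_Suc_shift[of f a] sum.lessThan_Suc[of f a] zero per[of 0] by (simp add: g_def)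
  have gper: "g (n + a) = g n" for n using per[of "Suc n"] by (simp add: g_def)
  have gper': "g (q * a + n) = g n" for q n
  proof (induction q)
    case (Suc q)
    thus ?case using gper[of "q * a + n"] by (simp add: add.commute add.left_commute)
  qed simp
  have split: "(\<Sum>k<q * a + r. g k) = (\<Sum>k<q * a. g k) + (\<Sum>k<r. g k)" for q r
    by (induction r) (auto simp: gper')
  have "(\<Sum>k<q * a. g k) = 0" for q
  proof (induction q)
    case (Suc q)
    thus ?case using split[of q a] g0 by (simp add: add.commute)
  qed simp
  hence "(\<Sum>k<n. g k) = (\<Sum>k<n mod a. g k)" using split[of "n div a" "n mod a"] by simp
  hence "norm (\<Sum>k<n. g k) \<le> (\<Sum>k<n mod a. K)" unfolding g_def using le by (simp only:) (intro sum_norm_le)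
  also have "\<dots> = real (n mod a) * K" by simp
  also have "\<dots> \<le> real a * K" using a order_trans[OF norm_ge_zero le[of 0]] by (intro mult_right_mono) (auto simp: less_imp_le)
  finally show ?thesis by (simp add: g_def)
qed

text \<open>As \<open>0 powr s = 0\<close>, a Dirichlet series may start at \<open>n = 0\<close>.\<close>

lemma sums_from_Suc:
  fixes c :: "nat \<Rightarrow> complex"
  assumes "(\<lambda>n. c (Suc n) * of_nat (Suc n) powr (- s)) sums l"
  shows "(\<lambda>n. c n * of_nat n powr (- s)) sums l"
  using assms by (subst (asm) sums_Suc_iff) simp

lemma nonprincipal_L:
  assumes a: "a > 0" and x: "x \<in> dchars a" "x \<noteq> principal_dchar a"
  obtains L where "L holomorphic_on {s. Re s > 0}"
    "\<And>s. Re s > 0 \<Longrightarrow> (\<lambda>n. x n * of_nat n powr (- s)) sums L s"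
proof -
  have bd: "norm (\<Sum>k<n. x (Suc k)) \<le> real a * 1" for n
    by (rule periodic_partial_sums_bounded[OF a])
       (use dcharsD(3)[OF x(1)] sum_dchars_eq_0[OF a x] norm_dchars[OF a x(1)] in simp_all)
  obtain D where "D holomorphic_on {s. Re s > 0}"
    "\<And>s. Re s > 0 \<Longrightarrow> (\<lambda>n. x (Suc n) * of_nat (Suc n) powr (- s)) sums D s"
    by (rule dirichlet_series_bounded_partial_sums[OF bd]) blast
  thus ?thesis using that sums_from_Suc by blast
qed

text \<open>Subtracting the mean value \<open>m\<close> leaves coefficients with bounded partial
  sums, hence a function \<open>D\<close> holomorphic for Re s > 0. The mean contributes
  \<open>m\<close> times the zeta function, and so the value \<open>m\<close> of \<open>S\<close> at
  1.\<close>

lemma principal_L: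
  assumes a: "a > 0"
  obtains S where "S holomorphic_on {s. Re s > 0}" "S 1 \<noteq> 0"
    "\<And>s. Re s > 1 \<Longrightarrow> (\<lambda>n. principal_dchar a n * of_nat n powr (- s)) sums (S s / (s - 1))"
proof -
  define m where "m = complex_of_nat (totient a) / of_nat a"
  have bd: "norm (\<Sum>k<n. principal_dchar a (Suc k) - m) \<le> real a * (1 + norm m)" for n
  proof (rule periodic_partial_sums_bounded[OF a, of "\<lambda>n. principal_dchar a n - m"])
    show "principal_dchar a (n + a) - m = principal_dchar a n - m" for n using dcharsD(3)[OF principal_dchar_in] by simp
    show "(\<Sum>n<a. principal_dchar a n - m) = 0" using a by (simp add: sum_subtractf sum_principal_dchar m_def)
    have "norm (principal_dchar a n) \<le> 1" for n by (simp add: principal_dchar_def)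
    thus "norm (principal_dchar a n - m) \<le> 1 + norm m" for n
      by (meson add_right_mono norm_triangle_ineq4 order_trans)
  qed
  obtain D where D: "D holomorphic_on {s. Re s > 0}"
    "\<And>s. Re s > 0 \<Longrightarrow> (\<lambda>n. (principal_dchar a (Suc n) - m) * of_nat (Suc n) powr (- s)) sums D s"
    by (rule dirichlet_series_bounded_partial_sums[OF bd]) blast
  obtain Z where Z: "Z holomorphic_on {s. Re s > 0}" "Z 1 = 1"
    "\<And>s. Re s > 1 \<Longrightarrow> (\<lambda>n. of_nat (Suc n) powr (- s)) sums (Z s / (s - 1))"
    using zeta_continuation by blast
  show ?thesis
  proof (rule that[of "\<lambda>s. m * Z s + (s - 1) * D s"])
    show "(\<lambda>s. m * Z s + (s - 1) * D s) holomorphic_on {s. Re s > 0}" by (intro holomorphic_intros D Z)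
    show "m * Z 1 + (1 - 1) * D 1 \<noteq> 0" using a Z(2) by (simp add: m_def)
    fix s :: complex assume s: "Re s > 1"
    hence s1: "s - 1 \<noteq> 0" by (auto simp: complex_eq_iff)
    have "(\<lambda>n. m * of_nat (Suc n) powr (- s) + (principal_dchar a (Suc n) - m) * of_nat (Suc n) powr (- s)) sums (m * (Z s / (s - 1)) + D s)"
      using s by (intro sums_add sums_mult Z D) auto
    also have "m * (Z s / (s - 1)) + D s = (m * Z s + (s - 1) * D s) / (s - 1)" using s1 by (simp add: field_simps)
    finally show "(\<lambda>n. principal_dchar a n * of_nat n powr (- s)) sums ((m * Z s + (s - 1) * D s) / (s - 1))"
      by (intro sums_from_Suc) (simp add: algebra_simps)
  qed
qed

section \<open>Dirichlet convolution and the logarithmic derivative\<close>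

text \<open>Pairs of positive integers are grouped by their product. This serves both the product of
  two Dirichlet series and, later, the Lambert series of Monsky's argument.\<close>

lemma divisor_regroup:
  fixes h :: "nat \<times> nat \<Rightarrow> 'b :: {topological_comm_monoid_add, t3_space}"
  assumes "(h has_sum P) ({0<..} \<times> {0<..})"
  shows "((\<lambda>n. \<Sum>d | d dvd n. h (d, n div d)) has_sum P) {0<..}"
proof -
  define B where "B = (\<lambda>n::nat. {d. d dvd n})"
  have "bij_betw (\<lambda>(n, d). (d, n div d)) (Sigma {0<..} B) ({0<..} \<times> {0<..})"
  proof (rule bij_betw_byWitness[where f' = "\<lambda>(d, m). (d * m, d)"])
    show "(\<lambda>(n, d). (d, n div d)) ` Sigma {0<..} B \<subseteq> {0<..} \<times> {0<..}"
      by (auto simp: B_def div_greater_zero_iff dvd_imp_le dvd_pos_nat)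
  qed (auto simp: B_def)
  hence "((\<lambda>z. h (case z of (n, d) \<Rightarrow> (d, n div d))) has_sum P) (Sigma {0<..} B)"
    using assms by (subst has_sum_reindex_bij_betw)
  hence "((\<lambda>n. \<Sum>d\<in>B n. h (d, n div d)) has_sum P) {0<..}"
    by (rule has_sum_SigmaD) (auto simp: B_def)
  thus ?thesis by (simp add: B_def)
qed

lemma dirichlet_product:
  fixes f g :: "nat \<Rightarrow> complex"
  assumes f: "summable (\<lambda>n. norm (f n))" "f sums A" "f 0 = 0"
    and g: "summable (\<lambda>n. norm (g n))" "g sums B" "g 0 = 0"
  shows "(\<lambda>n. \<Sum>d | d dvd n. f d * g (n div d)) sums (A * B)"
proof -
  define h where "h = (\<lambda>(d, m). f d * g m)"
  have hf: "(f has_sum A) {0<..}"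
    using norm_summable_imp_has_sum[OF f(1,2)] by (rule has_sum_cong_neutral[THEN iffD1, rotated -1]) (use f in auto)
  have hg: "(g has_sum B) {0<..}"
    using norm_summable_imp_has_sum[OF g(1,2)] by (rule has_sum_cong_neutral[THEN iffD1, rotated -1]) (use g in auto)
  have nf: "(\<lambda>n. norm (f n)) summable_on {0<..}"
    using norm_summable_imp_summable_on[of "\<lambda>n. norm (f n)"] f summable_on_subset_banach[OF _ subset_UNIV] by fastforce
  have ng: "(\<lambda>n. norm (g n)) summable_on {0<..}"
    using norm_summable_imp_summable_on[of "\<lambda>n. norm (g n)"] g summable_on_subset_banach[OF _ subset_UNIV] by fastforce
  obtain NB where NB: "((\<lambda>n. norm (g n)) has_sum NB) {0<..}" using ng by (auto simp: summable_on_def)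
  have "(\<lambda>z. norm (h z)) summable_on ({0<..} \<times> {0<..})"
  proof (rule summable_on_SigmaI)
    show "((\<lambda>y. norm (h (x, y))) has_sum norm (f x) * NB) {0<..}" for x
      using has_sum_cmult_right[OF NB, of "norm (f x)"] by (simp add: h_def norm_mult)
    show "(\<lambda>x. norm (f x) * NB) summable_on {0<..}" by (rule summable_on_cmult_left[OF nf])
  qed auto
  hence "h summable_on ({0<..} \<times> {0<..})" by (rule abs_summable_summable)
  hence "(h has_sum (A * B)) ({0<..} \<times> {0<..})"
  proof (rule has_sum_SigmaI[rotated 2])
    show "((\<lambda>y. h (x, y)) has_sum f x * B) {0<..}" for x
      using has_sum_cmult_right[OF hg, of "f x"] by (simp add: h_def)
    show "((\<lambda>x. f x * B) has_sum (A * B)) {0<..}" by (rule has_sum_cmult_left[OF hf])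
  qed
  from divisor_regroup[OF this] have "((\<lambda>n. \<Sum>d | d dvd n. f d * g (n div d)) has_sum (A * B)) {0<..}"
    by (simp add: h_def)
  \<comment> \<open>Every \<open>d\<close> divides 0, but each summand at \<open>n = 0\<close>
    contains the factor \<open>g 0 = 0\<close>.\<close>
  hence "((\<lambda>n. \<Sum>d | d dvd n. f d * g (n div d)) has_sum (A * B)) UNIV"
    by (rule has_sum_cong_neutral[THEN iffD1, rotated -1]) (use g in auto)
  thus ?thesis by (rule has_sum_imp_sums)
qed

lemma summable_ln_powr:
  assumes "p > 1" shows "summable (\<lambda>n. ln (real n) * real n powr - p)"
proof (rule summable_comparison_test)
  \<comment> \<open>Half of the excess of \<open>p\<close> over 1 absorbs the logarithm, the other
    half keeps the series convergent.\<close>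
  define d where "d = (p - 1) / 2"
  have d: "d > 0" "d - p < -1" using assms by (auto simp: d_def field_simps)
  show "summable (\<lambda>n. real n powr (d - p) / d)"
    using d by (intro summable_divide) (simp add: summable_real_powr_iff)
  show "\<exists>N. \<forall>n\<ge>N. norm (ln (real n) * real n powr - p) \<le> real n powr (d - p) / d"
  proof (intro exI[of _ 1] allI impI)
    fix n :: nat assume n: "n \<ge> 1"
    have "ln (real n) * real n powr - p \<le> real n powr d / d * real n powr - p"
      using n d by (intro mult_right_mono ln_powr_bound) auto
    also have "\<dots> = real n powr (d - p) / d" by (simp add: powr_diff powr_minus field_simps)
    finally show "norm (ln (real n) * real n powr - p) \<le> real n powr (d - p) / d" using n by simp
  qed
qed

text \<open>For a character this will be -L'/L on Re s > 1. Being a convergent series there, it is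
  available before L is known to be nonzero.\<close>

definition mangoldt_series :: "(nat \<Rightarrow> complex) \<Rightarrow> complex \<Rightarrow> complex" where
  "mangoldt_series x s = (\<Sum>n. mangoldt n * x n * of_nat n powr (- s))"

lemma norm_dchars_le: "a > 0 \<Longrightarrow> x \<in> dchars a \<Longrightarrow> norm (x n) \<le> 1"
  by (simp add: norm_dchars)

lemma dirichlet_term_bound:
  assumes "norm c \<le> C" "0 \<le> C" "p \<le> Re s"
  shows "norm (c * of_nat n powr (- s)) \<le> C * real n powr - p"
proof (cases "n = 0")
  case False
  have "real n powr - Re s \<le> real n powr - p" using False assms by (intro powr_mono) auto
  thus ?thesis using assms by (simp add: norm_mult norm_of_nat_powr mult_mono)
qed (use assms in auto)

lemma norm_mangoldt_le: "norm (x n) \<le> 1 \<Longrightarrow> norm (mangoldt n * x n :: complex) \<le> ln (real n)"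
proof (cases "n = 0")
  case False
  assume "norm (x n) \<le> 1"
  hence "mangoldt n * norm (x n) \<le> ln (real n) * 1"
    using mangoldt_le[of n] mangoldt_nonneg[of n] False by (intro mult_mono) auto
  thus ?thesis by (simp add: norm_mult)
qed simp

lemma mangoldt_series_sums:
  assumes x: "\<And>n. norm (x n) \<le> 1" and s: "Re s > 1"
  shows "summable (\<lambda>n. norm (mangoldt n * x n * of_nat n powr (- s)))"
    and "(\<lambda>n. mangoldt n * x n * of_nat n powr (- s)) sums mangoldt_series x s"
proof -
  have "norm (mangoldt n * x n * of_nat n powr (- s)) \<le> ln (real n) * real n powr - Re s" for n
  proof (cases "n = 0")
    case False
    thus ?thesis by (intro dirichlet_term_bound norm_mangoldt_le x) auto
  qed simp
  hence "\<exists>N. \<forall>n\<ge>N. norm (norm (mangoldt n * x n * of_nat n powr (- s))) \<le> ln (real n) * real n powr - Re s"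
    unfolding real_norm_def abs_norm_cancel by blast
  thus *: "summable (\<lambda>n. norm (mangoldt n * x n * of_nat n powr (- s)))"
    by (rule summable_comparison_test[OF _ summable_ln_powr[OF s]])
  thus "(\<lambda>n. mangoldt n * x n * of_nat n powr (- s)) sums mangoldt_series x s"
    unfolding mangoldt_series_def by (rule summable_sums[OF summable_norm_cancel])
qed

text \<open>The bound is uniform on a closed half-plane inside Re s > 1, which rules out poles of
  -L'/L there.\<close>

lemma mangoldt_series_bound:
  assumes x: "\<And>n. norm (x n) \<le> 1" and p: "p > 1" and s: "Re s \<ge> p"
  shows "norm (mangoldt_series x s) \<le> (\<Sum>n. ln (real n) * real n powr - p)"
proof -
  have le: "norm (mangoldt n * x n * of_nat n powr (- s)) \<le> ln (real n) * real n powr - p" for n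
  proof (cases "n = 0")
    case False
    thus ?thesis by (intro dirichlet_term_bound norm_mangoldt_le x s) auto
  qed simp
  have "Re s > 1" using p s by simp
  note summ = mangoldt_series_sums(1)[OF x this]
  have "norm (mangoldt_series x s) \<le> (\<Sum>n. norm (mangoldt n * x n * of_nat n powr (- s)))"
    unfolding mangoldt_series_def by (rule summable_norm[OF summ])
  also have "\<dots> \<le> (\<Sum>n. ln (real n) * real n powr - p)"
    by (rule suminf_le[OF le summ summable_ln_powr[OF p]])
  finally show ?thesis .
qed

text \<open>Termwise differentiation brings in ln n, which is the sum of the Mangoldt function over
  the divisors of \<open>n\<close>; multiplicativity of \<open>x\<close> turns this into a product
  of Dirichlet series. The result is a product and not a quotient because
  \<open>F s \<noteq> 0\<close> is derived from it.\<close>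

lemma dirichlet_L_deriv:
  assumes a: "a > 0" and x: "x \<in> dchars a"
    and F: "\<And>s. Re s > 1 \<Longrightarrow> (\<lambda>n. x n * of_nat n powr (- s)) sums F s"
  shows "F holomorphic_on {s. Re s > 1}"
    and "\<And>s. Re s > 1 \<Longrightarrow> deriv F s = - mangoldt_series x s * F s"
proof -
  define f where "f = (\<lambda>n s. x n * of_nat n powr (- s))"
  have S: "open {s. Re s > 1}" by (simp add: open_halfspace_Re_gt)
  have x1: "norm (x n) \<le> 1" for n by (rule norm_dchars_le[OF a x])
  obtain g where g: "g holomorphic_on {s. Re s > 1}" "\<And>s. s \<in> {s. Re s > 1} \<Longrightarrow> (\<lambda>n. f n s) sums g s"
    "\<And>s. s \<in> {s. Re s > 1} \<Longrightarrow> (\<lambda>n. deriv (f n) s) sums deriv g s"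
  proof (rule holomorphic_series[OF S, of f])
    show "f n holomorphic_on {s. Re s > 1}" for n unfolding f_def by (intro holomorphic_intros)
    fix s assume s: "s \<in> {s. Re s > 1}"
    define d where "d = (Re s - 1) / 2"
    have "norm (f n y) \<le> 1 * real n powr - (1 + d)" if "y \<in> ball s d" for n y
    proof -
      have "\<bar>Re (s - y)\<bar> < d" using that abs_Re_le_cmod[of "s - y"] by (simp add: dist_norm)
      hence "Re y \<ge> 1 + d" by (auto simp: d_def abs_if field_simps split: if_splits)
      thus ?thesis unfolding f_def by (intro dirichlet_term_bound x1) auto
    qed
    moreover have "summable (\<lambda>n. 1 * real n powr - (1 + d))"
      using s by (simp add: summable_real_powr_iff d_def)
    moreover have "d > 0" using s by (simp add: d_def)
    ultimately show "\<exists>d>0. \<exists>h. summable h \<and> (\<forall>n. \<forall>y\<in>ball s d \<inter> {s. Re s > 1}. norm (f n y) \<le> h n)"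
      by blast
  qed auto
  have Fg: "F s = g s" if "Re s > 1" for s
    using sums_unique2[OF F[OF that]] g(2)[of s] that by (simp add: f_def)
  show "F holomorphic_on {s. Re s > 1}" using g(1) by (rule holomorphic_transform) (simp add: Fg)
  fix s assume s: "Re s > 1"
  have "deriv F s = deriv g s"
    by (rule complex_derivative_transform_within_open[OF _ g(1) S]) (use s Fg \<open>F holomorphic_on _\<close> in auto)
  have df: "deriv (f n) s = - (x n * ln (real n) * of_nat n powr (- s))" for n
  proof (cases "n = 0")
    case False
    have "((\<lambda>s. (of_nat n :: complex) powr (- s)) has_field_derivative (Ln (of_nat n) * of_nat n powr (- s)) * (- 1)) (at s)"
      using False by (intro DERIV_chain2[OF has_field_derivative_powr_right] DERIV_minus DERIV_ident) auto
    from DERIV_cmult[OF this, of "x n"]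
    have "(f n has_field_derivative - (x n * ln (real n) * of_nat n powr (- s))) (at s)"
      unfolding f_def using False by (simp add: Ln_of_nat mult.assoc)
    thus ?thesis by (rule DERIV_imp_deriv)
  next
    case True
    hence "f n = (\<lambda>_. 0)" by (simp add: f_def fun_eq_iff)
    thus ?thesis using True by simp
  qed
  have "(\<lambda>n. \<Sum>d | d dvd n. (mangoldt d * x d * of_nat d powr (- s)) * (x (n div d) * of_nat (n div d) powr (- s))) sums (mangoldt_series x s * F s)"
  proof (rule dirichlet_product)
    show "summable (\<lambda>n. norm (x n * of_nat n powr (- s)))"
    proof (rule summable_comparison_test)
      show "summable (\<lambda>n. 1 * real n powr - Re s)" using s by (simp add: summable_real_powr_iff)
      have "norm (x n * of_nat n powr (- s)) \<le> 1 * real n powr - Re s" for n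
        by (intro dirichlet_term_bound x1) auto
      thus "\<exists>N. \<forall>n\<ge>N. norm (norm (x n * of_nat n powr (- s))) \<le> 1 * real n powr - Re s" by auto
    qed
  qed (use mangoldt_series_sums[OF x1 s] F[OF s] in auto)
  also have "(\<lambda>n. \<Sum>d | d dvd n. (mangoldt d * x d * of_nat d powr (- s)) * (x (n div d) * of_nat (n div d) powr (- s))) =
             (\<lambda>n. x n * ln (real n) * of_nat n powr (- s))"
  proof
    fix n
    show "(\<Sum>d | d dvd n. (mangoldt d * x d * of_nat d powr (- s)) * (x (n div d) * of_nat (n div d) powr (- s))) =
        x n * ln (real n) * of_nat n powr (- s)"
    proof (cases "n = 0")
      case False
      have "(\<Sum>d | d dvd n. (mangoldt d * x d * of_nat d powr (- s)) * (x (n div d) * of_nat (n div d) powr (- s))) =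
            (\<Sum>d | d dvd n. mangoldt d * (x n * of_nat n powr (- s)))"
      proof (intro sum.cong refl)
        fix d assume "d \<in> {d. d dvd n}"
        hence n: "n = d * (n div d)" by simp
        have "x n = x d * x (n div d)" using n dcharsD(2)[OF x] by metis
        moreover have "(of_nat n :: complex) powr (- s) = of_nat d powr (- s) * of_nat (n div d) powr (- s)"
          by (subst n, subst of_nat_mult, subst powr_times_real) auto
        ultimately show "(mangoldt d * x d * of_nat d powr (- s)) * (x (n div d) * of_nat (n div d) powr (- s)) =
          mangoldt d * (x n * of_nat n powr (- s))" by simp
      qed
      also have "\<dots> = x n * ln (real n) * of_nat n powr (- s)"
        unfolding sum_distrib_right [symmetric] using mangoldt_sum[of n, where ?'a = complex] False by simp
      finally show ?thesis .
    qed simp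
  qed
  finally have "(\<lambda>n. deriv (f n) s) sums (- (mangoldt_series x s * F s))"
    unfolding df by (rule sums_minus)
  hence "deriv g s = - (mangoldt_series x s * F s)" using sums_unique2 g(3)[of s] s by blast
  thus "deriv F s = - mangoldt_series x s * F s" using \<open>deriv F s = deriv g s\<close> by simp
qed

text \<open>\<open>j\<close> is the order of the zero at \<xi>: with f = (w - \<xi>)^j g and
  g(\<xi>) \<noteq> 0, the logarithmic derivative is j / (w - \<xi>) plus a bounded term. The point
  \<open>z0\<close> excludes that \<open>f\<close> vanishes identically. Only the limit from the
  right is taken, since from a point with Re s = 1 the series are accessible only on that
  side.\<close>

lemma log_deriv_limit:
  assumes f: "f holomorphic_on S" and S: "open S" "connected S" and \<xi>: "\<xi> \<in> S" and z0: "z0 \<in> S" "f z0 \<noteq> 0"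
  shows "\<exists>j::nat. ((\<lambda>t. complex_of_real t * (deriv f (\<xi> + of_real t) / f (\<xi> + of_real t))) \<longlongrightarrow> of_nat j) (at_right 0)
           \<and> (f \<xi> = 0 \<longleftrightarrow> j \<noteq> 0)"
proof -
  have shift: "((\<lambda>t. \<xi> + complex_of_real t) \<longlongrightarrow> \<xi>) (at_right 0)"
    by (rule tendsto_eq_intros | simp)+
  have t0: "((\<lambda>t. complex_of_real t) \<longlongrightarrow> 0) (at_right 0)"
    by (rule tendsto_eq_intros | simp)+
  have reg: "((\<lambda>t. complex_of_real t * (deriv g (\<xi> + of_real t) / g (\<xi> + of_real t))) \<longlongrightarrow> 0) (at_right 0)"
    if g: "g holomorphic_on U" "open U" "\<xi> \<in> U" "g \<xi> \<noteq> 0" for g U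
  proof -
    have "isCont g \<xi>" "isCont (deriv g) \<xi>"
      using g holomorphic_deriv[OF g(1,2)] by (auto simp: continuous_on_eq_continuous_at dest!: holomorphic_on_imp_continuous_on)
    hence "((\<lambda>t. complex_of_real t * (deriv g (\<xi> + of_real t) / g (\<xi> + of_real t))) \<longlongrightarrow> 0 * (deriv g \<xi> / g \<xi>)) (at_right 0)"
      using g(4) by (intro tendsto_intros t0 isCont_tendsto_compose[OF _ shift]) auto
    thus ?thesis by simp
  qed
  show ?thesis
  proof (cases "f \<xi> = 0")
    case False
    thus ?thesis using reg[OF f S(1) \<xi>] by (intro exI[of _ 0]) auto
  next
    case True
    have "\<not> f constant_on S" using True \<xi> z0 unfolding constant_on_def by metis
    then obtain g r n where n: "0 < n" "0 < r" "ball \<xi> r \<subseteq> S" "g holomorphic_on ball \<xi> r"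
       "\<And>w. w \<in> ball \<xi> r \<Longrightarrow> f w = (w - \<xi>) ^ n * g w" "\<And>w. w \<in> ball \<xi> r \<Longrightarrow> g w \<noteq> 0"
      using holomorphic_factor_zero_nonconstant[OF f S \<xi> True] by metis
    have "((\<lambda>t. of_nat n + complex_of_real t * (deriv g (\<xi> + of_real t) / g (\<xi> + of_real t))) \<longlongrightarrow> of_nat n + 0) (at_right 0)"
      using n by (intro tendsto_intros reg[of g "ball \<xi> r"]) auto
    moreover have "\<forall>\<^sub>F t in at_right 0. of_nat n + complex_of_real t * (deriv g (\<xi> + of_real t) / g (\<xi> + of_real t)) =
        complex_of_real t * (deriv f (\<xi> + of_real t) / f (\<xi> + of_real t))"
    proof -
      have "\<forall>\<^sub>F t in at_right (0::real). t \<in> {0<..<r}" using n(2) by (rule eventually_at_right_real)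
      thus ?thesis
      proof eventually_elim
        case (elim t)
        define w where "w = \<xi> + complex_of_real t"
        have w: "w \<in> ball \<xi> r" "w - \<xi> = of_real t" "w \<noteq> \<xi>" using elim by (auto simp: w_def dist_norm)
        have "((\<lambda>w. (w - \<xi>) ^ n * g w) has_field_derivative
                (of_nat n * (w - \<xi>) ^ (n - 1) * g w + (w - \<xi>) ^ n * deriv g w)) (at w)"
          using holomorphic_derivI[OF n(4) _ w(1)] by (auto intro!: derivative_eq_intros)
        hence "(f has_field_derivative
                (of_nat n * (w - \<xi>) ^ (n - 1) * g w + (w - \<xi>) ^ n * deriv g w)) (at w)"
          by (rule has_field_derivative_transform_within_open[OF _ _ w(1)]) (use n in auto)
        hence "deriv f w = of_nat n * (w - \<xi>) ^ (n - 1) * g w + (w - \<xi>) ^ n * deriv g w"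
          by (rule DERIV_imp_deriv)
        moreover have "(w - \<xi>) * (w - \<xi>) ^ (n - 1) = (w - \<xi>) ^ n" using n(1) by (cases n) auto
        ultimately have "(w - \<xi>) * deriv f w = (w - \<xi>) ^ n * (of_nat n * g w + (w - \<xi>) * deriv g w)"
          by (simp add: algebra_simps)
        hence "(w - \<xi>) * (deriv f w / f w) = (of_nat n * g w + (w - \<xi>) * deriv g w) / g w"
          using n(5)[OF w(1)] w(3) by simp
        also have "\<dots> = of_nat n + (w - \<xi>) * (deriv g w / g w)" using n(6)[OF w(1)] by (simp add: field_simps)
        finally show ?case unfolding w(2) by (simp add: w_def)
      qed
    qed
    ultimately have "((\<lambda>t. complex_of_real t * (deriv f (\<xi> + of_real t) / f (\<xi> + of_real t))) \<longlongrightarrow> of_nat n + 0) (at_right 0)"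
      by (rule Lim_transform_eventually)
    thus ?thesis using n(1) True by (intro exI[of _ n]) simp
  qed
qed

text \<open>A zero would make \<open>F' / F\<close> blow up at it, but this quotient is a Mangoldt
  series, bounded to the right of \<open>s\<close>. So the order of the zero is 0.\<close>

lemma dirichlet_L_nonzero_right:
  assumes a: "a > 0" and x: "x \<in> dchars a"
    and F: "\<And>s. Re s > 1 \<Longrightarrow> (\<lambda>n. x n * of_nat n powr (- s)) sums F s" and s: "Re s > 1"
  shows "F s \<noteq> 0"
proof -
  note D = dirichlet_L_deriv[OF a x F]
  have x1: "norm (x n) \<le> 1" for n by (rule norm_dchars_le[OF a x])
  \<comment> \<open>The first term is 1, and the others are bounded by a quarter of the series of
    inverse squares, because (n + 2)^4 is at least 4 (n + 1)^2.\<close>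
  have F4: "F 4 \<noteq> 0"
  proof -
    define g where "g = (\<lambda>n. x (Suc (Suc n)) * of_nat (Suc (Suc n)) powr (- 4))"
    have "(\<lambda>n. x (Suc n) * of_nat (Suc n) powr (- 4)) sums (F 4 - x 0 * of_nat 0 powr (- 4))"
      using F[of 4] by (subst sums_Suc_iff) simp
    hence "g sums (F 4 - x 0 * of_nat 0 powr (- 4) - x (Suc 0) * of_nat (Suc 0) powr (- 4))"
      unfolding g_def by (subst sums_Suc_iff) simp
    hence g: "g sums (F 4 - 1)" using dcharsD(1)[OF x] by simp
    have le: "norm (g n) \<le> 1 / 4 * (1 / (real n + 1)\<^sup>2)" for n
    proof -
      have "norm (g n) \<le> 1 * real (Suc (Suc n)) powr - 4" unfolding g_def by (intro dirichlet_term_bound x1) auto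
      also have "\<dots> = inverse (real (Suc (Suc n)) ^ 4)"
        unfolding mult_1 powr_minus by (subst powr_numeral) auto
      also have "\<dots> = 1 / ((real n + 2)\<^sup>2 * (real n + 2)\<^sup>2)"
        by (simp add: inverse_eq_divide add.commute flip: power_add)
      also have "\<dots> \<le> 1 / (4 * (real n + 1)\<^sup>2)"
      proof (rule divide_left_mono)
        have "(2::real)\<^sup>2 \<le> (real n + 2)\<^sup>2" "(real n + 1)\<^sup>2 \<le> (real n + 2)\<^sup>2" by (intro power_mono; simp)+
        thus "4 * (real n + 1)\<^sup>2 \<le> (real n + 2)\<^sup>2 * (real n + 2)\<^sup>2" by (intro mult_mono) auto
      qed (auto intro!: mult_pos_pos simp: add_pos_pos)
      finally show ?thesis by simp
    qed
    have sq: "(\<lambda>n. 1 / 4 * (1 / (real n + 1)\<^sup>2)) sums (1 / 4 * (pi\<^sup>2 / 6))"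
      using inverse_squares_sums by (intro sums_mult) (simp add: add.commute)
    have "norm (F 4 - 1) \<le> 1 / 4 * (pi\<^sup>2 / 6)"
      using norm_suminf_le[OF le sums_summable[OF sq]] sums_unique[OF g] sums_unique[OF sq] by simp
    also have "pi\<^sup>2 \<le> 4\<^sup>2" using pi_less_4 by (intro power_mono) auto
    hence "1 / 4 * (pi\<^sup>2 / 6) < 1" by simp
    finally show ?thesis by auto
  qed
  have "open {s. Re s > 1}" "connected {s. Re s > 1}"
    by (auto simp: open_halfspace_Re_gt intro: convex_connected convex_halfspace_Re_gt)
  then obtain j :: nat where j: "((\<lambda>t. complex_of_real t * (deriv F (s + of_real t) / F (s + of_real t))) \<longlongrightarrow> of_nat j) (at_right 0)"
     "F s = 0 \<longleftrightarrow> j \<noteq> 0"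
    using log_deriv_limit[OF D(1), of s 4] F4 s by auto
  have "((\<lambda>t. complex_of_real t * (deriv F (s + of_real t) / F (s + of_real t))) \<longlongrightarrow> 0) (at_right 0)"
  proof (rule Lim_null_comparison)
    define C where "C = (\<Sum>n. ln (real n) * real n powr - Re s)"
    show "((\<lambda>t. t * C) \<longlongrightarrow> 0) (at_right 0)" by (rule tendsto_eq_intros | simp)+
    show "\<forall>\<^sub>F t in at_right 0. norm (complex_of_real t * (deriv F (s + of_real t) / F (s + of_real t))) \<le> t * C"
      using eventually_at_right_less
    proof eventually_elim
      case (elim t)
      \<comment> \<open>The bound holds even where \<open>F\<close> vanishes, as division by 0 gives
        0.\<close>
      have "norm (deriv F (s + of_real t) / F (s + of_real t)) \<le> norm (mangoldt_series x (s + of_real t))"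
        using D(2)[of "s + of_real t"] s elim by (simp add: norm_divide norm_mult)
      also have "\<dots> \<le> C" unfolding C_def using elim s by (intro mangoldt_series_bound x1) auto
      finally show ?case unfolding norm_mult norm_of_real using elim by (intro mult_mono) auto
    qed
  qed
  hence "complex_of_nat j = 0" using tendsto_unique[OF _ j(1)] by (metis trivial_limit_at_right_real)
  thus ?thesis using j(2) by simp
qed

section \<open>Non-vanishing on the line Re s = 1\<close>

text \<open>Holds term by term: with z = x(n) n^(-iy) of modulus 1, the \<open>n\<close>-th term is
  a nonnegative number times Re (3 + 4 z + z^2) = 2 (1 + Re z)^2.\<close>

lemma mangoldt_341:
  assumes a: "a > 0" and x: "x \<in> dchars a" and t: "t > 0"
  shows "Re (3 * mangoldt_series (principal_dchar a) (1 + of_real t) + 4 * mangoldt_series x (1 + \<i> * of_real y + of_real t)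
           + mangoldt_series (\<lambda>n. x n * x n) (1 + \<i> * of_real (2 * y) + of_real t)) \<ge> 0" (is "Re ?S \<ge> 0")
proof -
  have x1: "norm (x n) \<le> 1" "norm (principal_dchar a n) \<le> 1" "norm (x n * x n) \<le> 1" for n
    using norm_dchars_le[OF a] x principal_dchar_in mult_dchars[OF x x] by blast+
  define f where "f = (\<lambda>n. 3 * (mangoldt n * principal_dchar a n * of_nat n powr (- (1 + of_real t))) +
        4 * (mangoldt n * x n * of_nat n powr (- (1 + \<i> * of_real y + of_real t))) +
        mangoldt n * (x n * x n) * of_nat n powr (- (1 + \<i> * of_real (2 * y) + of_real t)) :: complex)"
  have "f sums ?S"
    unfolding f_def using t by (intro sums_add sums_mult mangoldt_series_sums(2) x1) auto
  hence "(\<lambda>n. Re (f n)) sums Re ?S"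
    by (rule sums_Re)
  moreover have "Re (f n) \<ge> 0" for n
  proof (cases "n > 0 \<and> coprime n a")
    case True
    hence n: "n > 0" and cop: "coprime n a" by auto
    define z where "z = x n * of_nat n powr (- (\<i> * of_real y))"
    define q where "q = real n powr (- (1 + t))"
    have q: "(of_nat n :: complex) powr (- (1 + of_real t)) = of_real q"
      using powr_of_real[of "real n" "- (1 + t)"] by (simp add: q_def)
    have "norm z = 1" using norm_dchars[OF a x, of n] n cop by (simp add: z_def norm_mult norm_of_nat_powr)
    hence zz: "(Re z)\<^sup>2 + (Im z)\<^sup>2 = 1" by (metis cmod_power2 one_power2)
    have split: "(of_nat n :: complex) powr (- (1 + w + of_real t)) = of_real q * of_nat n powr (- w)" for w
    proof -
      have "- (1 + w + of_real t) = - (1 + of_real t) + (- w)" by simp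
      thus ?thesis unfolding q[symmetric] by (simp only: powr_add)
    qed
    have sq: "(of_nat n :: complex) powr (- (\<i> * of_real (2 * y))) = of_nat n powr (- (\<i> * of_real y)) * of_nat n powr (- (\<i> * of_real y))"
    proof -
      have "- (\<i> * complex_of_real (2 * y)) = - (\<i> * of_real y) + - (\<i> * of_real y)" by simp
      thus ?thesis by (simp only: powr_add)
    qed
    have "f n = of_real (mangoldt n * q) * (3 + 4 * z + z * z)"
      unfolding f_def q split sq z_def using cop by (simp add: principal_dchar_def algebra_simps)
    hence "Re (f n) = (mangoldt n * q) * Re (3 + 4 * z + z * z)"
      by (simp only: times_complex.sel Re_complex_of_real Im_complex_of_real mult_zero_left diff_zero)
    also have "Re (3 + 4 * z + z * z) = 2 * (1 + Re z)\<^sup>2" using zz by (simp add: power2_eq_square algebra_simps)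
    finally show ?thesis using mangoldt_nonneg[of n] by (simp add: q_def)
  next
    case False
    hence "f n = 0" using dcharsD(4)[OF x, of n] by (auto simp: f_def principal_dchar_def)
    thus ?thesis by simp
  qed
  ultimately show ?thesis using sums_le[of "\<lambda>_. 0" "\<lambda>n. Re (f n)"] sums_zero by blast
qed

text \<open>The exponent accounts for the simple pole at 1 of the \<open>L\<close>-function of the principal_dchar character.\<close>

lemma L_continuation:
  assumes a: "a > 0" and x: "x \<in> dchars a"
  obtains G where "G holomorphic_on {s. Re s > 0}" "x = principal_dchar a \<Longrightarrow> G 1 \<noteq> 0"
    "\<And>s. Re s > 1 \<Longrightarrow> (\<lambda>n. x n * of_nat n powr (- s)) sums (G s / (s - 1) ^ of_bool (x = principal_dchar a))"
    "\<And>s. x \<noteq> principal_dchar a \<Longrightarrow> Re s > 0 \<Longrightarrow> (\<lambda>n. x n * of_nat n powr (- s)) sums G s"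
proof (cases "x = principal_dchar a")
  case True
  obtain S where "S holomorphic_on {s. Re s > 0}" "S 1 \<noteq> 0"
    "\<And>s. Re s > 1 \<Longrightarrow> (\<lambda>n. principal_dchar a n * of_nat n powr (- s)) sums (S s / (s - 1))"
    by (rule principal_L[OF a]) blast
  thus ?thesis using True by (intro that[of S]) (auto simp: of_bool_def)
next
  case False
  obtain L where "L holomorphic_on {s. Re s > 0}"
    "\<And>s. Re s > 0 \<Longrightarrow> (\<lambda>n. x n * of_nat n powr (- s)) sums L s"
    by (rule nonprincipal_L[OF a x False]) blast
  thus ?thesis using False by (intro that[of L]) (auto simp: of_bool_def)
qed

text \<open>The factor (s - 1)^e in the denominator contributes e / (s - 1) to -F'/F; the remaining
  part is regular wherever \<open>G\<close> has no zero.\<close>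

lemma mangoldt_series_eq:
  assumes a: "a > 0" and x: "x \<in> dchars a"
    and G: "G holomorphic_on {s. Re s > 0}"
    and F: "\<And>s. Re s > 1 \<Longrightarrow> (\<lambda>n. x n * of_nat n powr (- s)) sums (G s / (s - 1) ^ e)"
    and s: "Re s > 1"
  shows "G s \<noteq> 0" "mangoldt_series x s = of_nat e / (s - 1) - deriv G s / G s"
proof -
  have nz: "(w - 1) ^ e \<noteq> 0" if "Re w > 1" for w using that by auto
  show G0: "G s \<noteq> 0" using dirichlet_L_nonzero_right[OF a x F s] nz[OF s] by auto
  have s1: "s - 1 \<noteq> 0" using s by auto
  have "(G has_field_derivative deriv G s) (at s)"
    by (rule holomorphic_derivI[OF G]) (use s in \<open>auto simp: open_halfspace_Re_gt\<close>)
  hence "((\<lambda>s. G s / (s - 1) ^ e) has_field_derivative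
      (deriv G s * (s - 1) ^ e - G s * (of_nat e * (s - 1) ^ (e - 1))) / ((s - 1) ^ e * (s - 1) ^ e)) (at s)"
    using s1 by (auto intro!: derivative_eq_intros)
  hence "deriv (\<lambda>s. G s / (s - 1) ^ e) s = (deriv G s * (s - 1) ^ e - G s * (of_nat e * (s - 1) ^ (e - 1))) / ((s - 1) ^ e * (s - 1) ^ e)"
    by (rule DERIV_imp_deriv)
  hence eq: "- mangoldt_series x s * (G s / (s - 1) ^ e) = (deriv G s * (s - 1) ^ e - G s * (of_nat e * (s - 1) ^ (e - 1))) / ((s - 1) ^ e * (s - 1) ^ e)"
    using dirichlet_L_deriv(2)[OF a x F s] by simp
  have *: "- p * (g / W) = (d * W - g * v) / (W * W) \<Longrightarrow> W \<noteq> 0 \<Longrightarrow> g \<noteq> 0 \<Longrightarrow> p = v / W - d / g" (is "_ \<Longrightarrow> _ \<Longrightarrow> _ \<Longrightarrow> ?thesis") for p g W d v :: complex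
  proof -
    assume h: "- p * (g / W) = (d * W - g * v) / (W * W)" and nz: "W \<noteq> 0" "g \<noteq> 0"
    have "p * (g * W) = - ((- p * (g / W)) * (W * W))" using nz by simp
    also have "\<dots> = g * v - d * W" unfolding h using nz by simp
    finally have "p = (g * v - d * W) / (g * W)" using nz by (simp add: nonzero_eq_divide_eq)
    also have "\<dots> = v / W - d / g" using nz by (simp add: diff_divide_distrib)
    finally show ?thesis .
  qed
  have "mangoldt_series x s = of_nat e * (s - 1) ^ (e - 1) / (s - 1) ^ e - deriv G s / G s"
    by (rule *[OF eq nz[OF s] G0])
  also have "of_nat e * (s - 1) ^ (e - 1) / (s - 1) ^ e = of_nat e / (s - 1)"
    using s1 by (cases e) auto
  finally show "mangoldt_series x s = of_nat e / (s - 1) - deriv G s / G s" .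
qed

text \<open>The limit is the order of the pole, which can only sit at \<open>y = 0\<close>, minus
  the order \<open>j\<close> of the zero of \<open>G\<close>.\<close>

lemma mangoldt_series_limit:
  assumes a: "a > 0" and x: "x \<in> dchars a"
    and G: "G holomorphic_on {s. Re s > 0}"
    and F: "\<And>s. Re s > 1 \<Longrightarrow> (\<lambda>n. x n * of_nat n powr (- s)) sums (G s / (s - 1) ^ e)"
  shows "\<exists>j::nat. ((\<lambda>t. of_real t * mangoldt_series x (1 + \<i> * of_real y + of_real t)) \<longlongrightarrow>
            of_nat (e * of_bool (y = 0)) - of_nat j) (at_right 0) \<and> (G (1 + \<i> * of_real y) = 0 \<longleftrightarrow> j \<noteq> 0)"
proof -
  define w where "w = 1 + \<i> * complex_of_real y"
  note EQ = mangoldt_series_eq[OF a x G F]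
  have "open {s. Re s > 0}" "connected {s. Re s > 0}"
    by (auto simp: open_halfspace_Re_gt intro: convex_connected convex_halfspace_Re_gt)
  then obtain j :: nat where j: "((\<lambda>t. complex_of_real t * (deriv G (w + of_real t) / G (w + of_real t))) \<longlongrightarrow> of_nat j) (at_right 0)"
     "G w = 0 \<longleftrightarrow> j \<noteq> 0"
    using log_deriv_limit[OF G, of w 2] EQ(1)[of 2] by (auto simp: w_def)
  have lim: "((\<lambda>t. complex_of_real t * (of_nat e / (w + of_real t - 1))) \<longlongrightarrow> of_nat (e * of_bool (y = 0))) (at_right 0)"
  proof (cases "y = 0")
    case True
    have "\<forall>\<^sub>F t in at_right 0. complex_of_real t * (of_nat e / (w + of_real t - 1)) = of_nat e"
      using eventually_at_right_less by eventually_elim (simp add: w_def True)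
    hence "((\<lambda>t. complex_of_real t * (of_nat e / (w + of_real t - 1))) \<longlongrightarrow> of_nat e) (at_right 0)"
      by (rule tendsto_eventually)
    thus ?thesis using True by (simp add: of_bool_def)
  next
    case False
    have "((\<lambda>t. complex_of_real t * (of_nat e / (w + of_real t - 1))) \<longlongrightarrow> of_real 0 * (of_nat e / (w + of_real 0 - 1))) (at_right 0)"
      using False by (intro tendsto_intros) (auto simp: w_def)
    thus ?thesis using False by (simp add: of_bool_def)
  qed
  have "\<forall>\<^sub>F t in at_right 0. complex_of_real t * (of_nat e / (w + of_real t - 1)) - complex_of_real t * (deriv G (w + of_real t) / G (w + of_real t))
      = of_real t * mangoldt_series x (w + of_real t)"
    using eventually_at_right_less
  proof eventually_elim
    case (elim t)
    show ?case using EQ(2)[of "w + of_real t"] elim by (simp add: w_def right_diff_distrib)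
  qed
  with tendsto_diff[OF lim j(1)] have "((\<lambda>t. of_real t * mangoldt_series x (w + of_real t)) \<longlongrightarrow> of_nat (e * of_bool (y = 0)) - of_nat j) (at_right 0)"
    by (rule Lim_transform_eventually)
  thus ?thesis using j(2) unfolding w_def by blast
qed

text \<open>Multiplying the inequality of \<open>mangoldt_341\<close> by \<open>t\<close> and
  letting \<open>t\<close> tend to 0 gives 3 - 4 j1 - j2 \<ge> 0 for the zero orders at 1 + iy and 1
  + 2iy, so j1 = 0. In the excluded case the squared character has a pole at 1 + 2iy, the inequality
  becomes 4 - 4 j1 - j2 \<ge> 0, and a simple zero is not ruled out.\<close>

lemma nonvanishing_341:
  assumes a: "a > 0" and x: "x \<in> dchars a"
    and G: "G holomorphic_on {s. Re s > 0}"
    and F: "\<And>s. Re s > 1 \<Longrightarrow> (\<lambda>n. x n * of_nat n powr (- s)) sums (G s / (s - 1) ^ of_bool (x = principal_dchar a))"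
    and y: "\<not> ((\<lambda>n. x n * x n) = principal_dchar a \<and> y = 0)"
  shows "G (1 + \<i> * of_real y) \<noteq> 0"
proof -
  define x2 where "x2 = (\<lambda>n. x n * x n)"
  have x2: "x2 \<in> dchars a" unfolding x2_def by (rule mult_dchars[OF x x])
  define P0 where "P0 = (\<lambda>t. of_real t * mangoldt_series (principal_dchar a) (1 + of_real t))"
  define P1 where "P1 = (\<lambda>t. of_real t * mangoldt_series x (1 + \<i> * of_real y + of_real t))"
  define P2 where "P2 = (\<lambda>t. of_real t * mangoldt_series x2 (1 + \<i> * of_real (2 * y) + of_real t))"
  obtain G0 where G0: "G0 holomorphic_on {s. Re s > 0}" "G0 1 \<noteq> 0"
    "\<And>s. Re s > 1 \<Longrightarrow> (\<lambda>n. principal_dchar a n * of_nat n powr (- s)) sums (G0 s / (s - 1) ^ 1)"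
    by (rule principal_L[OF a]) simp
  obtain G2 where G2: "G2 holomorphic_on {s. Re s > 0}"
    "\<And>s. Re s > 1 \<Longrightarrow> (\<lambda>n. x2 n * of_nat n powr (- s)) sums (G2 s / (s - 1) ^ of_bool (x2 = principal_dchar a))"
    by (rule L_continuation[OF a x2]) blast
  have l0: "(P0 \<longlongrightarrow> 1) (at_right 0)"
    using mangoldt_series_limit[OF a principal_dchar_in G0(1,3), of 0] G0(2) by (auto simp: P0_def of_bool_def)
  have "\<not> (x = principal_dchar a \<and> y = 0)"
  proof -
    have "(\<lambda>n. principal_dchar a n * principal_dchar a n) = principal_dchar a" by (auto simp: principal_dchar_def)
    thus ?thesis using y by auto
  qed
  hence e1: "of_bool (x = principal_dchar a) * of_bool (y = 0) = (0 :: nat)" by (simp add: of_bool_def)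
  obtain j1 :: nat where l1: "(P1 \<longlongrightarrow> - of_nat j1) (at_right 0)" and j1: "G (1 + \<i> * of_real y) = 0 \<longleftrightarrow> j1 \<noteq> 0"
    using mangoldt_series_limit[OF a x G F, of y] unfolding e1 P1_def by auto
  have e2: "of_bool (x2 = principal_dchar a) * of_bool (2 * y = 0) = (0 :: nat)"
    using y by (auto simp: of_bool_def x2_def)
  obtain j2 :: nat where l2: "(P2 \<longlongrightarrow> - of_nat j2) (at_right 0)"
    using mangoldt_series_limit[OF a x2 G2, of "2 * y"] unfolding e2 P2_def by auto
  have "((\<lambda>t. Re (3 * P0 t + 4 * P1 t + P2 t)) \<longlongrightarrow> Re (3 * 1 + 4 * (- of_nat j1) + - of_nat j2)) (at_right 0)"
    by (intro tendsto_intros l0 l1 l2)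
  moreover have "\<forall>\<^sub>F t in at_right 0. 0 \<le> Re (3 * P0 t + 4 * P1 t + P2 t)"
    using eventually_at_right_less
  proof eventually_elim
    case (elim t)
    have "0 \<le> t * Re (3 * mangoldt_series (principal_dchar a) (1 + of_real t) + 4 * mangoldt_series x (1 + \<i> * of_real y + of_real t)
           + mangoldt_series (\<lambda>n. x n * x n) (1 + \<i> * of_real (2 * y) + of_real t))"
      using mangoldt_341[OF a x elim] elim by (intro mult_nonneg_nonneg) auto
    thus ?case unfolding P0_def P1_def P2_def x2_def by (simp add: algebra_simps)
  qed
  ultimately have "0 \<le> Re (3 * 1 + 4 * (- of_nat j1) + - of_nat j2)"
    by (intro tendsto_lowerbound) auto
  hence "j1 = 0" by simp
  thus ?thesis using j1 by simp
qed

section \<open>Monsky's argument for real characters at s = 1\<close>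

text \<open>Every divisor of \<open>p ^ k * m\<close> is \<open>p ^ i * d\<close> for exactly one
  \<open>i \<le> k\<close> and one divisor \<open>d\<close> of \<open>m\<close>.\<close>

lemma sum_dvd_prime_power_mult:
  fixes y :: "nat \<Rightarrow> real"
  assumes p: "prime p" "\<not> p dvd m" and mult: "\<And>m n. y (m * n) = y m * y n" and y1: "y 1 = 1"
  shows "(\<Sum>d | d dvd p ^ k * m. y d) = (\<Sum>i\<le>k. y p ^ i) * (\<Sum>d | d dvd m. y d)"
proof -
  have m: "m > 0" using p by (intro Nat.gr0I) auto
  have inj: "inj_on (\<lambda>(i, d). p ^ i * d) ({..k} \<times> {d. d dvd m})"
  proof (rule inj_onI, clarify)
    fix i d j e assume *: "d dvd m" "e dvd m" "p ^ i * d = p ^ j * e"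
    have nd: "\<not> p dvd d" "\<not> p dvd e" using * p by (auto dest: dvd_trans)
    have "multiplicity p (p ^ i * d) = i" if "\<not> p dvd d" for i d
    proof -
      have "d \<noteq> 0" using that by (intro notI) simp
      thus ?thesis using that p(1)
        by (simp add: prime_elem_multiplicity_mult_distrib not_dvd_imp_multiplicity_0 prime_gt_0_nat)
    qed
    from this[OF nd(1), of i] this[OF nd(2), of j] have "i = j" using * by simp
    thus "i = j \<and> d = e" using * p(1) by (auto simp: prime_gt_0_nat)
  qed
  have im: "(\<lambda>(i, d). p ^ i * d) ` ({..k} \<times> {d. d dvd m}) = {d. d dvd p ^ k * m}"
  proof (intro equalityI subsetI)
    fix z assume "z \<in> {d. d dvd p ^ k * m}"
    then obtain b c where bc: "z = b * c" "b dvd p ^ k" "c dvd m" using division_decomp[of z "p ^ k" m] by auto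
    moreover obtain i where "i \<le> k" "b = p ^ i" using bc(2) p(1) divides_primepow_nat by blast
    ultimately show "z \<in> (\<lambda>(i, d). p ^ i * d) ` ({..k} \<times> {d. d dvd m})" by auto
  qed (auto intro!: mult_dvd_mono le_imp_power_dvd)
  have pow: "y (p ^ i) = y p ^ i" for i by (induction i) (use mult y1 in auto)
  have "(\<Sum>d | d dvd p ^ k * m. y d) = (\<Sum>(i, d)\<in>{..k} \<times> {d. d dvd m}. y (p ^ i * d))"
    unfolding im [symmetric] by (subst sum.reindex[OF inj]) (simp add: case_prod_unfold)
  also have "\<dots> = (\<Sum>(i, d)\<in>{..k} \<times> {d. d dvd m}. y p ^ i * y d)"
    by (intro sum.cong refl) (auto simp: mult pow)
  also have "\<dots> = (\<Sum>i\<le>k. y p ^ i) * (\<Sum>d | d dvd m. y d)"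
    by (simp add: sum_product sum.cartesian_product)
  finally show ?thesis .
qed

text \<open>The divisor sum is a product of factors 1 + y(p) + ... + y(p)^k. Such a factor is 0 or 1
  if y(p) = -1, it is 1 if y(p) = 0 and k + 1 if y(p) = 1; for even \<open>k\<close> it is at least
  1. The induction strips one prime at a time.\<close>

lemma sum_dvd_real_character:
  fixes y :: "nat \<Rightarrow> real"
  assumes mult: "\<And>m n. y (m * n) = y m * y n" and y1: "y 1 = 1" and vals: "\<And>n. y n \<in> {-1, 0, 1}"
    and "n > 0"
  shows "(\<Sum>d | d dvd n. y d) \<ge> 0 \<and> ((\<exists>k. n = k\<^sup>2) \<longrightarrow> (\<Sum>d | d dvd n. y d) \<ge> 1)"
  using \<open>n > 0\<close>
proof (induction n rule: less_induct)
  case (less n)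
  show ?case
  proof (cases "n = 1")
    case True
    thus ?thesis using y1 by simp
  next
    case False
    then obtain p where p: "prime p" "p dvd n" using prime_factor_nat by blast
    define k where "k = multiplicity p n"
    obtain m where m: "n = p ^ k * m" "\<not> p dvd m"
      using multiplicity_decompose'[of n p] p less.prems unfolding k_def by (metis neq0_conv not_prime_unit)
    have k: "k > 0" using p less.prems unfolding k_def by (simp add: prime_multiplicity_gt_zero_iff)
    have m0: "m > 0" using m less.prems by (intro Nat.gr0I) auto
    have "1 < p ^ k" by (rule one_less_power[OF prime_gt_1_nat[OF p(1)] k])
    hence mn: "m < n" using m m0 by simp
    note IH = less.IH[OF mn m0]
    have eq: "(\<Sum>d | d dvd n. y d) = (\<Sum>i\<le>k. y p ^ i) * (\<Sum>d | d dvd m. y d)"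
      unfolding m(1) by (rule sum_dvd_prime_power_mult[OF p(1) m(2) mult y1])
    have geo: "(\<Sum>i\<le>k. y p ^ i) \<ge> 0 \<and> (even k \<longrightarrow> (\<Sum>i\<le>k. y p ^ i) \<ge> 1)"
    proof -
      consider "y p = -1" | "y p = 0" | "y p = 1" using vals[of p] by auto
      thus ?thesis
      proof cases
        case 1
        have "(\<Sum>i\<le>k. (-1::real) ^ i) = (if even k then 1 else 0)" by (induction k) auto
        thus ?thesis using 1 by simp
      next
        case 2
        have "(\<Sum>i\<le>k. (0::real) ^ i) = 1" by (induction k) auto
        thus ?thesis using 2 by simp
      qed simp
    qed
    show ?thesis
    proof (intro conjI impI)
      show "(\<Sum>d | d dvd n. y d) \<ge> 0" unfolding eq using geo IH by (intro mult_nonneg_nonneg) auto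
      assume "\<exists>k. n = k\<^sup>2"
      then obtain l where l: "n = l\<^sup>2" by blast
      have l0: "l > 0" using l less.prems by (intro Nat.gr0I) auto
      define j where "j = multiplicity p l"
      obtain u where u: "l = p ^ j * u" "\<not> p dvd u"
        using multiplicity_decompose'[of l p] p l0 unfolding j_def by (metis neq0_conv not_prime_unit)
      have kj: "k = 2 * j" using p l0 unfolding k_def j_def l by (simp add: prime_elem_multiplicity_power_distrib)
      have "p ^ k * m = p ^ k * u\<^sup>2" using m l u kj by (metis power_mult power_mult_distrib mult.commute)
      hence "m = u\<^sup>2" using p by (simp add: prime_gt_0_nat)
      hence "(\<Sum>d | d dvd m. y d) \<ge> 1" using IH by blast
      moreover have "(\<Sum>i\<le>k. y p ^ i) \<ge> 1" using geo kj by simp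
      ultimately show "(\<Sum>d | d dvd n. y d) \<ge> 1"
        unfolding eq using mult_mono[of 1 "\<Sum>i\<le>k. y p ^ i" 1 "\<Sum>d | d dvd m. y d"] by simp
    qed
  qed
qed

text \<open>The inequality of arithmetic and geometric means for the terms with indices
  \<open>i\<close> and \<open>n - 1 - i\<close>. The ratio is written as a square so that the
  geometric mean is a natural power of \<open>w\<close>.\<close>

lemma geometric_sum_ge:
  fixes w :: real assumes "0 \<le> w"
  shows "real n * w ^ (n - 1) \<le> (\<Sum>i<n. (w\<^sup>2) ^ i)"
proof -
  have "2 * (real n * w ^ (n - 1)) = (\<Sum>i<n. 2 * w ^ (n - 1))" by simp
  also have "\<dots> \<le> (\<Sum>i<n. (w\<^sup>2) ^ i + (w\<^sup>2) ^ (n - Suc i))"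
  proof (rule sum_mono)
    fix i assume "i \<in> {..<n}"
    hence "w ^ (n - 1) = w ^ i * w ^ (n - Suc i)" by (simp flip: power_add)
    moreover have "2 * (w ^ i * w ^ (n - Suc i)) \<le> (w ^ i)\<^sup>2 + (w ^ (n - Suc i))\<^sup>2"
      using sum_squares_bound[of "w ^ i" "w ^ (n - Suc i)"] by (simp add: mult.assoc)
    ultimately show "2 * w ^ (n - 1) \<le> (w\<^sup>2) ^ i + (w\<^sup>2) ^ (n - Suc i)"
      by (simp add: power_mult [symmetric] mult.commute)
  qed
  also have "\<dots> = 2 * (\<Sum>i<n. (w\<^sup>2) ^ i)"
    unfolding sum.distrib using sum.nat_diff_reindex[of "\<lambda>i. (w\<^sup>2) ^ i" n] by simp
  finally show ?thesis by simp
qed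

text \<open>The error in replacing the Lambert coefficient q^n / (1 - q^n) by 1 / (n (1 - q)).
  Summed against \<open>y\<close>, the replacement yields 1 / (1 - q) times the sum of y(n) /
  n.\<close>

definition monsky_b :: "real \<Rightarrow> nat \<Rightarrow> real" where
  "monsky_b q n = 1 / (real n * (1 - q)) - q ^ n / (1 - q ^ n)"

text \<open>With A and B the sums of the first n and n + 1 powers of q, (1 - q) times the decrease
  is 1 / (n (n + 1)) - q^n / (A B). By \<open>geometric_sum_ge\<close>, A B is at least n (n + 1)
  w^(2 n - 1), which exceeds n (n + 1) q^n.\<close>

lemma monsky_b_decreasing:
  assumes w: "0 < w" "w < 1" and n: "n > 0"
  shows "monsky_b (w\<^sup>2) (Suc n) \<le> monsky_b (w\<^sup>2) n"
proof -
  define q where "q = w\<^sup>2"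
  have q: "0 < q" "q < 1" using w by (auto simp: q_def power_less_one_iff)
  define A where "A = (\<Sum>i<n. q ^ i)"
  define B where "B = (\<Sum>i<Suc n. q ^ i)"
  have A: "1 - q ^ n = (1 - q) * A" and B: "1 - q ^ Suc n = (1 - q) * B"
    unfolding A_def B_def by (rule one_diff_power_eq)+
  have A1: "A \<ge> real n * w ^ (n - 1)" and B1: "B \<ge> real (Suc n) * w ^ n"
    unfolding A_def B_def q_def using geometric_sum_ge[of w n] geometric_sum_ge[of w "Suc n"] w by auto
  have "real n * w ^ (n - 1) > 0" using w n by simp
  hence A0: "A > 0" using A1 by linarith
  have "real (Suc n) * w ^ n > 0" using w by simp
  hence B0: "B > 0" using B1 by linarith
  have "real n * real (Suc n) * q ^ n \<le> (real n * w ^ (n - 1)) * (real (Suc n) * w ^ n)"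
  proof -
    have "q ^ n = w ^ n * w ^ n" by (simp add: q_def power2_eq_square power_mult_distrib)
    also have "\<dots> \<le> w ^ (n - 1) * w ^ n" using w by (intro mult_right_mono power_decreasing) auto
    finally have "real n * real (Suc n) * q ^ n \<le> real n * real (Suc n) * (w ^ (n - 1) * w ^ n)"
      by (intro mult_left_mono) auto
    thus ?thesis by (simp add: mult_ac)
  qed
  also have "\<dots> \<le> A * B" using A1 B1 w A0 by (intro mult_mono) auto
  finally have "real n * real (Suc n) * q ^ n \<le> A * B" .
  hence AB: "q ^ n / (A * B) \<le> 1 / (real n * real (Suc n))"
  proof -
    have AB0: "A * B > 0" and N: "real n * real (Suc n) > 0" using A0 B0 n by auto
    have "q ^ n \<le> A * B / (real n * real (Suc n))"
      unfolding pos_le_divide_eq[OF N] using \<open>real n * real (Suc n) * q ^ n \<le> A * B\<close> by (subst mult.commute)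
    thus ?thesis unfolding pos_divide_le_eq[OF AB0] by simp
  qed
  have scaled: "(1 - q) * monsky_b q m = 1 / real m - q ^ m / X" if "1 - q ^ m = (1 - q) * X" for m X
    unfolding monsky_b_def that right_diff_distrib[of "1 - q"] using q by simp
  have "(1 - q) * (monsky_b q n - monsky_b q (Suc n)) = (1 / real n - 1 / real (Suc n)) - (q ^ n / A - q ^ Suc n / B)"
    unfolding right_diff_distrib scaled[OF A] scaled[OF B] by simp
  also have "1 / real n - 1 / real (Suc n) = 1 / (real n * real (Suc n))" using n by (simp add: field_simps)
  also have "q ^ n / A - q ^ Suc n / B = q ^ n / (A * B)"
  proof -
    have "B - q * A = 1"
    proof -
      have "(1 - q) * (B - q * A) = (1 - q ^ Suc n) - q * (1 - q ^ n)" unfolding A B by (simp add: algebra_simps)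
      also have "\<dots> = (1 - q) * 1" by (simp add: right_diff_distrib)
      finally show ?thesis using q by simp
    qed
    thus ?thesis using A0 B0 by (simp add: field_simps)
  qed
  finally have "(1 - q) * (monsky_b q n - monsky_b q (Suc n)) \<ge> 0" using AB by linarith
  thus ?thesis using q by (simp add: q_def zero_le_mult_iff)
qed

lemma monsky_b_tendsto: 
  assumes "0 < q" "q < 1" shows "monsky_b q \<longlonglongrightarrow> 0"
  unfolding monsky_b_def using assms by real_asymp

lemma abel_partial_sum_bound:
  fixes c b :: "nat \<Rightarrow> real"
  assumes M: "\<And>n. \<bar>\<Sum>k<n. c k\<bar> \<le> M" and dec: "\<And>n. b (Suc n) \<le> b n" and pos: "\<And>n. b n \<ge> 0"
  shows "\<bar>\<Sum>k<n. c k * b k\<bar> \<le> M * b 0"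
proof -
  define C where "C = (\<lambda>n. \<Sum>k<n. c k)"
  have "(\<Sum>k<n. c k * b k) = (\<Sum>k<n. C (Suc k) * (b k - b (Suc k))) + C n * b n" for n
    by (induction n) (auto simp: C_def algebra_simps)
  hence "\<bar>\<Sum>k<n. c k * b k\<bar> \<le> \<bar>\<Sum>k<n. C (Suc k) * (b k - b (Suc k))\<bar> + \<bar>C n * b n\<bar>" by simp
  also have "\<bar>\<Sum>k<n. C (Suc k) * (b k - b (Suc k))\<bar> \<le> (\<Sum>k<n. M * (b k - b (Suc k)))"
  proof (intro order_trans[OF sum_abs] sum_mono)
    fix k
    have "\<bar>b k - b (Suc k)\<bar> = b k - b (Suc k)" using dec[of k] by simp
    thus "\<bar>C (Suc k) * (b k - b (Suc k))\<bar> \<le> M * (b k - b (Suc k))"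
      unfolding abs_mult C_def using dec[of k] by (simp only:) (intro mult_right_mono M, simp)
  qed
  also have "\<bar>C n * b n\<bar> \<le> M * b n" using M pos by (auto simp: abs_mult C_def intro!: mult_right_mono)
  also have "(\<Sum>k<n. M * (b k - b (Suc k))) + M * b n = M * b 0"
    unfolding sum_distrib_left [symmetric] sum_lessThan_telescope' by (simp add: algebra_simps)
  finally show ?thesis by simp
qed

text \<open>
  Monsky's argument. The Lambert series \<open>f(q) = \<Sum> y(n) q\<^sup>n / (1 - q\<^sup>n)\<close> has the power series coefficients
  \<open>\<Sum>\<^bsub>d dvd n\<^esub> y(d) \<ge> 0\<close>, which are at least 1 at squares, so it is unbounded as \<open>q\<close> tends to 1. If \<open>\<Sum> y(n) / n\<close>
  vanished, then \<open>- f(q) = \<Sum> y(n) b\<^sub>n(q)\<close> with \<open>b\<^sub>n(q)\<close> decreasing to 0 from \<open>b\<^sub>1(q) = 1\<close>, and summation by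
  parts would bound \<open>f\<close>.
\<close>

lemma monsky_nonzero:
  fixes y :: "nat \<Rightarrow> real"
  assumes mult: "\<And>m n. y (m * n) = y m * y n" and y1: "y 1 = 1" and vals: "\<And>n. y n \<in> {-1, 0, 1}"
    and M: "\<And>n. \<bar>\<Sum>k<n. y (Suc k)\<bar> \<le> M" and L: "(\<lambda>n. y (Suc n) / real (Suc n)) sums L"
  shows "L \<noteq> 0"
proof
  assume "L = 0"
  have y_le: "\<bar>y n\<bar> \<le> 1" for n using vals[of n] by auto
  define r where "r = (\<lambda>n. \<Sum>d | d dvd n. y d)"
  \<comment> \<open>The bound depends neither on \<open>K\<close> nor on \<open>w\<close>. Letting
    \<open>w\<close> tend to 1 turns the left side into \<open>K\<close>, which can be taken larger
    than \<open>M\<close>.\<close>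
  have main: "(\<Sum>k=1..K. (w\<^sup>2) ^ k\<^sup>2) \<le> M" if w: "0 < w" "w < 1" for w :: real and K :: nat
  proof -
    define q where "q = w\<^sup>2"
    have q: "0 < q" "q < 1" using w by (auto simp: q_def power_less_one_iff)
    define g where "g = (\<lambda>n. q ^ n / (1 - q ^ n))"
    have qn: "q ^ n < 1" if "n > 0" for n using q that by (simp add: power_less_one_iff)
    have geo: "((\<lambda>m. q ^ (n * m)) has_sum g n) {0<..}" if n: "n > 0" for n
    proof -
      have "(\<lambda>m. (q ^ n) ^ m) sums (1 / (1 - q ^ n))" using qn[OF n] q by (intro geometric_sums) auto
      hence "((\<lambda>m. (q ^ n) ^ m) has_sum (1 / (1 - q ^ n))) UNIV"
        using qn[OF n] q by (intro norm_summable_imp_has_sum) (auto simp: power_abs summable_geometric_iff intro!: summable_geometric)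
      hence "((\<lambda>m. (q ^ n) ^ m) has_sum (1 / (1 - q ^ n) - (\<Sum>m\<in>{0}. (q ^ n) ^ m))) (UNIV - {0})"
        by (rule has_sum_Diff[OF _ has_sum_finite]) auto
      moreover have "UNIV - {0} = {0::nat<..}" by auto
      moreover have "1 / (1 - q ^ n) - 1 = g n" using qn[OF n] by (simp add: g_def field_simps)
      ultimately show ?thesis by (simp add: power_mult)
    qed
    have g_le: "0 \<le> g n" "g n \<le> q ^ n / (1 - q)" if "n > 0" for n
    proof -
      have "q ^ n \<le> q ^ 1" using q that by (intro power_decreasing) auto
      thus "0 \<le> g n" "g n \<le> q ^ n / (1 - q)" unfolding g_def using q qn[OF that]
        by (auto intro!: divide_left_mono mult_pos_pos)
    qed
    have g_summ: "summable (\<lambda>n. g (Suc n))"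
    proof (rule summable_comparison_test)
      show "summable (\<lambda>n. q * q ^ n / (1 - q))" using q by (intro summable_divide summable_mult summable_geometric) auto
      show "\<exists>N. \<forall>n\<ge>N. norm (g (Suc n)) \<le> q * q ^ n / (1 - q)"
        using g_le[of "Suc _"] by auto
    qed
    have abs_summ: "summable (\<lambda>n. norm (y n * (if n = 0 then 0 else g n)))"
    proof (subst summable_Suc_iff [symmetric], rule summable_comparison_test[OF _ g_summ])
      have "\<bar>y (Suc n)\<bar> * \<bar>g (Suc n)\<bar> \<le> 1 * \<bar>g (Suc n)\<bar>" for n by (intro mult_right_mono y_le) auto
      thus "\<exists>N. \<forall>n\<ge>N. norm (norm (y (Suc n) * (if Suc n = 0 then 0 else g (Suc n)))) \<le> g (Suc n)"
        using g_le[of "Suc _"] by (auto simp: abs_mult)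
    qed
    define f where "f = (\<Sum>n. y n * (if n = 0 then 0 else g n))"
    have f_sums: "(\<lambda>n. y n * (if n = 0 then 0 else g n)) sums f"
      unfolding f_def by (rule summable_sums[OF summable_norm_cancel[OF abs_summ]])
    have f_hs: "((\<lambda>n. y n * g n) has_sum f) {0<..}"
      using norm_summable_imp_has_sum[OF abs_summ f_sums]
      by (rule has_sum_cong_neutral[THEN iffD1, rotated -1]) auto
    define h where "h = (\<lambda>(n, m). y n * q ^ (n * m))"
    have "(\<lambda>z. norm (h z)) summable_on ({0<..} \<times> {0<..})"
    proof (rule summable_on_SigmaI)
      show "((\<lambda>m. norm (h (n, m))) has_sum \<bar>y n\<bar> * g n) {0<..}" if "n \<in> {0<..}" for n
        using has_sum_cmult_right[OF geo, of n "\<bar>y n\<bar>"] that q by (simp add: h_def abs_mult)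
      have "((\<lambda>n. norm (y n * (if n = 0 then 0 else g n))) summable_on UNIV)"
        using abs_summ by (intro norm_summable_imp_summable_on) simp
      hence "((\<lambda>n. norm (y n * (if n = 0 then 0 else g n))) summable_on {0<..})"
        by (rule summable_on_subset_banach) auto
      thus "(\<lambda>n. \<bar>y n\<bar> * g n) summable_on {0<..}"
        by (rule summable_on_cong[THEN iffD1, rotated]) (use g_le in \<open>auto simp: abs_mult\<close>)
    qed auto
    hence "h summable_on ({0<..} \<times> {0<..})" by (rule abs_summable_summable)
    hence "(h has_sum f) ({0<..} \<times> {0<..})"
    proof (rule has_sum_SigmaI[rotated 2])
      show "((\<lambda>m. h (n, m)) has_sum y n * g n) {0<..}" if "n \<in> {0<..}" for n
        using has_sum_cmult_right[OF geo, of n "y n"] that by (simp add: h_def)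
    qed (rule f_hs)
    from divisor_regroup[OF this] have "((\<lambda>n. \<Sum>d | d dvd n. h (d, n div d)) has_sum f) {0<..}" .
    also have "?this \<longleftrightarrow> ((\<lambda>n. r n * q ^ n) has_sum f) {0<..}"
      by (rule has_sum_cong) (auto simp: h_def r_def sum_distrib_right intro!: sum.cong)
    finally have r_hs: "((\<lambda>n. r n * q ^ n) has_sum f) {0<..}" .
    have r0: "r n \<ge> 0" if "n > 0" for n using sum_dvd_real_character[OF mult y1 vals that] by (simp add: r_def)
    have r1: "r (k\<^sup>2) \<ge> 1" if "k > 0" for k using sum_dvd_real_character[OF mult y1 vals, of "k\<^sup>2"] that by (auto simp: r_def)
    have "(\<Sum>k=1..K. q ^ k\<^sup>2) = (\<Sum>n\<in>(\<lambda>k. k\<^sup>2) ` {1..K}. q ^ n)"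
      by (subst sum.reindex) (auto simp: inj_on_def)
    also have "\<dots> \<le> (\<Sum>n\<in>(\<lambda>k. k\<^sup>2) ` {1..K}. r n * q ^ n)"
      using r1 q by (intro sum_mono) (auto simp: mult_le_cancel_right1)
    also have "\<dots> \<le> f"
      by (rule finite_sum_le_has_sum[OF r_hs]) (use r0 q in auto)
    finally have lower: "(\<Sum>k=1..K. q ^ k\<^sup>2) \<le> f" .
    have "(\<lambda>n. y (Suc n) / real (Suc n) * (1 / (1 - q)) - y (Suc n) * g (Suc n)) sums (L * (1 / (1 - q)) - f)"
    proof (intro sums_diff sums_mult2 L)
      show "(\<lambda>n. y (Suc n) * g (Suc n)) sums f" using f_sums sums_Suc_iff[of "\<lambda>n. y n * (if n = 0 then 0 else g n)" f] by simp
    qed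
    also have "(\<lambda>n. y (Suc n) / real (Suc n) * (1 / (1 - q)) - y (Suc n) * g (Suc n)) = (\<lambda>n. y (Suc n) * monsky_b q (Suc n))"
      by (simp add: fun_eq_iff monsky_b_def g_def right_diff_distrib)
    finally have lim: "(\<lambda>n. \<bar>\<Sum>k<n. y (Suc k) * monsky_b q (Suc k)\<bar>) \<longlonglongrightarrow> \<bar>- f\<bar>"
      unfolding sums_def using \<open>L = 0\<close> by (intro tendsto_rabs) simp
    have dec: "monsky_b q (Suc (Suc n)) \<le> monsky_b q (Suc n)" for n
      unfolding q_def by (rule monsky_b_decreasing[OF w]) simp
    have pos: "monsky_b q (Suc n) \<ge> 0" for n
      by (rule decseq_ge[OF decseq_SucI[of "\<lambda>n. monsky_b q (Suc n)", OF dec] LIMSEQ_Suc[OF monsky_b_tendsto[OF q]]])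
    have b1: "monsky_b q (Suc 0) = 1" using q by (simp add: monsky_b_def field_simps)
    have "\<bar>\<Sum>k<n. y (Suc k) * monsky_b q (Suc k)\<bar> \<le> M" for n
      using abel_partial_sum_bound[of "\<lambda>k. y (Suc k)" M "\<lambda>k. monsky_b q (Suc k)", OF M dec pos, of n] b1 by simp
    hence "\<bar>- f\<bar> \<le> M" by (intro LIMSEQ_le_const2[OF lim]) auto
    thus ?thesis using lower by (simp add: q_def)
  qed
  define K where "K = Suc (nat \<lceil>M\<rceil>)"
  have "((\<lambda>w::real. \<Sum>k=1..K. (w\<^sup>2) ^ k\<^sup>2) \<longlongrightarrow> (\<Sum>k=1..K. (1\<^sup>2) ^ k\<^sup>2)) (at_left 1)"
    by (intro tendsto_intros)
  hence "((\<lambda>w::real. \<Sum>k=1..K. (w\<^sup>2) ^ k\<^sup>2) \<longlongrightarrow> real K) (at_left 1)" by simp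
  moreover have "\<forall>\<^sub>F w in at_left 1. (\<Sum>k=1..K. (w\<^sup>2) ^ k\<^sup>2) \<le> M"
  proof -
    have "\<forall>\<^sub>F w in at_left (1::real). w \<in> {0<..<1}" by (rule eventually_at_left_real) simp
    thus ?thesis by eventually_elim (use main in auto)
  qed
  ultimately have "real K \<le> M" by (rule tendsto_upperbound) auto
  thus False by (simp add: K_def) linarith
qed

section \<open>The Wiener-Ikehara theorem\<close>

text \<open>This is (sin (u/2) / (u/2))^2, the Fourier transform of \<open>tri 1\<close>:
  nonnegative, integrable, and band-limited, so that only a compact piece of the line Re s = 1 is
  seen.\<close>

definition fejer :: "real \<Rightarrow> real" where
  "fejer u = (if u = 0 then 1 else 2 * (1 - cos u) / u\<^sup>2)"

definition tri :: "real \<Rightarrow> real \<Rightarrow> real" where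
  "tri l t = max 0 (1 - \<bar>t\<bar> / l)"

lemma fejer_nonneg: "fejer u \<ge> 0"
  by (simp add: fejer_def)

text \<open>The constant 5 adds the bounds fejer u \<le> 1 and u^2 fejer u \<le> 4.\<close>

lemma fejer_bound: "fejer u \<le> 5 * inverse (1 + u\<^sup>2)"
proof -
  have "fejer u * (1 + u\<^sup>2) \<le> 5"
  proof (cases "u = 0")
    case False
    have "1 - cos u = 2 * (sin (u/2))\<^sup>2" using cos_double_sin[of "u/2"] by simp
    also have "(sin (u/2))\<^sup>2 \<le> (u/2)\<^sup>2" using abs_sin_le_one abs_sin_x_le_abs_x[of "u/2"]
      by (metis abs_le_square_iff)
    finally have "2 * (1 - cos u) \<le> u\<^sup>2" by (simp add: power2_eq_square)
    hence 1: "2 * (1 - cos u) / u\<^sup>2 \<le> 1" using False by (subst divide_le_eq_1_pos) auto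
    have 2: "2 * (1 - cos u) \<le> 4" using cos_ge_minus_one[of u] by argo
    have "fejer u * (1 + u\<^sup>2) = 2 * (1 - cos u) / u\<^sup>2 + 2 * (1 - cos u)"
      using False by (simp add: fejer_def field_simps)
    thus ?thesis using 1 2 by linarith
  qed (simp add: fejer_def)
  moreover have "1 + u\<^sup>2 > 0" by (simp add: add_pos_nonneg)
  ultimately show ?thesis by (simp add: field_simps)
qed

lemma fejer_measurable [measurable]: "fejer \<in> borel_measurable borel"
  unfolding fejer_def by measurable

lemma integrable_fejer: "integrable lborel fejer"
proof (rule Bochner_Integration.integrable_bound)
  show "integrable lborel (\<lambda>x. 5 * inverse (1 + x\<^sup>2) :: real)"
    using integrable_inverse_1_plus_square by (auto simp: set_integrable_def)
  show "AE x in lborel. norm (fejer x) \<le> norm (5 * inverse (1 + x\<^sup>2))"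
    using fejer_bound fejer_nonneg by (intro AE_I2) (metis abs_of_nonneg order_trans real_norm_def abs_ge_self)
qed auto

lemma continuous_tri: "l > 0 \<Longrightarrow> continuous_on A (tri l)"
  unfolding tri_def by (intro continuous_intros) auto

lemma tri_nonneg: "tri l t \<ge> 0" by (simp add: tri_def)

lemma tri_eq_0: "l > 0 \<Longrightarrow> \<bar>t\<bar> \<ge> l \<Longrightarrow> tri l t = 0" by (simp add: tri_def field_simps)

lemma integrable_tri_mult:
  fixes g :: "real \<Rightarrow> complex"
  assumes "l > 0" "continuous_on UNIV g"
  shows "integrable lborel (\<lambda>t. tri l t * g t)"
proof -
  have "integrable lborel (\<lambda>t. indicator {-l..l} t *\<^sub>R (tri l t * g t))"
    using assms by (intro borel_integrable_compact continuous_intros continuous_tri)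
                   (auto intro: continuous_on_subset)
  also have "(\<lambda>t. indicator {-l..l} t *\<^sub>R (tri l t * g t)) = (\<lambda>t. tri l t * g t)"
    using assms(1) by (auto simp: fun_eq_iff indicator_def not_le tri_eq_0)
  finally show ?thesis .
qed

lemma integral_tri:
  assumes "l > 0"
  shows "(LINT t|lborel. tri l t * exp (\<i> * of_real (u * t))) = complex_of_real (l * fejer (l * u))"
proof -
  let ?f = "\<lambda>t. tri l t * exp (\<i> * of_real (u * t))"
  define e where "e = (\<lambda>t. exp (\<i> * of_real (u * t)))"
  \<comment> \<open>Antiderivatives by parts on the two linear pieces of \<open>tri\<close>;
    \<open>u = 0\<close> is separate since the formula divides by \<open>u\<close>.\<close>
  define F where "F = (\<lambda>t. if u = 0 then complex_of_real (t - t\<^sup>2 / (2*l)) else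
      (1 - t / l) * e t / (\<i> * u) - e t / (l * u\<^sup>2))"
  define G where "G = (\<lambda>t. if u = 0 then complex_of_real (t + t\<^sup>2 / (2*l)) else
      (1 + t / l) * e t / (\<i> * u) + e t / (l * u\<^sup>2))"
  have de: "(e has_vector_derivative \<i> * u * e t) (at t within S)" for t S
    unfolding e_def
    by (rule has_vector_derivative_real_field derivative_eq_intros refl | simp)+
  have 1: "(?f has_integral (F l - F 0)) {0..l}"
  proof (rule fundamental_theorem_of_calculus)
    fix t assume t: "t \<in> {0..l}"
    hence tri: "tri l t = 1 - t / l" using assms by (simp add: tri_def)
    have "(F has_vector_derivative (1 - t/l) * e t) (at t within {0..l})"
    proof (cases "u = 0")
      case True
      have "((\<lambda>t. t - t\<^sup>2 / (2*l)) has_real_derivative (1 - t/l)) (at t within {0..l})"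
        using assms by (auto intro!: derivative_eq_intros)
      from has_vector_derivative_of_real[OF this] show ?thesis using True unfolding F_def e_def by (simp del: of_real_add of_real_diff)
    next
      case False
      thus ?thesis unfolding F_def using assms
        by (auto intro!: derivative_eq_intros de simp: field_simps power2_eq_square)
    qed
    thus "(F has_vector_derivative ?f t) (at t within {0..l})" by (simp add: tri e_def)
  qed (use assms in auto)
  have 2: "(?f has_integral (G 0 - G (-l))) {-l..0}"
  proof (rule fundamental_theorem_of_calculus)
    fix t assume t: "t \<in> {-l..0}"
    hence tri: "tri l t = 1 + t / l" using assms by (simp add: tri_def field_simps)
    have "(G has_vector_derivative (1 + t/l) * e t) (at t within {-l..0})"
    proof (cases "u = 0")
      case True
      have "((\<lambda>t. t + t\<^sup>2 / (2*l)) has_real_derivative (1 + t/l)) (at t within {-l..0})"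
        using assms by (auto intro!: derivative_eq_intros)
      from has_vector_derivative_of_real[OF this] show ?thesis using True unfolding G_def e_def by (simp del: of_real_add of_real_diff)
    next
      case False
      thus ?thesis unfolding G_def using assms
        by (auto intro!: derivative_eq_intros de simp: field_simps power2_eq_square)
    qed
    thus "(G has_vector_derivative ?f t) (at t within {-l..0})" by (simp add: tri e_def)
  qed (use assms in auto)
  have "(?f has_integral (G 0 - G (-l) + (F l - F 0))) {-l..l}"
    using assms by (intro has_integral_combine[OF _ _ 2 1]) auto
  also have "(G 0 - G (-l) + (F l - F 0)) = complex_of_real (l * fejer (l * u))"
  proof (cases "u = 0")
    case True
    thus ?thesis using assms by (simp add: F_def G_def fejer_def power2_eq_square field_simps)
  next
    case False
    have e: "e l + e (-l) = 2 * cos (l * u)"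
      using cos_exp_eq[of "complex_of_real (l * u)"] unfolding cos_of_real
      by (simp add: e_def mult_ac)
    have "(G 0 - G (-l) + (F l - F 0)) = (2 - (e l + e (-l))) / (l * u\<^sup>2)"
      using assms False by (simp add: F_def G_def e_def field_simps)
    also have "\<dots> = complex_of_real (l * fejer (l * u))"
      unfolding e using assms False by (simp add: fejer_def power2_eq_square field_simps)
    finally show ?thesis .
  qed
  finally have "(?f has_integral complex_of_real (l * fejer (l * u))) UNIV"
    by (rule has_integral_on_superset) (use assms in \<open>auto simp: tri_eq_0\<close>)
  moreover have "integrable lborel ?f"
    using assms by (intro integrable_tri_mult continuous_intros)
  ultimately show ?thesis
    using has_integral_integral_lborel has_integral_unique by blast
qed

text \<open>Translating the variable by pi / v flips the sign of the exponential, so twice the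
  integral is that of \<phi>(t) - \<phi>(t + pi / v) against the exponential. This difference tends
  to 0 by continuity, with a dominating function of compact support.\<close>

lemma riemann_lebesgue_tri:
  fixes g :: "real \<Rightarrow> complex"
  assumes "l > 0" "continuous_on UNIV g"
  shows "((\<lambda>v. LINT t|lborel. tri l t * g t * exp (\<i> * of_real (v * t))) \<longlongrightarrow> 0) at_top"
proof -
  define \<phi> where "\<phi> = (\<lambda>t. tri l t * g t)"
  have cont: "continuous_on A \<phi>" for A
    unfolding \<phi>_def using assms by (auto intro!: continuous_intros continuous_tri intro: continuous_on_subset)
  have int: "integrable lborel (\<lambda>t. \<phi> t * exp (\<i> * of_real (v * t)))" for v
    unfolding \<phi>_def mult.assoc using assms by (intro integrable_tri_mult continuous_intros)
  define J where "J = (\<lambda>v. LINT t|lborel. \<phi> t * exp (\<i> * of_real (v * t)))"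
  have bound: "norm (J v) \<le> (LINT t|lborel. norm (\<phi> t - \<phi> (t + pi / v))) / 2" if v: "v > 0" for v
  proof -
    have "J v = (LINT t|lborel. \<phi> (pi/v + 1 * t) * exp (\<i> * of_real (v * (pi/v + 1 * t))))"
      unfolding J_def by (subst lborel_integral_real_affine[where c=1 and t="pi/v"]) auto
    also have "\<dots> = (LINT t|lborel. - (\<phi> (t + pi/v) * exp (\<i> * of_real (v * t))))"
    proof (intro Bochner_Integration.integral_cong refl)
      fix t
      have *: "v * (pi/v + 1 * t) = v * t + pi" using v by (simp add: field_simps)
      have "exp (\<i> * of_real (v * (pi/v + 1 * t))) = exp (\<i> * of_real (v * t)) * exp (\<i> * pi)"
        unfolding * by (simp add: exp_add distrib_left)
      thus "\<phi> (pi/v + 1 * t) * exp (\<i> * of_real (v * (pi/v + 1 * t))) = - (\<phi> (t + pi/v) * exp (\<i> * of_real (v * t)))"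
        by (simp add: add.commute)
    qed
    finally have J2: "J v = - (LINT t|lborel. \<phi> (t + pi/v) * exp (\<i> * of_real (v * t)))" by simp
    have int': "integrable lborel (\<lambda>t. \<phi> (t + pi/v) * exp (\<i> * of_real (v * t)))"
    proof -
      have "integrable lborel (\<lambda>t. \<phi> (pi/v + 1 * t) * exp (\<i> * of_real (0 * (pi/v + 1 * t))))"
        using lborel_integrable_real_affine[OF int[of 0], of 1 "pi/v"] by simp
      hence "integrable lborel (\<lambda>t. \<phi> (t + pi/v))" by (simp add: add.commute)
      hence "integrable lborel (\<lambda>t. norm (\<phi> (t + pi/v)))" by simp
      thus ?thesis
        by (rule Bochner_Integration.integrable_bound)
           (auto simp: norm_mult intro!: borel_measurable_continuous_onI continuous_intros
             continuous_on_compose2[OF cont[of UNIV]])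
    qed
    have "2 * J v = (LINT t|lborel. (\<phi> t - \<phi> (t + pi/v)) * exp (\<i> * of_real (v * t)))"
      unfolding left_diff_distrib using Bochner_Integration.integral_diff[OF int[of v] int'] J2 by (simp add: J_def)
    hence "2 * norm (J v) = norm (LINT t|lborel. (\<phi> t - \<phi> (t + pi/v)) * exp (\<i> * of_real (v * t)))"
      by (metis norm_mult norm_numeral)
    also have "\<dots> \<le> (LINT t|lborel. norm ((\<phi> t - \<phi> (t + pi/v)) * exp (\<i> * of_real (v * t))))"
      by (rule integral_norm_bound)
    finally show ?thesis by (simp add: norm_mult)
  qed
  obtain M where M: "\<And>t. norm (\<phi> t) \<le> M"
  proof -
    have "compact (\<phi> ` {-l..l})" by (intro compact_continuous_image cont) auto
    hence "bounded (\<phi> ` {-l..l})" by (rule compact_imp_bounded)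
    then obtain M where M: "\<And>t. t \<in> {-l..l} \<Longrightarrow> norm (\<phi> t) \<le> M" unfolding bounded_iff by blast
    have "norm (\<phi> t) \<le> max M 0" for t
      using M[of t] assms(1) by (cases "t \<in> {-l..l}") (auto simp: \<phi>_def tri_eq_0)
    thus ?thesis using that by blast
  qed
  have lim: "((\<lambda>v. LINT t|lborel. norm (\<phi> t - \<phi> (t + pi / v))) \<longlongrightarrow> (LINT t|(lborel::real measure). 0)) at_top"
  proof (rule integral_dominated_convergence_at_top)
    show "(\<lambda>t. norm (\<phi> t - \<phi> (t + pi / v))) \<in> borel_measurable lborel" for v
      by (auto intro!: borel_measurable_continuous_onI continuous_intros
             continuous_on_compose2[OF cont[of UNIV]] cont)
    \<comment> \<open>For v \<ge> 1 the shift is at most pi, so both terms vanish outside this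
      interval.\<close>
    have "integrable lborel (\<lambda>t. indicator {-l-pi..l+pi} t *\<^sub>R (2 * M))"
      by (intro borel_integrable_compact) auto
    thus "integrable lborel (\<lambda>t. indicator {-l-pi..l+pi} t * (2 * M))" by simp
    show "\<forall>\<^sub>F v in at_top. AE t in lborel. norm (norm (\<phi> t - \<phi> (t + pi / v))) \<le> indicator {-l-pi..l+pi} t * (2 * M)"
      using eventually_ge_at_top[of 1]
    proof eventually_elim
      case (elim v)
      have p: "0 \<le> pi / v" "pi / v \<le> pi" using elim by (auto simp: field_simps)
      show ?case
      proof (rule AE_I2)
        fix t
        show "norm (norm (\<phi> t - \<phi> (t + pi / v))) \<le> indicator {-l-pi..l+pi} t * (2 * M)"
        proof (cases "t \<in> {-l-pi..l+pi}")
          case True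
          thus ?thesis using norm_triangle_ineq4[of "\<phi> t" "\<phi> (t + pi / v)"] M[of t] M[of "t + pi/v"] by simp
        next
          case False
          hence "\<bar>t\<bar> \<ge> l" "\<bar>t + pi/v\<bar> \<ge> l" using p assms(1) pi_gt_zero by auto
          thus ?thesis using False assms(1) by (simp add: \<phi>_def tri_eq_0)
        qed
      qed
    qed
    show "AE t in lborel. ((\<lambda>v. norm (\<phi> t - \<phi> (t + pi / v))) \<longlongrightarrow> 0) at_top"
    proof (rule AE_I2)
      fix t
      have "((\<lambda>v. t + pi / v) \<longlongrightarrow> t) at_top" by real_asymp
      moreover have "isCont \<phi> t" using cont[of UNIV] by (simp add: continuous_on_eq_continuous_at)
      ultimately have "((\<lambda>v. \<phi> (t + pi / v)) \<longlongrightarrow> \<phi> t) at_top" by (rule isCont_tendsto_compose[rotated])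
      hence "((\<lambda>v. norm (\<phi> t - \<phi> (t + pi / v))) \<longlongrightarrow> norm (\<phi> t - \<phi> t)) at_top" by (intro tendsto_intros)
      thus "((\<lambda>v. norm (\<phi> t - \<phi> (t + pi / v))) \<longlongrightarrow> 0) at_top" by simp
    qed
  qed auto
  have "(J \<longlongrightarrow> 0) at_top"
  proof (rule Lim_null_comparison)
    show "\<forall>\<^sub>F v in at_top. norm (J v) \<le> (LINT t|lborel. norm (\<phi> t - \<phi> (t + pi / v))) / 2"
      using eventually_gt_at_top[of 0] by eventually_elim (rule bound)
    show "((\<lambda>v. (LINT t|lborel. norm (\<phi> t - \<phi> (t + pi / v))) / 2) \<longlongrightarrow> 0) at_top"
      using tendsto_divide[OF lim tendsto_const[of 2]] by simp
  qed
  thus ?thesis unfolding J_def \<phi>_def .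
qed

text \<open>
  Averaging \<open>B - c\<close> against dilated Fejer kernels turns into an integral of the boundary values of its Laplace
  transform over a compact interval, which tends to 0 by the Riemann-Lebesgue lemma. As \<open>B u * exp u\<close> is
  increasing, \<open>B\<close> can be recovered from its averages over short intervals.
\<close>

context
  fixes B :: "real \<Rightarrow> real" and c :: real and h :: "complex \<Rightarrow> complex"
  assumes B_meas [measurable]: "B \<in> borel_measurable borel"
    and B_nonneg: "\<And>u. B u \<ge> 0"
    and B_neg: "\<And>u. u < 0 \<Longrightarrow> B u = 0"
    and B_int: "\<And>e. e > 0 \<Longrightarrow> integrable lborel (\<lambda>u. B u * exp (- e * u))"
    and B_slow: "\<And>u v. 0 \<le> u \<Longrightarrow> u \<le> v \<Longrightarrow> B u * exp (u - v) \<le> B v"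
    and h_cont: "continuous_on {z. Re z \<ge> 0} h"
    and h_eq: "\<And>z. Re z > 0 \<Longrightarrow>
      h z = (LINT u|lborel. complex_of_real (B u - c * indicator {0..} u) * exp (- (z * of_real u)))"
begin

private lemma ind_int: "e > 0 \<Longrightarrow> integrable lborel (\<lambda>u. indicator {0..} u * exp (- e * u) :: real)"
proof -
  assume e: "e > 0"
  have "integrable lborel (\<lambda>u. indicator {0<..} u *\<^sub>R exp (- (u * e)))"
    using integrable_I0i_exp_mscale[OF e] by (simp add: set_integrable_def)
  thus ?thesis
  proof (rule integrable_cong_AE_imp)
    show "AE u in lborel. indicator {0<..} u *\<^sub>R exp (- (u * e)) = indicator {0..} u * exp (- e * u)"
      using AE_lborel_singleton[of 0] by eventually_elim (auto simp: indicator_def mult.commute)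
  qed auto
qed

private lemma a_int: 
  assumes "e > 0" shows "integrable lborel (\<lambda>u. (B u - c * indicator {0..} u) * exp (- e * u))"
proof -
  have "integrable lborel (\<lambda>u. B u * exp (- e * u) - c * (indicator {0..} u * exp (- e * u)))"
    by (intro Bochner_Integration.integrable_diff integrable_mult_right B_int ind_int assms)
  thus ?thesis by (simp add: algebra_simps)
qed

text \<open>On the line Re z = e > 0 the double integral converges absolutely. Fubini then exchanges
  the Laplace transform with the integral over \<open>t\<close>, and \<open>integral_tri\<close>
  evaluates the inner integral.\<close>

private lemma smoothed_eps:
  assumes l: "l > 0" and e: "e > 0"
  shows "(LINT t|lborel. tri l t * (h (Complex e t) * exp (\<i> * of_real (v * t)))) =
         complex_of_real (LINT u|lborel. (B u - c * indicator {0..} u) * exp (- e * u) * (l * fejer (l * (v - u))))"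
proof -
  define a where "a = (\<lambda>u. (B u - c * indicator {0..} u) * exp (- e * u))"
  have [measurable]: "a \<in> borel_measurable borel" unfolding a_def by measurable
  have aint: "integrable lborel a" unfolding a_def by (rule a_int[OF e])
  have [measurable]: "tri l \<in> borel_measurable borel"
    by (intro borel_measurable_continuous_onI continuous_tri l)
  have triint: "integrable lborel (tri l)"
    using integrable_tri_mult[of l "\<lambda>_. 1"] l by (simp add: complex_of_real_integrable_eq)
  define F where "F = (\<lambda>t u. complex_of_real (tri l t) * (complex_of_real (a u) * exp (\<i> * of_real ((v - u) * t))))"
  have normF: "norm (F t u) = tri l t * \<bar>a u\<bar>" for t u
    using tri_nonneg[of l t] by (simp add: F_def norm_mult)
  have Fint: "integrable (lborel \<Otimes>\<^sub>M lborel) (case_prod F)"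
  proof (rule lborel_pair.Fubini_integrable)
    show "case_prod F \<in> borel_measurable (lborel \<Otimes>\<^sub>M lborel)"
      unfolding F_def by measurable
    show "integrable lborel (\<lambda>t. LINT u|lborel. norm (case (t, u) of (x, xa) \<Rightarrow> F x xa))"
      by (simp add: normF triint)
    show "AE t in lborel. complex_integrable lborel (\<lambda>u. case (t, u) of (x, xa) \<Rightarrow> F x xa)"
    proof (rule AE_I2)
      fix t
      have "integrable lborel (\<lambda>u. tri l t * \<bar>a u\<bar>)" using aint by auto
      moreover have "F t \<in> borel_measurable lborel" unfolding F_def by measurable
      ultimately have "complex_integrable lborel (F t)"
        by (rule Bochner_Integration.integrable_bound) (simp add: normF tri_nonneg abs_mult)
      thus "complex_integrable lborel (\<lambda>u. case (t, u) of (x, xa) \<Rightarrow> F x xa)" by simp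
    qed
  qed
  have 1: "(LINT u|lborel. F t u) = tri l t * (h (Complex e t) * exp (\<i> * of_real (v * t)))" for t
  proof -
    have "h (Complex e t) = (LINT u|lborel. complex_of_real (a u) * exp (- (\<i> * of_real (t * u))))"
    proof (subst h_eq)
      have "exp (- (Complex e t * complex_of_real u)) = complex_of_real (exp (- e * u)) * exp (- (\<i> * of_real (t * u)))" for u
        by (simp add: Complex_eq exp_of_real [symmetric] mult_exp_exp algebra_simps)
      thus "(LINT u|lborel. complex_of_real (B u - c * indicator {0..} u) * exp (- (Complex e t * complex_of_real u))) =
            (LINT u|lborel. complex_of_real (a u) * exp (- (\<i> * of_real (t * u))))"
        by (simp add: a_def mult.assoc)
    qed (use e in auto)
    hence "tri l t * (h (Complex e t) * exp (\<i> * of_real (v * t))) =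
       (LINT u|lborel. tri l t * ((complex_of_real (a u) * exp (- (\<i> * of_real (t * u)))) * exp (\<i> * of_real (v * t))))"
      by simp
    also have "\<dots> = (LINT u|lborel. F t u)"
      unfolding F_def by (intro Bochner_Integration.integral_cong refl)
        (simp add: mult.assoc mult_exp_exp algebra_simps)
    finally show ?thesis by simp
  qed
  have 2: "(LINT t|lborel. F t u) = complex_of_real (a u * (l * fejer (l * (v - u))))" for u
  proof -
    have "(LINT t|lborel. F t u) = (LINT t|lborel. a u * (tri l t * exp (\<i> * of_real ((v - u) * t))))"
      unfolding F_def by (intro Bochner_Integration.integral_cong refl) simp
    also have "\<dots> = complex_of_real (a u) * (LINT t|lborel. tri l t * exp (\<i> * of_real ((v - u) * t)))"
      by (rule integral_mult_right_zero)
    also have "\<dots> = complex_of_real (a u * (l * fejer (l * (v - u))))"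
      by (subst integral_tri[OF l]) simp
    finally show ?thesis .
  qed
  have "(LINT t|lborel. tri l t * (h (Complex e t) * exp (\<i> * of_real (v * t)))) =
        (LINT t|lborel. (LINT u|lborel. F t u))" by (simp add: 1)
  also have "\<dots> = (LINT u|lborel. (LINT t|lborel. F t u))"
    using lborel_pair.Fubini_integral[OF Fint] by simp
  also have "\<dots> = complex_of_real (LINT u|lborel. a u * (l * fejer (l * (v - u))))"
    by (simp only: 2 integral_complex_of_real)
  finally show ?thesis unfolding a_def .
qed

private lemma fejer_le_5: "fejer u \<le> 5"
proof -
  have "inverse (1 + u\<^sup>2) \<le> 1" by (simp add: inverse_eq_divide add_pos_nonneg)
  thus ?thesis using fejer_bound[of u] by linarith
qed

private lemma kernel_int:
  assumes l: "l > 0" shows "integrable lborel (\<lambda>u. l * fejer (l * (v - u)))"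
proof -
  have "integrable lborel (\<lambda>u. fejer (l * v + (- l) * u))"
    by (rule lborel_integrable_real_affine[OF integrable_fejer]) (use l in auto)
  thus ?thesis by (simp add: algebra_simps)
qed

text \<open>The case e = 0, as a limit. Dominated convergence handles the boundary integral
  (\<open>h\<close> is bounded on a compact rectangle) and the part with \<open>c\<close>. For the
  part with \<open>B\<close> no integrable majorant is at hand; monotone convergence gives both its
  limit and the integrability in the first claim, using \<open>B \<ge> 0\<close> and
  \<open>B = 0\<close> on the negative axis.\<close>

private lemma smoothed:
  assumes l: "l > 0"
  defines "K \<equiv> \<lambda>v u. l * fejer (l * (v - u))"
  shows "integrable lborel (\<lambda>u. B u * K v u)" (is ?A)
    and "complex_of_real (LINT u|lborel. B u * K v u) =
          (LINT t|lborel. tri l t * h (Complex 0 t) * exp (\<i> * of_real (v * t))) +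
          complex_of_real (c * (LINT u|lborel. indicator {0..} u * K v u))" (is ?B)
proof -
  have K_nonneg: "K v u \<ge> 0" for u using l fejer_nonneg by (simp add: K_def)
  have K_le: "K v u \<le> 5 * l" for u using l fejer_le_5[of "l * (v - u)"] by (simp add: K_def)
  have Kint: "integrable lborel (K v)" unfolding K_def by (rule kernel_int[OF l])
  have Kmeas [measurable]: "K v \<in> borel_measurable borel" unfolding K_def by measurable
  define eps where "eps = (\<lambda>n. 1 / real (Suc n))"
  have eps: "eps n > 0" "eps n \<le> 1" for n by (auto simp: eps_def)
  have eps_lim: "eps \<longlonglongrightarrow> 0" unfolding eps_def by real_asymp
  have eps_mono: "m \<le> n \<Longrightarrow> eps n \<le> eps m" for m n by (auto simp: eps_def field_simps)
  define X where "X = (\<lambda>n. LINT u|lborel. (B u - c * indicator {0..} u) * exp (- eps n * u) * K v u)"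
  define Y where "Y = (\<lambda>n. LINT u|lborel. indicator {0..} u * exp (- eps n * u) * K v u)"
  define Z where "Z = (\<lambda>n. LINT u|lborel. B u * exp (- eps n * u) * K v u)"
  have intK: "integrable lborel (\<lambda>u. g u * K v u)" if "integrable lborel g" for g :: "real \<Rightarrow> real"
  proof (rule Bochner_Integration.integrable_bound)
    show "integrable lborel (\<lambda>u. g u * (5 * l))" using that by auto
    have "norm (g u * K v u) \<le> norm (g u * (5 * l))" for u
      using K_nonneg[of u] K_le[of u] l by (simp add: abs_mult mult_left_mono)
    thus "AE u in lborel. norm (g u * K v u) \<le> norm (g u * (5 * l))" by (intro AE_I2)
    have [measurable]: "g \<in> borel_measurable borel" using that borel_measurable_integrable by fastforce
    show "(\<lambda>u. g u * K v u) \<in> borel_measurable lborel" by measurable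
  qed
  have intZ: "integrable lborel (\<lambda>u. B u * exp (- eps n * u) * K v u)" for n
    by (intro intK B_int eps)
  have intY: "integrable lborel (\<lambda>u. indicator {0..} u * exp (- eps n * u) * K v u)" for n
    by (intro intK ind_int eps)
  have XYZ: "X n = Z n - c * Y n" for n
  proof -
    have "Z n - c * Y n = (LINT u|lborel. B u * exp (- eps n * u) * K v u - c * (indicator {0..} u * exp (- eps n * u) * K v u))"
      unfolding Y_def Z_def
      by (subst Bochner_Integration.integral_diff[OF intZ integrable_mult_right[OF intY]]) simp
    also have "\<dots> = X n" unfolding X_def by (intro Bochner_Integration.integral_cong refl) (simp add: algebra_simps)
    finally show ?thesis ..
  qed
  define G where "G = (\<lambda>e t. tri l t * (h (Complex e t) * exp (\<i> * of_real (v * t))))"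
  have G_cont: "continuous_on UNIV (G e)" if "e \<ge> 0" for e
    unfolding G_def using that
    by (intro continuous_intros continuous_tri l continuous_on_compose2[OF h_cont]) (auto simp: Complex_eq intro!: continuous_intros)
  have "(\<lambda>n. LINT t|lborel. G (eps n) t) \<longlonglongrightarrow> (LINT t|lborel. G 0 t)"
  proof -
    define S where "S = cbox (Complex 0 (-l)) (Complex 1 l)"
    have "compact (h ` S)" unfolding S_def
      by (intro compact_continuous_image compact_cbox continuous_on_subset[OF h_cont])
         (auto simp: in_cbox_complex_iff)
    then obtain M where M: "\<And>z. z \<in> S \<Longrightarrow> norm (h z) \<le> M"
      using compact_imp_bounded bounded_iff by (metis imageI)
    show ?thesis
    proof (rule integral_dominated_convergence)
      show "G 0 \<in> borel_measurable lborel" 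
        using borel_measurable_continuous_onI[OF G_cont[of 0]] by simp
      show "G (eps n) \<in> borel_measurable lborel" for n
        using borel_measurable_continuous_onI[OF G_cont[of "eps n"]] eps[of n] by simp
      have "integrable lborel (\<lambda>t. tri l t * complex_of_real M)"
        by (intro integrable_tri_mult l) auto
      thus "integrable lborel (\<lambda>t. tri l t * M)"
        unfolding of_real_mult [symmetric] complex_of_real_integrable_eq .
      show "AE t in lborel. (\<lambda>n. G (eps n) t) \<longlonglongrightarrow> G 0 t"
      proof (rule AE_I2)
        fix t
        have "(\<lambda>n. h (Complex (eps n) t)) \<longlonglongrightarrow> h (Complex 0 t)"
          by (rule continuous_on_tendsto_compose[OF h_cont tendsto_Complex[OF eps_lim tendsto_const]])
             (use eps in \<open>auto simp: less_imp_le\<close>)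
        thus "(\<lambda>n. G (eps n) t) \<longlonglongrightarrow> G 0 t" unfolding G_def by (intro tendsto_intros)
      qed
      show "AE t in lborel. norm (G (eps n) t) \<le> tri l t * M" for n
      proof (rule AE_I2)
        fix t
        show "norm (G (eps n) t) \<le> tri l t * M"
        proof (cases "\<bar>t\<bar> \<le> l")
          case True
          hence "Complex (eps n) t \<in> S" using eps[of n] by (auto simp: S_def in_cbox_complex_iff)
          from M[OF this] show ?thesis using tri_nonneg[of l t]
            by (simp add: G_def norm_mult mult_left_mono)
        qed (use l in \<open>auto simp: G_def tri_eq_0\<close>)
      qed
    qed
  qed
  also have "(\<lambda>n. LINT t|lborel. G (eps n) t) = (\<lambda>n. complex_of_real (X n))"
    unfolding G_def X_def K_def using smoothed_eps[OF l eps(1)] by simp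
  finally have Xlim: "(\<lambda>n. complex_of_real (X n)) \<longlonglongrightarrow> (LINT t|lborel. G 0 t)" .
  hence ReX: "X \<longlonglongrightarrow> Re (LINT t|lborel. G 0 t)" using tendsto_Re by fastforce
  hence Teq: "(LINT t|lborel. G 0 t) = complex_of_real (Re (LINT t|lborel. G 0 t))"
    using LIMSEQ_unique[OF Xlim tendsto_of_real[OF ReX]] by simp
  have Ylim: "Y \<longlonglongrightarrow> (LINT u|lborel. indicator {0..} u * K v u)"
    unfolding Y_def
  proof (rule integral_dominated_convergence)
    show "integrable lborel (K v)" by (rule Kint)
    show "AE u in lborel. (\<lambda>n. indicator {0..} u * exp (- eps n * u) * K v u) \<longlonglongrightarrow> indicator {0..} u * K v u"
    proof (rule AE_I2)
      fix u
      have "(\<lambda>n. indicator {0..} u * exp (- eps n * u) * K v u) \<longlonglongrightarrow> indicator {0..} u * exp (- 0 * u) * K v u"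
        by (intro tendsto_intros eps_lim)
      thus "(\<lambda>n. indicator {0..} u * exp (- eps n * u) * K v u) \<longlonglongrightarrow> indicator {0..} u * K v u" by simp
    qed
    show "AE u in lborel. norm (indicator {0..} u * exp (- eps n * u) * K v u) \<le> K v u" for n
      using eps(1)[of n] K_nonneg by (intro AE_I2) (auto simp: indicator_def mult_left_le_one_le)
  qed auto
  have Zlim: "Z \<longlonglongrightarrow> Re (LINT t|lborel. G 0 t) + c * (LINT u|lborel. indicator {0..} u * K v u)"
    using tendsto_add[OF ReX tendsto_mult[OF tendsto_const[of c] Ylim]] by (simp add: XYZ)
  have mono: "AE u in lborel. mono (\<lambda>n. B u * exp (- eps n * u) * K v u)"
  proof (intro AE_I2 monoI)
    fix u :: real and m n :: nat assume mn: "m \<le> n"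
    show "B u * exp (- eps m * u) * K v u \<le> B u * exp (- eps n * u) * K v u"
    proof (cases "u < 0")
      case False
      hence "- eps m * u \<le> - eps n * u" using eps_mono[OF mn] by (simp add: mult_right_mono)
      thus ?thesis by (intro mult_right_mono mult_left_mono B_nonneg K_nonneg) auto
    qed (simp add: B_neg)
  qed
  have lim: "AE u in lborel. (\<lambda>n. B u * exp (- eps n * u) * K v u) \<longlonglongrightarrow> B u * K v u"
  proof (rule AE_I2)
    fix u
    have "(\<lambda>n. B u * exp (- eps n * u) * K v u) \<longlonglongrightarrow> B u * exp (- 0 * u) * K v u"
      by (intro tendsto_intros eps_lim)
    thus "(\<lambda>n. B u * exp (- eps n * u) * K v u) \<longlonglongrightarrow> B u * K v u" by simp
  qed
  have hb: "has_bochner_integral lborel (\<lambda>u. B u * K v u)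
      (Re (LINT t|lborel. G 0 t) + c * (LINT u|lborel. indicator {0..} u * K v u))"
    by (rule has_bochner_integral_monotone_convergence[OF intZ mono lim Zlim[unfolded Z_def]]) auto
  show ?A using hb by (rule integrable.intros)
  have "G 0 = (\<lambda>t. tri l t * h (Complex 0 t) * exp (\<i> * of_real (v * t)))"
    by (simp add: G_def mult.assoc)
  thus ?B using has_bochner_integral_integral_eq[OF hb] Teq by simp
qed

private definition "I = (LINT u|lborel. fejer u)"
private definition "\<kappa> T = (LINT u|lborel. indicator {-T..T} u * fejer u)"
text \<open>Up to the factor \<open>I\<close>, an average of \<open>B\<close> around
  \<open>v\<close> on the scale \<open>1 / l\<close>.\<close>

private definition "W l v = (LINT w|lborel. B (v - w / l) * fejer w)"

private lemma substitute:
  assumes l: "l > 0"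
  shows "(LINT u|lborel. g u * (l * fejer (l * (v - u)))) = (LINT w|lborel. g (v - w / l) * fejer w)"
proof -
  have "(LINT w|lborel. g (v - w / l) * fejer w) =
        \<bar>-l\<bar> *\<^sub>R (LINT u|lborel. g (v - (l * v + (-l) * u) / l) * fejer (l * v + (- l) * u))"
    using l by (intro lborel_integral_real_affine) auto
  also have "\<dots> = (LINT u|lborel. l * (g (v - (l * v + (-l) * u) / l) * fejer (l * v + (- l) * u)))"
    using l by simp
  also have "\<dots> = (LINT u|lborel. g u * (l * fejer (l * (v - u))))"
  proof (intro Bochner_Integration.integral_cong refl)
    fix u
    have "v - (l * v + (-l) * u) / l = u" "l * v + (- l) * u = l * (v - u)" using l by (auto simp: field_simps)
    thus "l * (g (v - (l * v + (-l) * u) / l) * fejer (l * v + (- l) * u)) = g u * (l * fejer (l * (v - u)))"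
      by simp
  qed
  finally show ?thesis ..
qed

private lemma W_int:
  assumes l: "l > 0"
  shows "integrable lborel (\<lambda>w. B (v - w / l) * fejer w)"
proof -
  have "integrable lborel (\<lambda>w. B (v + (-1/l) * w) * (l * fejer (l * (v - (v + (-1/l) * w)))))"
    by (rule lborel_integrable_real_affine[OF smoothed(1)[OF l, of v]]) (use l in auto)
  also have "(\<lambda>w. B (v + (-1/l) * w) * (l * fejer (l * (v - (v + (-1/l) * w))))) = (\<lambda>w. l * (B (v - w / l) * fejer w))"
    using l by auto
  finally show ?thesis using l by simp
qed

text \<open>By \<open>smoothed\<close>, \<open>W l v\<close> is a boundary integral, which vanishes
  by the Riemann-Lebesgue lemma, plus \<open>c\<close> times the part of the kernel's mass that
  falls on u \<ge> 0; this part exhausts \<open>I\<close> as \<open>v\<close> grows.\<close>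

private lemma W_tendsto:
  assumes l: "l > 0"
  shows "(W l \<longlongrightarrow> c * I) at_top"
proof -
  have 1: "((\<lambda>v. LINT t|lborel. tri l t * h (Complex 0 t) * exp (\<i> * of_real (v * t))) \<longlongrightarrow> 0) at_top"
    by (intro riemann_lebesgue_tri l continuous_on_compose2[OF h_cont])
       (auto simp: Complex_eq intro!: continuous_intros)
  have 2: "((\<lambda>v. LINT w|lborel. indicator {0..} (v - w / l) * fejer w) \<longlongrightarrow> I) at_top"
    unfolding I_def
  proof (rule integral_dominated_convergence_at_top[OF _ _ integrable_fejer])
    show "\<forall>\<^sub>F v in at_top. AE w in lborel. norm (indicator {0..} (v - w / l) * fejer w) \<le> fejer w"
      using fejer_nonneg by (intro always_eventually allI AE_I2) (auto simp: indicator_def)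
    show "AE w in lborel. ((\<lambda>v. indicator {0..} (v - w / l) * fejer w) \<longlongrightarrow> fejer w) at_top"
    proof (rule AE_I2)
      fix w
      have "\<forall>\<^sub>F v in at_top. indicator {0..} (v - w / l) * fejer w = fejer w"
        using eventually_ge_at_top[of "w / l"] by eventually_elim (auto simp: indicator_def)
      thus "((\<lambda>v. indicator {0..} (v - w / l) * fejer w) \<longlongrightarrow> fejer w) at_top"
        by (rule tendsto_eventually)
    qed
  qed auto
  have "((\<lambda>v. complex_of_real (W l v)) \<longlongrightarrow> 0 + complex_of_real (c * I)) at_top"
    unfolding W_def substitute[OF l, symmetric] smoothed(2)[OF l]
    using 2 unfolding substitute[OF l] by (intro tendsto_add 1 tendsto_of_real tendsto_mult tendsto_const)
  thus ?thesis by (simp only: add_0 tendsto_of_real_iff)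
qed

private lemma kappa_int: "integrable lborel (\<lambda>u. indicator {-T..T} u * fejer u)"
  using integrable_mult_indicator[of "{-T..T}" lborel fejer] integrable_fejer by simp

private lemma kappa_tendsto: "(\<kappa> \<longlongrightarrow> I) at_top"
  unfolding \<kappa>_def I_def
proof (rule integral_dominated_convergence_at_top[OF _ _ integrable_fejer])
  show "\<forall>\<^sub>F T in at_top. AE w in lborel. norm (indicator {-T..T} w * fejer w) \<le> fejer w"
    using fejer_nonneg by (intro always_eventually allI AE_I2) (auto simp: indicator_def)
  show "AE w in lborel. ((\<lambda>T. indicator {-T..T} w * fejer w) \<longlongrightarrow> fejer w) at_top"
  proof (rule AE_I2)
    fix w :: real
    have "\<forall>\<^sub>F T in at_top. indicator {-T..T} w * fejer w = fejer w"
      using eventually_ge_at_top[of "\<bar>w\<bar>"] by eventually_elim (auto simp: indicator_def)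
    thus "((\<lambda>T. indicator {-T..T} w * fejer w) \<longlongrightarrow> fejer w) at_top"
      by (rule tendsto_eventually)
  qed
qed auto

private lemma I_pos: "I > 0"
proof -
  have "I \<ge> 0" unfolding I_def by (intro integral_nonneg_AE AE_I2 fejer_nonneg)
  moreover have "I \<noteq> 0"
  proof
    assume "I = 0"
    hence "AE u in lborel. fejer u = 0" unfolding I_def
      using integral_nonneg_eq_0_iff_AE[OF integrable_fejer] fejer_nonneg by auto
    hence "AE u in lborel. u \<notin> {0<..<1::real}"
    proof eventually_elim
      case (elim u)
      show ?case
      proof
        assume u: "u \<in> {0<..<1}"
        hence "cos u < cos 0" using pi_gt3 by (intro cos_monotone_0_pi) auto
        thus False using elim u by (auto simp: fejer_def)
      qed
    qed
    hence "{0<..<1::real} \<in> null_sets lborel" by (subst AE_iff_null_sets) auto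
    thus False by (simp add: null_sets_def)
  qed
  ultimately show ?thesis by simp
qed

text \<open>The average is centred at v + d and only the window [v, v + 2 d] is kept. There
  \<open>B\<close> is at least \<open>B v * exp (- 2 * d)\<close>, because
  \<open>B u * exp u\<close> increases.\<close>

private lemma upper:
  assumes "v \<ge> 0" "d > 0" "l > 0"
  shows "B v * exp (- 2 * d) * \<kappa> (l * d) \<le> W l (v + d)"
proof -
  have "B v * exp (- 2 * d) * \<kappa> (l * d) = (LINT w|lborel. B v * exp (- 2 * d) * (indicator {-(l*d)..l*d} w * fejer w))"
    unfolding \<kappa>_def by simp
  also have "\<dots> \<le> W l (v + d)" unfolding W_def
  proof (rule integral_mono)
    show "integrable lborel (\<lambda>w. B v * exp (- 2 * d) * (indicator {-(l*d)..l*d} w * fejer w))"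
      by (intro integrable_mult_right kappa_int)
    show "integrable lborel (\<lambda>w. B (v + d - w / l) * fejer w)" by (rule W_int) fact
    fix w
    show "B v * exp (- 2 * d) * (indicator {-(l*d)..l*d} w * fejer w) \<le> B (v + d - w / l) * fejer w"
    proof (cases "w \<in> {-(l*d)..l*d}")
      case True
      hence w: "- d \<le> w / l" "w / l \<le> d" using assms by (auto simp: field_simps)
      have "B v * exp (- 2 * d) \<le> B v * exp (v - (v + d - w / l))"
        using w by (intro mult_left_mono B_nonneg) auto
      also have "\<dots> \<le> B (v + d - w / l)" using w assms by (intro B_slow) auto
      finally show ?thesis using True fejer_nonneg by (simp add: mult_right_mono)
    qed (use B_nonneg fejer_nonneg in auto)
  qed
  finally show ?thesis .
qed

text \<open>The average is centred at v - d. On the window [v - 2 d, v], contained in u \<ge> 0,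
  \<open>B\<close> is at most \<open>B v * exp (2 * d)\<close>; outside it the bound
  \<open>M\<close> multiplies the tail mass of the kernel.\<close>

private lemma lower:
  assumes "d > 0" "v \<ge> 2 * d" "l > 0" and M: "\<And>u. B u \<le> M"
  shows "W l (v - d) \<le> B v * exp (2 * d) * I + M * (I - \<kappa> (l * d))"
proof -
  have M0: "M \<ge> 0" using M[of 0] B_nonneg[of 0] by linarith
  have "W l (v - d) \<le> (LINT w|lborel. B v * exp (2 * d) * fejer w + M * (fejer w - indicator {-(l*d)..l*d} w * fejer w))"
    unfolding W_def
  proof (rule integral_mono)
    show "integrable lborel (\<lambda>w. B v * exp (2 * d) * fejer w + M * (fejer w - indicator {-(l*d)..l*d} w * fejer w))"
      by (intro Bochner_Integration.integrable_add Bochner_Integration.integrable_diff integrable_mult_right kappa_int integrable_fejer)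
    show "integrable lborel (\<lambda>w. B (v - d - w / l) * fejer w)" by (rule W_int) fact
    fix w
    show "B (v - d - w / l) * fejer w \<le> B v * exp (2 * d) * fejer w + M * (fejer w - indicator {-(l*d)..l*d} w * fejer w)"
    proof (cases "w \<in> {-(l*d)..l*d}")
      case True
      hence w: "- d \<le> w / l" "w / l \<le> d" using assms by (auto simp: field_simps)
      let ?u = "v - d - w / l"
      have "B ?u * exp (?u - v) \<le> B v" using w assms by (intro B_slow) auto
      hence "B ?u * exp (?u - v) * exp (v - ?u) \<le> B v * exp (v - ?u)" by (intro mult_right_mono) auto
      hence "B ?u \<le> B v * exp (v - ?u)" by (simp add: mult.assoc flip: exp_add)
      also have "\<dots> \<le> B v * exp (2 * d)" using w by (intro mult_left_mono B_nonneg) auto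
      finally show ?thesis using True fejer_nonneg by (simp add: mult_right_mono)
    next
      case False
      have "B (v - d - w / l) * fejer w \<le> M * fejer w" by (intro mult_right_mono M fejer_nonneg)
      moreover have "B v * exp (2 * d) * fejer w \<ge> 0" using B_nonneg fejer_nonneg by simp
      ultimately show ?thesis using False by simp
    qed
  qed
  also have "\<dots> = B v * exp (2 * d) * I + M * (I - \<kappa> (l * d))"
    unfolding I_def \<kappa>_def using kappa_int[of "l*d"] integrable_fejer by simp
  finally show ?thesis .
qed

private lemma scale_tendsto: "((\<lambda>d. \<kappa> (1 / d)) \<longlongrightarrow> I) (at_right 0)"
  by (rule filterlim_compose[OF kappa_tendsto]) real_asymp

private lemma eventually_less:
  assumes "e > c" shows "\<forall>\<^sub>F v in at_top. B v < e"
proof -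
  have "((\<lambda>d. c * I * exp (2 * d) / \<kappa> (1 / d)) \<longlongrightarrow> c * I * exp (2 * 0) / I) (at_right 0)"
    using I_pos by (intro tendsto_intros scale_tendsto) auto
  hence "\<forall>\<^sub>F d in at_right 0. c * I * exp (2 * d) / \<kappa> (1 / d) < e"
    using I_pos assms by (intro order_tendstoD) auto
  moreover have "\<forall>\<^sub>F d in at_right 0. \<kappa> (1 / d) > 0"
    using scale_tendsto I_pos by (rule order_tendstoD)
  moreover have "\<forall>\<^sub>F d in at_right (0::real). d > 0" by (rule eventually_at_right_less)
  ultimately have "\<forall>\<^sub>F d in at_right 0. c * I * exp (2 * d) / \<kappa> (1 / d) < e \<and> \<kappa> (1 / d) > 0 \<and> d > 0"
    by eventually_elim simp
  then obtain d where d: "c * I * exp (2 * d) / \<kappa> (1 / d) < e" "\<kappa> (1 / d) > 0" "d > 0"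
    using eventually_happens trivial_limit_at_right_real by blast
  \<comment> \<open>The window of radius \<open>d\<close> is then [-1/d, 1/d] for the kernel: as
    \<open>d\<close> tends to 0 it captures the whole mass, while exp (2 d) tends to 1.\<close>
  define l where "l = 1 / d^2"
  have l: "l > 0" "l * d = 1 / d" using d by (auto simp: l_def power2_eq_square)
  have "filterlim (\<lambda>v. v + d) at_top at_top" by real_asymp
  hence "((\<lambda>v. W l (v + d)) \<longlongrightarrow> c * I) at_top" by (rule filterlim_compose[OF W_tendsto[OF l(1)]])
  hence "((\<lambda>v. W l (v + d) * exp (2 * d) / \<kappa> (1 / d)) \<longlongrightarrow> c * I * exp (2 * d) / \<kappa> (1 / d)) at_top"
    using d by (intro tendsto_intros) auto
  hence "\<forall>\<^sub>F v in at_top. W l (v + d) * exp (2 * d) / \<kappa> (1 / d) < e" using d by (intro order_tendstoD)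
  thus ?thesis using eventually_ge_at_top[of 0]
  proof eventually_elim
    case (elim v)
    have "B v * exp (- 2 * d) * \<kappa> (1 / d) \<le> W l (v + d)" using upper[of v d l] elim d l by simp
    hence "B v \<le> W l (v + d) * exp (2 * d) / \<kappa> (1 / d)"
      using d by (simp add: exp_minus field_simps)
    thus ?case using elim by linarith
  qed
qed

text \<open>The upper estimate bounds \<open>B\<close> for large arguments, and on a bounded
  interval monotonicity of \<open>B u * exp u\<close> does. \<open>lower\<close> relies on this
  bound for its tails.\<close>

private lemma B_bounded: "\<exists>M. \<forall>u. B u \<le> M"
proof -
  obtain v0 where v0: "\<And>v. v \<ge> v0 \<Longrightarrow> B v < c + 1"
    using eventually_less[of "c + 1"] by (auto simp: eventually_at_top_linorder)
  define v1 where "v1 = max v0 0"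
  have "B u \<le> max (c + 1) (B v1 * exp v1)" for u
  proof -
    consider "u < 0" | "0 \<le> u" "u \<le> v1" | "u \<ge> v0" unfolding v1_def by linarith
    thus ?thesis
    proof cases
      case 1
      thus ?thesis using B_neg[of u] B_nonneg[of v1] by (simp add: le_max_iff_disj)
    next
      case 2
      have "B u * exp (u - v1) * exp (v1 - u) \<le> B v1 * exp (v1 - u)"
        using 2 by (intro mult_right_mono B_slow) auto
      hence "B u \<le> B v1 * exp (v1 - u)" by (simp add: mult.assoc flip: exp_add)
      also have "\<dots> \<le> B v1 * exp v1" using 2 by (intro mult_left_mono B_nonneg) auto
      finally show ?thesis by simp
    next
      case 3
      thus ?thesis using v0[of u] by simp
    qed
  qed
  thus ?thesis by blast
qed

private lemma eventually_greater:
  assumes "e < c" shows "\<forall>\<^sub>F v in at_top. B v > e"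
proof -
  obtain M where M: "\<And>u. B u \<le> M" using B_bounded by blast
  have "((\<lambda>d. (c * I - M * (I - \<kappa> (1 / d))) * exp (- 2 * d) / I) \<longlongrightarrow> (c * I - M * (I - I)) * exp (- 2 * 0) / I) (at_right 0)"
    using I_pos by (intro tendsto_intros scale_tendsto) auto
  hence "\<forall>\<^sub>F d in at_right 0. (c * I - M * (I - \<kappa> (1 / d))) * exp (- 2 * d) / I > e"
    using I_pos assms by (intro order_tendstoD) auto
  moreover have "\<forall>\<^sub>F d in at_right (0::real). d > 0" by (rule eventually_at_right_less)
  ultimately have "\<forall>\<^sub>F d in at_right 0. (c * I - M * (I - \<kappa> (1 / d))) * exp (- 2 * d) / I > e \<and> d > 0"
    by eventually_elim simp
  then obtain d where d: "(c * I - M * (I - \<kappa> (1 / d))) * exp (- 2 * d) / I > e" "d > 0"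
    using eventually_happens trivial_limit_at_right_real by blast
  define l where "l = 1 / d^2"
  have l: "l > 0" "l * d = 1 / d" using d by (auto simp: l_def power2_eq_square)
  have "filterlim (\<lambda>v. v - d) at_top at_top" by real_asymp
  hence "((\<lambda>v. W l (v - d)) \<longlongrightarrow> c * I) at_top" by (rule filterlim_compose[OF W_tendsto[OF l(1)]])
  hence "((\<lambda>v. (W l (v - d) - M * (I - \<kappa> (1 / d))) * exp (- 2 * d) / I) \<longlongrightarrow>
           (c * I - M * (I - \<kappa> (1 / d))) * exp (- 2 * d) / I) at_top"
    using I_pos by (intro tendsto_intros) auto
  hence "\<forall>\<^sub>F v in at_top. (W l (v - d) - M * (I - \<kappa> (1 / d))) * exp (- 2 * d) / I > e"
    using d by (intro order_tendstoD)
  thus ?thesis using eventually_ge_at_top[of "2 * d"]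
  proof eventually_elim
    case (elim v)
    have "W l (v - d) - M * (I - \<kappa> (1 / d)) \<le> B v * exp (2 * d) * I"
      using lower[OF d(2) elim(2) l(1) M] l by simp
    hence "(W l (v - d) - M * (I - \<kappa> (1 / d))) * exp (- 2 * d) / I \<le> B v"
      using I_pos by (simp add: exp_minus field_simps)
    thus ?case using elim by linarith
  qed
qed

lemma wiener_ikehara_laplace: "(B \<longlongrightarrow> c) at_top"
  by (intro order_tendstoI eventually_less eventually_greater)

end

section \<open>From Laplace transforms to Dirichlet series\<close>

text \<open>With T = ln n this is the transform of a single jump, n^(-s) / s. It connects a
  Dirichlet series with the Laplace transform of its summatory function.\<close>

lemma exp_tail_integral:
  assumes s: "Re s > 0"
  shows "has_bochner_integral lborel (\<lambda>u. indicator {T..} u *\<^sub>R exp (- (s * of_real u))) (exp (- (s * T)) / s)"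
proof -
  define f where "f = (\<lambda>u. exp (- (s * of_real u)))"
  have s0: "s \<noteq> 0" using s by auto
  have norm_f: "norm (f u) = exp (- (Re s * u))" for u by (simp add: f_def)
  have real_int: "integrable lborel (\<lambda>u. indicator {T<..} u * exp (- (Re s * u)))"
  proof -
    have "integrable lborel (\<lambda>u. indicator {0<..} u *\<^sub>R exp (- (u * Re s)))"
      using integrable_I0i_exp_mscale[OF s] by (simp add: set_integrable_def)
    hence "integrable lborel (\<lambda>u. indicator {0<..} (-T + 1 * u) *\<^sub>R exp (- ((-T + 1 * u) * Re s)))"
      by (rule lborel_integrable_real_affine) auto
    hence "integrable lborel (\<lambda>u. exp (- (Re s * T)) * (indicator {0<..} (-T + 1 * u) *\<^sub>R exp (- ((-T + 1 * u) * Re s))))"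
      by (rule integrable_mult_right)
    also have "(\<lambda>u. exp (- (Re s * T)) * (indicator {0<..} (-T + 1 * u) *\<^sub>R exp (- ((-T + 1 * u) * Re s)))) =
               (\<lambda>u. indicator {T<..} u * exp (- (Re s * u)))"
    proof
      fix u
      have "exp (- (Re s * T)) * exp (- ((-T + 1 * u) * Re s)) = exp (- (Re s * u))"
        unfolding exp_add [symmetric] by (simp add: algebra_simps)
      thus "exp (- (Re s * T)) * (indicator {0<..} (-T + 1 * u) *\<^sub>R exp (- ((-T + 1 * u) * Re s))) = indicator {T<..} u * exp (- (Re s * u))"
        by (simp add: indicator_def)
    qed
    finally show ?thesis .
  qed
  have int: "integrable lborel (\<lambda>u. indicator {T<..} u *\<^sub>R f u)"
    by (rule Bochner_Integration.integrable_bound[OF real_int])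
       (auto simp: norm_f f_def indicator_def)
  have ei: "einterval (ereal T) \<infinity> = {T<..}" by (auto simp: einterval_def)
  have "(LBINT u=ereal T..\<infinity>. f u) = 0 - (- f T / s)"
  proof (rule interval_integral_FTC_integrable)
    show "((\<lambda>u. - f u / s) has_vector_derivative f u) (at u)" for u
      unfolding f_def by (auto intro!: has_vector_derivative_real_field derivative_eq_intros simp: s0)
    show "isCont f u" for u unfolding f_def by (intro continuous_intros)
    show "set_integrable lborel (einterval (ereal T) \<infinity>) f"
      unfolding ei set_integrable_def by (rule int)
    have "isCont (\<lambda>u. - f u / s) T" unfolding f_def using s0 by (intro continuous_intros)
    thus "(((\<lambda>u. - f u / s) \<circ> real_of_ereal) \<longlongrightarrow> - f T / s) (at_right (ereal T))"
      unfolding ereal_tendsto_simps by (simp add: isCont_def filterlim_at_split)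
    have "(f \<longlongrightarrow> 0) at_top"
    proof (rule Lim_null_comparison)
      show "\<forall>\<^sub>F u in at_top. norm (f u) \<le> exp (- (Re s * u))" by (simp add: norm_f)
      show "((\<lambda>u. exp (- (Re s * u))) \<longlongrightarrow> 0) at_top" using s by real_asymp
    qed
    hence "((\<lambda>u. - f u / s) \<longlongrightarrow> - 0 / s) at_top" using s0 by (intro tendsto_intros) auto
    thus "(((\<lambda>u. - f u / s) \<circ> real_of_ereal) \<longlongrightarrow> 0) (at_left \<infinity>)"
      unfolding ereal_tendsto_simps by simp
  qed auto
  hence "(LINT u|lborel. indicator {T<..} u *\<^sub>R f u) = f T / s"
    by (simp add: interval_lebesgue_integral_def set_lebesgue_integral_def ei)
  hence "has_bochner_integral lborel (\<lambda>u. indicator {T<..} u *\<^sub>R f u) (f T / s)"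
    using int by (simp add: has_bochner_integral_iff)
  moreover have "has_bochner_integral lborel (\<lambda>u. indicator {T<..} u *\<^sub>R f u) x = has_bochner_integral lborel (\<lambda>u. indicator {T..} u *\<^sub>R f u) x" for x
    by (rule has_bochner_integral_cong_AE)
       (use AE_lborel_singleton[of T] in \<open>auto simp: f_def indicator_def\<close>)
  ultimately show ?thesis by (simp add: f_def)
qed

lemma exp_tail_integral_real:
  fixes p :: real
  assumes "p > 0"
  shows "has_bochner_integral lborel (\<lambda>u. indicator {T..} u * exp (- (p * u))) (exp (- (p * T)) / p)"
proof -
  have "has_bochner_integral lborel (\<lambda>u. complex_of_real (indicat_real {T..} u * exp (- (p * u)))) (complex_of_real (exp (- (p * T)) / p))"
    using exp_tail_integral[of "of_real p" T] assms by (simp add: scaleR_conv_of_real exp_of_real [symmetric])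
  from has_bochner_integral_Re[OF this] show ?thesis by simp
qed

lemma powr_minus_eq_exp: "n > 0 \<Longrightarrow> (of_nat n :: complex) powr (- s) = exp (- (s * of_real (ln (real n))))"
  by (simp add: powr_def Ln_of_nat)

text \<open>With x = exp u, the quotient in the conclusion is \<open>B u\<close>, the summatory
  function times exp (-u). Its Laplace transform at \<open>z\<close> is the Dirichlet series at s =
  1 + z divided by s.\<close>

theorem wiener_ikehara:
  fixes f :: "nat \<Rightarrow> real" and R :: "complex \<Rightarrow> complex" and c :: real
  assumes f_nonneg: "\<And>n. f n \<ge> 0"
    and F: "\<And>s. Re s > 1 \<Longrightarrow> (\<lambda>n. of_real (f n) * of_nat n powr (- s)) sums (of_real c / (s - 1) + R s)"
    and R: "continuous_on {s. Re s \<ge> 1} R"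
  shows "((\<lambda>x. (\<Sum>n\<in>{1..nat \<lfloor>x\<rfloor>}. f n) / x) \<longlongrightarrow> c) at_top"
proof -
  \<comment> \<open>The contribution of the single index \<open>n\<close> to \<open>B\<close>. Index
    0 is set apart because \<open>ln 0 = 0\<close> would give it a jump at u = 0.\<close>
  define b where "b = (\<lambda>n u. if n = 0 then 0 else f n * indicator {ln (real n)..} u * exp (- u))"
  define B where "B = (\<lambda>u. \<Sum>n. b n u)"
  have b0: "b n u = 0" if "n \<notin> {1..nat \<lfloor>exp u\<rfloor>}" for n u
  proof (cases "n = 0")
    case False
    hence "exp u < real n" using that by (auto simp: not_le le_nat_iff nat_less_iff floor_less_iff)
    hence "u < ln (real n)" using False by (metis exp_less_cancel_iff exp_ln of_nat_0_less_iff zero_less_iff_neq_zero)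
    thus ?thesis by (simp add: b_def)
  qed (simp add: b_def)
  have b1: "b n u = f n * exp (- u)" if "n \<in> {1..nat \<lfloor>exp u\<rfloor>}" for n u
  proof -
    have "real n \<le> exp u" using that by (auto simp: le_nat_iff le_floor_iff)
    hence "ln (real n) \<le> u" using that by (metis atLeastAtMost_iff exp_le_cancel_iff exp_ln less_le_trans of_nat_0_less_iff zero_less_one)
    thus ?thesis using that by (simp add: b_def)
  qed
  have b_sums: "(\<lambda>n. b n u) sums (\<Sum>n\<in>{1..nat \<lfloor>exp u\<rfloor>}. b n u)" for u
    by (rule sums_finite) (use b0 in auto)
  have B_eq: "B u = (\<Sum>n\<in>{1..nat \<lfloor>exp u\<rfloor>}. f n) * exp (- u)" for u
    using sums_unique[OF b_sums[of u]] b1 by (simp add: B_def sum_distrib_right)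
  have B_meas [measurable]: "B \<in> borel_measurable borel" unfolding B_def b_def by measurable
  have key: "has_bochner_integral lborel (\<lambda>u. complex_of_real (B u) * exp (- (z * of_real u)))
               ((of_real c / z + R (1 + z)) / (1 + z))"
    if z: "Re z > 0" for z
  proof -
    define s where "s = 1 + z"
    have s: "Re s > 1" "s \<noteq> 0" using z by (auto simp: s_def complex_eq_iff)
    define g where "g = (\<lambda>n u. complex_of_real (b n u) * exp (- (z * of_real u)))"
    have g_eq: "g n = (\<lambda>u. (if n = 0 then 0 else of_real (f n)) * (indicator {ln (real n)..} u *\<^sub>R exp (- (s * of_real u))))" for n
    proof
      fix u
      have "complex_of_real (exp (- u)) * exp (- (z * of_real u)) = exp (- (s * of_real u))"
        by (simp add: s_def exp_of_real [symmetric] mult_exp_exp distrib_right)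
      thus "g n u = (if n = 0 then 0 else of_real (f n)) * (indicator {ln (real n)..} u *\<^sub>R exp (- (s * of_real u)))"
        by (simp add: g_def b_def indicator_def mult.assoc)
    qed
    have hb: "has_bochner_integral lborel (g n) (of_real (f n) * of_nat n powr (- s) / s)" for n
    proof -
      have "has_bochner_integral lborel (g n) ((if n = 0 then 0 else of_real (f n)) * (exp (- (s * ln (real n))) / s))"
        unfolding g_eq by (intro has_bochner_integral_mult_right exp_tail_integral) (use s in auto)
      thus ?thesis using s by (cases "n = 0") (auto simp: powr_minus_eq_exp)
    qed
    have norm_g: "norm (g n u) = (if n = 0 then 0 else f n) * (indicator {ln (real n)..} u * exp (- (Re s * u)))" for n u
      unfolding g_eq using f_nonneg[of n] by (auto simp: norm_mult indicator_def)
    have hb': "has_bochner_integral lborel (\<lambda>u. norm (g n u)) (f n * real n powr (- Re s) / Re s)" for n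
    proof -
      have "has_bochner_integral lborel (\<lambda>u. (if n = 0 then 0 else f n) * (indicator {ln (real n)..} u * exp (- (Re s * u))))
          ((if n = 0 then 0 else f n) * (exp (- (Re s * ln (real n))) / Re s))"
        using s by (intro has_bochner_integral_mult_right exp_tail_integral_real) simp
      thus ?thesis unfolding norm_g by (auto simp: powr_def split: if_splits)
    qed
    \<comment> \<open>Nonnegative coefficients turn convergence at the real point Re s into absolute
      convergence at \<open>s\<close>.\<close>
    have summ: "summable (\<lambda>n. f n * real n powr (- Re s) / Re s)"
    proof -
      have "summable (\<lambda>n. of_real (f n) * of_nat n powr (- complex_of_real (Re s)))"
        using F[of "complex_of_real (Re s)"] s sums_summable by fastforce
      hence "summable (\<lambda>n. Re (of_real (f n) * of_nat n powr (- complex_of_real (Re s))))"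
        by (rule summable_Re)
      also have "(\<lambda>n. Re (of_real (f n) * of_nat n powr (- complex_of_real (Re s)))) = (\<lambda>n. f n * real n powr (- Re s))"
      proof
        fix n
        have "(of_nat n :: complex) powr (- complex_of_real (Re s)) = complex_of_real (real n powr (- Re s))"
          using powr_of_real[of "real n" "- Re s"] by simp
        thus "Re (of_real (f n) * of_nat n powr (- complex_of_real (Re s))) = f n * real n powr (- Re s)" by simp
      qed
      finally show ?thesis by (rule summable_divide)
    qed
    have sg: "(\<lambda>n. norm (g n u)) sums (\<Sum>n\<in>{1..nat \<lfloor>exp u\<rfloor>}. norm (g n u))" for u
      by (rule sums_finite) (use b0 in \<open>auto simp: g_def\<close>)
    have sg': "(\<lambda>n. g n u) sums (complex_of_real (B u) * exp (- (z * of_real u)))" for u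
      unfolding g_def B_def using b_sums sums_unique[OF b_sums] by (intro sums_mult2 sums_of_real) metis
    have 1: "integrable lborel (g n)" for n using hb by (rule integrable.intros)
    have 2: "AE u in lborel. summable (\<lambda>n. norm (g n u))" using sg sums_summable by (intro AE_I2) blast
    have 3: "summable (\<lambda>n. LINT u|lborel. norm (g n u))"
      using summ has_bochner_integral_integral_eq[OF hb'] by simp
    have gB: "(\<lambda>u. \<Sum>n. g n u) = (\<lambda>u. complex_of_real (B u) * exp (- (z * of_real u)))"
      using sums_unique[OF sg'] by auto
    have "integrable lborel (\<lambda>u. complex_of_real (B u) * exp (- (z * of_real u)))"
      using integrable_suminf[OF 1 2 3] unfolding gB .
    moreover have "(\<lambda>n. LINT u|lborel. g n u) sums (LINT u|lborel. complex_of_real (B u) * exp (- (z * of_real u)))"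
      using sums_integral[OF 1 2 3] unfolding gB .
    hence "(\<lambda>n. of_real (f n) * of_nat n powr (- s) / s) sums (LINT u|lborel. complex_of_real (B u) * exp (- (z * of_real u)))"
      using has_bochner_integral_integral_eq[OF hb] by simp
    moreover have "(\<lambda>n. of_real (f n) * of_nat n powr (- s) / s) sums ((of_real c / (s - 1) + R s) / s)"
      using F[OF s(1)] by (rule sums_divide)
    ultimately show ?thesis unfolding has_bochner_integral_iff
      using sums_unique2 by (auto simp: s_def)
  qed
  have "(B \<longlongrightarrow> c) at_top"
  proof (rule wiener_ikehara_laplace[where h = "\<lambda>z. (R (1 + z) - of_real c) / (1 + z)"])
    show "B \<in> borel_measurable borel" by measurable
    show "B u \<ge> 0" for u unfolding B_eq by (intro mult_nonneg_nonneg sum_nonneg f_nonneg) auto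
    show "B u = 0" if "u < 0" for u
    proof -
      have "exp u < 1" using that by simp
      hence "nat \<lfloor>exp u\<rfloor> = 0" by (simp add: floor_less_iff)
      thus ?thesis unfolding B_eq by simp
    qed
    show "integrable lborel (\<lambda>u. B u * exp (- e * u))" if "e > 0" for e
    proof -
      have "integrable lborel (\<lambda>u. Re (complex_of_real (B u) * exp (- (complex_of_real e * complex_of_real u))))"
        using key[of "of_real e"] that by (intro integrable_Re) (auto intro: integrable.intros)
      thus ?thesis
        by (simp only: of_real_mult [symmetric] of_real_minus [symmetric] exp_of_real Re_complex_of_real mult_minus_left)
    qed
    show "B u * exp (u - v) \<le> B v" if "0 \<le> u" "u \<le> v" for u v
    proof -
      have "B u * exp (u - v) = (\<Sum>n\<in>{1..nat \<lfloor>exp u\<rfloor>}. f n) * exp (- v)"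
        unfolding B_eq mult.assoc exp_add [symmetric] by simp
      also have "\<dots> \<le> B v"
      proof -
      have "nat \<lfloor>exp u\<rfloor> \<le> nat \<lfloor>exp v\<rfloor>" using that by (intro nat_mono floor_mono) simp
      thus ?thesis
        unfolding B_eq by (intro mult_right_mono sum_mono2 f_nonneg) auto
      qed
      finally show ?thesis .
    qed
    \<comment> \<open>Subtracting the transform c / z of the constant \<open>c\<close> cancels the
      pole: (c / z + R) / (1 + z) - c / z = (R - c) / (1 + z).\<close>
    show "continuous_on {z. Re z \<ge> 0} (\<lambda>z. (R (1 + z) - of_real c) / (1 + z))"
    proof (intro continuous_intros continuous_on_compose2[OF R])
      show "\<forall>z\<in>{z. Re z \<ge> 0}. 1 + z \<noteq> 0" by (auto simp: complex_eq_iff)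
    qed auto
    fix z assume z: "Re z > 0"
    have z0: "z \<noteq> 0" "1 + z \<noteq> 0" using z by (auto simp: complex_eq_iff)
    have "has_bochner_integral lborel (\<lambda>u. complex_of_real (B u) * exp (- (z * of_real u)) -
            c * (indicator {0..} u *\<^sub>R exp (- (z * of_real u))))
            ((of_real c / z + R (1 + z)) / (1 + z) - c * (exp (- (z * complex_of_real 0)) / z))"
      using z by (intro has_bochner_integral_diff key has_bochner_integral_mult_right exp_tail_integral) auto
    also have "(of_real c / z + R (1 + z)) / (1 + z) - c * (exp (- (z * complex_of_real 0)) / z) = (R (1 + z) - of_real c) / (1 + z)"
    proof -
      have "(of_real c / z + r) / w - c * (1 / z) = (r - of_real c * (w - 1) / z) / w" if "w \<noteq> 0" for r w
        using that z0 by (simp add: field_simps)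
      from this[OF z0(2)] show ?thesis using z0 by simp
    qed
    also have "(\<lambda>u. complex_of_real (B u) * exp (- (z * of_real u)) - c * (indicator {0..} u *\<^sub>R exp (- (z * of_real u)))) =
        (\<lambda>u. complex_of_real (B u - c * indicator {0..} u) * exp (- (z * of_real u)))"
      by (auto simp: fun_eq_iff left_diff_distrib indicator_def)
    finally show "(R (1 + z) - of_real c) / (1 + z) = (LINT u|lborel. complex_of_real (B u - c * indicator {0..} u) * exp (- (z * of_real u)))"
      by (simp add: has_bochner_integral_iff)
  qed
  hence "((\<lambda>x. B (ln x)) \<longlongrightarrow> c) at_top" by (rule filterlim_compose) (rule ln_at_top)
  moreover have "\<forall>\<^sub>F x in at_top. B (ln x) = (\<Sum>n\<in>{1..nat \<lfloor>x\<rfloor>}. f n) / x"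
    using eventually_gt_at_top[of 0] by eventually_elim (simp add: B_eq exp_minus field_simps)
  ultimately show ?thesis by (rule Lim_transform_eventually)
qed

section \<open>Primes in arithmetic progressions\<close>

text \<open>A principal square forces the values -1, 0, 1, so \<open>x\<close> is real and
  \<open>monsky_nonzero\<close> applies to its real part.\<close>

lemma real_character_L_nonzero:
  assumes a: "a > 0" and x: "x \<in> dchars a" "x \<noteq> principal_dchar a" and sq: "(\<lambda>n. x n * x n) = principal_dchar a"
    and L: "(\<lambda>n. x n * of_nat n powr (- 1)) sums L"
  shows "L \<noteq> 0"
proof
  assume "L = 0"
  define y where "y = (\<lambda>n. Re (x n))"
  have vals: "x n \<in> {-1, 0, 1}" for n
  proof -
    have "x n * x n = principal_dchar a n" using sq by (rule fun_cong)
    hence "x n * x n = 0 \<or> x n * x n = 1" by (auto simp: principal_dchar_def split: if_splits)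
    thus ?thesis by (auto simp: square_eq_1_iff)
  qed
  have xy: "x n = of_real (y n)" for n using vals[of n] by (auto simp: y_def)
  have "Re L \<noteq> 0"
  proof (rule monsky_nonzero)
    show "y (m * n) = y m * y n" for m n using dcharsD(2)[OF x(1), of m n] by (simp add: xy flip: of_real_mult)
    show "y 1 = 1" using dcharsD(1)[OF x(1)] by (simp add: y_def)
    show "y n \<in> {-1, 0, 1}" for n using vals[of n] by (auto simp: y_def)
    show "\<bar>\<Sum>k<n. y (Suc k)\<bar> \<le> real a * 1" for n
    proof -
      have "norm (\<Sum>k<n. x (Suc k)) \<le> real a * 1"
        by (rule periodic_partial_sums_bounded[OF a])
           (use dcharsD(3)[OF x(1)] sum_dchars_eq_0[OF a x] norm_dchars[OF a x(1)] in simp_all)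
      moreover have "(\<Sum>k<n. x (Suc k)) = of_real (\<Sum>k<n. y (Suc k))" by (simp add: xy)
      ultimately show ?thesis by (simp only: norm_of_real)
    qed
    have "(\<lambda>n. x (Suc n) * of_nat (Suc n) powr (- 1)) sums L"
      using L sums_Suc_iff[of "\<lambda>n. x n * of_nat n powr (- 1)" L] by simp
    hence "(\<lambda>n. Re (x (Suc n) * of_nat (Suc n) powr (- 1))) sums Re L" by (rule sums_Re)
    also have "(\<lambda>n. Re (x (Suc n) * of_nat (Suc n) powr (- 1))) = (\<lambda>n. y (Suc n) / real (Suc n))"
    proof
      fix n
      have "(of_nat (Suc n) :: complex) powr (- 1) = of_real (1 / real (Suc n))"
        by (simp add: powr_minus_divide del: of_nat_Suc)
      thus "Re (x (Suc n) * of_nat (Suc n) powr (- 1)) = y (Suc n) / real (Suc n)"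
        by (simp add: xy del: of_nat_Suc flip: of_real_mult)
    qed
    finally show "(\<lambda>n. y (Suc n) / real (Suc n)) sums Re L" .
  qed
  thus False using \<open>L = 0\<close> by simp
qed

text \<open>-G'/G is continuous up to Re s = 1 because \<open>G\<close> has no zero on Re s \<ge> 1.
  This combines the half-plane Re s > 1, the 3-4-1 argument on the line, and at s = 1 the nonzero
  residue of the principal character or Monsky's argument.\<close>

lemma mangoldt_series_regular:
  assumes a: "a > 0" and x: "x \<in> dchars a"
  shows "\<exists>R. continuous_on {s. Re s \<ge> 1} R \<and>
           (\<forall>s. Re s > 1 \<longrightarrow> mangoldt_series x s = of_nat (of_bool (x = principal_dchar a)) / (s - 1) + R s)"
proof -
  obtain G where G: "G holomorphic_on {s. Re s > 0}" "x = principal_dchar a \<Longrightarrow> G 1 \<noteq> 0"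
    "\<And>s. Re s > 1 \<Longrightarrow> (\<lambda>n. x n * of_nat n powr (- s)) sums (G s / (s - 1) ^ of_bool (x = principal_dchar a))"
    "\<And>s. x \<noteq> principal_dchar a \<Longrightarrow> Re s > 0 \<Longrightarrow> (\<lambda>n. x n * of_nat n powr (- s)) sums G s"
    by (rule L_continuation[OF a x]) blast
  have nz: "G s \<noteq> 0" if s: "Re s \<ge> 1" for s
  proof (cases "Re s > 1")
    case True
    thus ?thesis using mangoldt_series_eq(1)[OF a x G(1,3)] by blast
  next
    case False
    hence seq: "s = 1 + \<i> * of_real (Im s)" using s by (auto simp: complex_eq_iff)
    show ?thesis
    proof (cases "(\<lambda>n. x n * x n) = principal_dchar a \<and> Im s = 0")
      case False
      show ?thesis by (subst seq, rule nonvanishing_341[OF a x G(1,3) False])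
    next
      case True
      hence s1: "s = 1" using seq by simp
      show ?thesis
      proof (cases "x = principal_dchar a")
        case True
        thus ?thesis using G(2) s1 by simp
      next
        case False
        thus ?thesis using real_character_L_nonzero[OF a x False] True G(4)[OF False, of 1] s1 by simp
      qed
    qed
  qed
  have op: "open {s. Re s > 0}" by (simp add: open_halfspace_Re_gt)
  show ?thesis
  proof (intro exI[of _ "\<lambda>s. - (deriv G s / G s)"] conjI allI impI)
    have sub: "{s. Re s \<ge> 1} \<subseteq> {s. Re s > 0}" by auto
    have "continuous_on {s. Re s > 0} G" "continuous_on {s. Re s > 0} (deriv G)"
      using G(1) holomorphic_deriv[OF G(1) op] by (auto intro: holomorphic_on_imp_continuous_on)
    thus "continuous_on {s. Re s \<ge> 1} (\<lambda>s. - (deriv G s / G s))"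
      using nz by (intro continuous_intros continuous_on_subset[OF _ sub]) auto
    show "mangoldt_series x s = of_nat (of_bool (x = principal_dchar a)) / (s - 1) + - (deriv G s / G s)" if "Re s > 1" for s
      using mangoldt_series_eq(2)[OF a x G(1,3) that] by simp
  qed
qed

text \<open>Wiener-Ikehara needs nonnegative coefficients, which single characters do not provide
  but the orthogonality combination for a residue class does. Only the principal character has a
  pole, and its weight is 1 / \<open>totient a\<close>.\<close>

theorem psi_arithmetic_progression:
  assumes a: "a > 1" and r: "coprime r a"
  shows "((\<lambda>x. (\<Sum>n\<in>{1..nat \<lfloor>x\<rfloor>}. if [n = r] (mod a) then mangoldt n else 0) / x) \<longlongrightarrow> 1 / real (totient a)) at_top"
proof -
  have a0: "a > 0" using a by simp
  have fin: "finite (dchars a)" by (rule finite_dchars[OF a0])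
  have tot: "complex_of_nat (totient a) \<noteq> 0" using a by simp
  obtain R where R: "\<And>x. x \<in> dchars a \<Longrightarrow> continuous_on {s. Re s \<ge> 1} (R x)"
    "\<And>x s. x \<in> dchars a \<Longrightarrow> Re s > 1 \<Longrightarrow> mangoldt_series x s = of_nat (of_bool (x = principal_dchar a)) / (s - 1) + R x s"
    using mangoldt_series_regular[OF a0] by metis
  define Q where "Q = (\<lambda>s. (\<Sum>x\<in>dchars a. cnj (x r) * R x s) / of_nat (totient a))"
  show ?thesis
  proof (rule wiener_ikehara)
    show "continuous_on {s. Re s \<ge> 1} Q" unfolding Q_def using tot by (intro continuous_intros R) auto
    show "0 \<le> (if [n = r] (mod a) then mangoldt n else 0 :: real)" for n by (simp add: mangoldt_nonneg)
    fix s :: complex assume s: "Re s > 1"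
    have "(\<lambda>n. (\<Sum>x\<in>dchars a. cnj (x r) * (mangoldt n * x n * of_nat n powr (- s))) / of_nat (totient a)) sums
          ((\<Sum>x\<in>dchars a. cnj (x r) * mangoldt_series x s) / of_nat (totient a))"
      by (intro sums_divide sums_sum sums_mult mangoldt_series_sums(2) norm_dchars_le[OF a0] s)
    also have "(\<lambda>n. (\<Sum>x\<in>dchars a. cnj (x r) * (mangoldt n * x n * of_nat n powr (- s))) / of_nat (totient a)) =
        (\<lambda>n. of_real (if [n = r] (mod a) then mangoldt n else 0) * of_nat n powr (- s))"
    proof
      fix n
      have "(\<Sum>x\<in>dchars a. cnj (x r) * (mangoldt n * x n * of_nat n powr (- s))) =
            (\<Sum>x\<in>dchars a. cnj (x r) * x n) * (mangoldt n * of_nat n powr (- s))"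
        unfolding sum_distrib_right by (intro sum.cong refl) (simp add: mult_ac)
      thus "(\<Sum>x\<in>dchars a. cnj (x r) * (mangoldt n * x n * of_nat n powr (- s))) / of_nat (totient a) =
          of_real (if [n = r] (mod a) then mangoldt n else 0) * of_nat n powr (- s)"
        unfolding dchars_orthogonality[OF a r] using tot by simp
    qed
    also have "(\<Sum>x\<in>dchars a. cnj (x r) * mangoldt_series x s) =
        (\<Sum>x\<in>dchars a. cnj (x r) * (of_nat (of_bool (x = principal_dchar a)) / (s - 1))) + (\<Sum>x\<in>dchars a. cnj (x r) * R x s)"
      unfolding sum.distrib [symmetric] by (intro sum.cong refl) (simp add: R(2)[OF _ s] distrib_left)
    also have "(\<Sum>x\<in>dchars a. cnj (x r) * (of_nat (of_bool (x = principal_dchar a)) / (s - 1))) =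
        (\<Sum>x\<in>{principal_dchar a}. cnj (x r) * (of_nat (of_bool (x = principal_dchar a)) / (s - 1)))"
      by (rule sum.mono_neutral_right) (use fin principal_dchar_in in \<open>auto simp: of_bool_def\<close>)
    also have "\<dots> = 1 / (s - 1)" using r by (simp add: principal_dchar_def of_bool_def)
    also have "(1 / (s - 1) + (\<Sum>x\<in>dchars a. cnj (x r) * R x s)) / of_nat (totient a) = of_real (1 / real (totient a)) / (s - 1) + Q s"
      by (simp add: Q_def add_divide_distrib)
    finally show "(\<lambda>n. of_real (if [n = r] (mod a) then mangoldt n else 0) * of_nat n powr (- s)) sums
       (of_real (1 / real (totient a)) / (s - 1) + Q s)" .
  qed
qed

section \<open>From the Mangoldt function to counting primes\<close>

definition primes_cong :: "nat \<Rightarrow> nat \<Rightarrow> real \<Rightarrow> nat set" where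
  "primes_cong a r x = {p. prime p \<and> real p \<le> x \<and> [p = r] (mod a)}"

lemma finite_nat_le_real: "finite {n::nat. real n \<le> x \<and> P n}"
proof (rule finite_subset)
  show "{n::nat. real n \<le> x \<and> P n} \<subseteq> {..nat \<lfloor>x\<rfloor>}" by (auto simp: le_nat_floor)
qed auto

lemma finite_primes_cong [simp]: "finite (primes_cong a r x)"
  by (rule finite_subset[OF _ finite_nat_le_real[of x "\<lambda>_. True"]]) (auto simp: primes_cong_def)

text \<open>If p^k \<le> x with k \<ge> 2, then \<open>p\<close> is at most sqrt x and
  \<open>k\<close> at most the binary logarithm of \<open>x\<close>.\<close>

lemma card_nonprime_primepows:
  assumes "x \<ge> 1"
  shows "real (card {n. real n \<le> x \<and> primepow n \<and> \<not> prime n}) \<le> (sqrt x + 1) * (log 2 x + 1)"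
    (is "real (card ?N) \<le> _")
proof -
  define A where "A = {..nat \<lfloor>sqrt x\<rfloor>} \<times> {..nat \<lfloor>log 2 x\<rfloor>}"
  have "?N \<subseteq> (\<lambda>(p, k). p ^ k) ` A"
  proof
    fix n assume "n \<in> ?N"
    hence n: "real n \<le> x" "primepow n" "\<not> prime n" by auto
    then obtain p k where pk: "prime p" "k > 0" "n = p ^ k" by (auto simp: primepow_def)
    have k2: "k \<ge> 2" using pk n(3) by (cases "k = 1") auto
    have "p ^ 2 \<le> p ^ k" using pk k2 by (intro power_increasing) (auto simp: prime_ge_Suc_0_nat)
    hence "real (p ^ 2) \<le> real (p ^ k)" by (simp only: of_nat_le_iff)
    hence "(real p)\<^sup>2 \<le> x" using n(1) pk(3) by simp
    hence "real p \<le> sqrt x" by (rule real_le_rsqrt)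
    moreover have "(2::real) ^ k \<le> x"
    proof -
      have "2 ^ k \<le> p ^ k" using prime_ge_2_nat[OF pk(1)] by (intro power_mono) auto
      hence "real (2 ^ k) \<le> real (p ^ k)" by (simp only: of_nat_le_iff)
      thus ?thesis using n(1) pk(3) by simp
    qed
    hence "real k \<le> log 2 x" using assms by (simp add: le_log_iff powr_realpow)
    ultimately have "(p, k) \<in> A" by (auto simp: A_def le_nat_floor)
    thus "n \<in> (\<lambda>(p, k). p ^ k) ` A" using pk(3) by (intro image_eqI[of _ _ "(p, k)"]) auto
  qed
  moreover have "finite A" by (simp add: A_def)
  ultimately have "card ?N \<le> card A"
    by (intro order_trans[OF card_mono card_image_le]) auto
  also have "card A = (nat \<lfloor>sqrt x\<rfloor> + 1) * (nat \<lfloor>log 2 x\<rfloor> + 1)" by (simp add: A_def)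
  finally have "real (card ?N) \<le> real (nat \<lfloor>sqrt x\<rfloor> + 1) * real (nat \<lfloor>log 2 x\<rfloor> + 1)"
    unfolding of_nat_mult [symmetric] of_nat_le_iff .
  also have "\<dots> \<le> (sqrt x + 1) * (log 2 x + 1)"
    using assms by (intro mult_mono) (auto simp: of_nat_nat)
  finally show ?thesis .
qed

text \<open>Proper prime powers contribute at most ln x each, so sqrt x (ln x)^2 up to a constant,
  which is o(x).\<close>

lemma theta_arithmetic_progression:
  assumes a: "a > 1" and r: "coprime r a"
  shows "((\<lambda>x. (\<Sum>p\<in>primes_cong a r x. ln (real p)) / x) \<longlongrightarrow> 1 / real (totient a)) at_top"
proof -
  define T where "T = (\<lambda>x::real. \<Sum>n\<in>{1..nat \<lfloor>x\<rfloor>}. if [n = r] (mod a) then mangoldt n else (0::real))"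
  define Th where "Th = (\<lambda>x. \<Sum>p\<in>primes_cong a r x. ln (real p))"
  have diff: "0 \<le> T x - Th x \<and> T x - Th x \<le> (sqrt x + 1) * (log 2 x + 1) * ln x" if x: "x \<ge> 1" for x :: real
  proof -
    define N where "N = {n. real n \<le> x \<and> primepow n \<and> \<not> prime n}"
    have finN: "finite N" unfolding N_def by (rule finite_nat_le_real)
    define M where "M = {n\<in>{1..nat \<lfloor>x\<rfloor>}. [n = r] (mod a)}"
    have M: "T x = (\<Sum>n\<in>M. mangoldt n)" unfolding T_def M_def by (rule sum.inter_filter [symmetric]) simp
    have sub: "primes_cong a r x \<subseteq> M"
      by (auto simp: primes_cong_def M_def le_nat_floor prime_ge_Suc_0_nat)
    have finM: "finite M" by (simp add: M_def)
    have "Th x = (\<Sum>p\<in>primes_cong a r x. mangoldt p)"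
      unfolding Th_def by (intro sum.cong refl) (auto simp: primes_cong_def)
    hence eq: "T x - Th x = (\<Sum>n\<in>M - primes_cong a r x. mangoldt n)"
      unfolding M using sum_diff[OF finM sub, of "mangoldt :: nat \<Rightarrow> real"] by simp
    have "(\<Sum>n\<in>M - primes_cong a r x. mangoldt n) = (\<Sum>n\<in>(M - primes_cong a r x) \<inter> N. mangoldt n :: real)"
    proof (rule sum.mono_neutral_right)
      show "\<forall>i\<in>M - primes_cong a r x - (M - primes_cong a r x) \<inter> N. mangoldt i = (0::real)"
      proof
        fix n assume n: "n \<in> M - primes_cong a r x - (M - primes_cong a r x) \<inter> N"
        hence le: "real n \<le> x" using x by (auto simp: M_def le_nat_iff le_floor_iff)
        hence "\<not> prime n" using n by (auto simp: M_def primes_cong_def)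
        hence "\<not> primepow n" using n le by (auto simp: N_def)
        thus "mangoldt n = (0::real)" by (simp add: mangoldt_def)
      qed
    qed (use finM in auto)
    also have "\<dots> \<le> (\<Sum>n\<in>(M - primes_cong a r x) \<inter> N. ln x)"
    proof (rule sum_mono)
      fix n assume "n \<in> (M - primes_cong a r x) \<inter> N"
      hence n: "n > 0" "real n \<le> x" by (auto simp: M_def N_def)
      have "mangoldt n \<le> ln (real n)" using n(1) by (rule mangoldt_le)
      also have "\<dots> \<le> ln x" using n by simp
      finally show "mangoldt n \<le> ln x" .
    qed
    also have "\<dots> = real (card ((M - primes_cong a r x) \<inter> N)) * ln x" by simp
    also have "\<dots> \<le> real (card N) * ln x" using x finN by (intro mult_right_mono) (auto intro!: card_mono)
    also have "\<dots> \<le> (sqrt x + 1) * (log 2 x + 1) * ln x"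
      unfolding N_def using x by (intro mult_right_mono card_nonprime_primepows) auto
    finally show ?thesis unfolding eq by (auto intro!: sum_nonneg mangoldt_nonneg)
  qed
  have "((\<lambda>x. (T x - Th x) / x) \<longlongrightarrow> 0) at_top"
  proof (rule tendsto_sandwich)
    show "\<forall>\<^sub>F x in at_top. 0 \<le> (T x - Th x) / x"
      using eventually_ge_at_top[of 1] by eventually_elim (use diff in auto)
    show "\<forall>\<^sub>F x in at_top. (T x - Th x) / x \<le> (sqrt x + 1) * (log 2 x + 1) * ln x / x"
      using eventually_ge_at_top[of 1] by eventually_elim (use diff in \<open>auto intro!: divide_right_mono\<close>)
    show "((\<lambda>x::real. (sqrt x + 1) * (log 2 x + 1) * ln x / x) \<longlongrightarrow> 0) at_top" by real_asymp
  qed auto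
  from tendsto_diff[OF psi_arithmetic_progression[OF a r] this]
  show ?thesis by (simp add: T_def Th_def diff_divide_distrib)
qed

lemma pi_arithmetic_progression:
  assumes a: "a > 1" and r: "coprime r a"
  shows "((\<lambda>x. real (card (primes_cong a r x)) * ln x / x) \<longlongrightarrow> 1 / real (totient a)) at_top"
proof (rule tendsto_sandwich)
  define Th where "Th = (\<lambda>x. \<Sum>p\<in>primes_cong a r x. ln (real p))"
  have Th: "((\<lambda>x. Th x / x) \<longlongrightarrow> 1 / real (totient a)) at_top"
    unfolding Th_def by (rule theta_arithmetic_progression[OF a r])
  show "((\<lambda>x. Th x / x) \<longlongrightarrow> 1 / real (totient a)) at_top" by (rule Th)
  show "\<forall>\<^sub>F x in at_top. Th x / x \<le> real (card (primes_cong a r x)) * ln x / x"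
    using eventually_ge_at_top[of 1]
  proof eventually_elim
    case (elim x)
    have "Th x \<le> (\<Sum>p\<in>primes_cong a r x. ln x)"
      unfolding Th_def using elim by (intro sum_mono) (auto simp: primes_cong_def prime_gt_0_nat intro!: ln_mono)
    thus ?case using elim by (auto intro!: divide_right_mono)
  qed
  have "((\<lambda>x. 1 / ln x + Th x / x * (ln x / ln (x / (ln x)\<^sup>2))) \<longlongrightarrow> 0 + 1 / real (totient a) * 1) at_top"
    by (intro tendsto_add tendsto_mult Th) real_asymp+
  thus "((\<lambda>x. 1 / ln x + Th x / x * (ln x / ln (x / (ln x)\<^sup>2))) \<longlongrightarrow> 1 / real (totient a)) at_top" by simp
  have "\<forall>\<^sub>F x in at_top. x / (ln x)\<^sup>2 > (1::real)" by real_asymp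
  thus "\<forall>\<^sub>F x in at_top. real (card (primes_cong a r x)) * ln x / x \<le> 1 / ln x + Th x / x * (ln x / ln (x / (ln x)\<^sup>2))"
    using eventually_gt_at_top[of 1]
  proof eventually_elim
    case (elim x)
    \<comment> \<open>Small enough that the at most \<open>y\<close> primes up to \<open>y\<close>
      are negligible, as y ln x / x = 1 / ln x, and large enough that ln y is asymptotic to ln
      x.\<close>
    define y where "y = x / (ln x)\<^sup>2"
    have lnx: "ln x > 0" and lny: "ln y > 0" using elim by (auto simp: y_def)
    define A where "A = {p. real p \<le> y \<and> p > 0}"
    have A: "A \<subseteq> {1..nat \<lfloor>y\<rfloor>}" by (auto simp: A_def le_nat_floor)
    have "card A \<le> nat \<lfloor>y\<rfloor>" using card_mono[OF _ A] by simp
    hence cA: "real (card A) \<le> y" using elim by (simp add: y_def of_nat_nat le_nat_iff le_floor_iff)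
    have "card (primes_cong a r x) \<le> card (A \<union> (primes_cong a r x - A))"
      using A finite_subset by (intro card_mono) auto
    also have "\<dots> \<le> card A + card (primes_cong a r x - A)" by (rule card_Un_le)
    finally have le: "real (card (primes_cong a r x)) \<le> y + real (card (primes_cong a r x - A))" using cA by linarith
    have "real (card (primes_cong a r x - A)) * ln y = (\<Sum>p\<in>primes_cong a r x - A. ln y)" by simp
    also have "\<dots> \<le> (\<Sum>p\<in>primes_cong a r x - A. ln (real p))"
    proof (rule sum_mono)
      fix p assume "p \<in> primes_cong a r x - A"
      hence "y < real p" by (auto simp: primes_cong_def A_def prime_gt_0_nat not_le)
      moreover have "y > 0" using elim by (simp add: y_def)
      ultimately show "ln y \<le> ln (real p)" by (intro ln_mono) auto
    qed
    also have "\<dots> \<le> Th x" unfolding Th_def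
    proof (rule sum_mono2[OF finite_primes_cong])
      show "0 \<le> ln (real p)" if "p \<in> primes_cong a r x - (primes_cong a r x - A)" for p
        using that by (intro ln_ge_zero) (auto simp: primes_cong_def prime_ge_Suc_0_nat)
    qed auto
    finally have c: "real (card (primes_cong a r x - A)) \<le> Th x / ln y" using lny by (simp add: field_simps)
    have "real (card (primes_cong a r x)) * ln x / x \<le> (y + Th x / ln y) * ln x / x"
      using le c lnx elim by (intro divide_right_mono mult_right_mono) auto
    also have "\<dots> = y * ln x / x + Th x / x * (ln x / ln y)" by (simp add: add_divide_distrib distrib_right)
    also have "y * ln x / x = 1 / ln x" using lnx elim by (simp add: y_def power2_eq_square)
    finally show ?case by (simp add: y_def)
  qed
qed

section \<open>Primes in the semigroup generated by two numbers\<close>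

text \<open>The involution \<open>y \<mapsto> a - y\<close> preserves the totatives, and each
  \<open>y\<close> adds up to \<open>a\<close> with its image.\<close>

lemma sum_totatives:
  assumes "a > 1" shows "2 * (\<Sum>y\<in>totatives a. real y) = real a * real (totient a)"
proof -
  have bij: "bij_betw (\<lambda>y. a - y) (totatives a) (totatives a)"
  proof (rule bij_betwI[where g = "\<lambda>y. a - y"])
    have "a - y \<in> totatives a" if "y \<in> totatives a" for y
    proof -
      have y: "0 < y" "y < a" "coprime y a" using that assms totatives_less[OF that] by (auto simp: in_totatives_iff)
      have "gcd (a - y) a = gcd (a - y) ((a - y) + y)" using y by simp
      also have "\<dots> = gcd (a - y) y" by (rule gcd_add2)
      also have "\<dots> = gcd a y" using y by (intro gcd_diff1_nat) simp
      finally have "coprime (a - y) a" using y(3)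
        unfolding coprime_iff_gcd_eq_1 by (simp only: gcd.commute [of a y])
      thus ?thesis using y by (auto simp: in_totatives_iff)
    qed
    thus "(\<lambda>y. a - y) \<in> totatives a \<rightarrow> totatives a" "(\<lambda>y. a - y) \<in> totatives a \<rightarrow> totatives a" by auto
  qed (auto simp: in_totatives_iff)
  have "(\<Sum>y\<in>totatives a. real y) = (\<Sum>y\<in>totatives a. real (a - y))"
    by (rule sum.reindex_bij_betw[OF bij, symmetric])
  hence "2 * (\<Sum>y\<in>totatives a. real y) = (\<Sum>y\<in>totatives a. real y + real (a - y))"
    by (simp add: sum.distrib)
  also have "\<dots> = (\<Sum>y\<in>totatives a. real a)" by (intro sum.cong refl) (auto simp: in_totatives_iff)
  finally show ?thesis by (simp add: totient_def)
qed

section \<open>Limits as b tends to infinity through integers coprime to a\<close>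

context
  fixes a :: nat and F :: "nat filter"
  assumes a: "a > 1" and F: "F = inf at_top (principal {b. coprime a b})"
begin

lemma real_at_top: "filterlim real at_top F"
  using filterlim_mono[OF filterlim_real_sequentially order_refl, of F] by (simp add: F)

lemma eventually_coprime: "\<forall>\<^sub>F b in F. coprime a b"
  unfolding F by (simp add: eventually_inf_principal)

lemma eventually_ge: "\<forall>\<^sub>F b in F. b \<ge> N"
  unfolding F by (rule filter_leD[OF inf_le1]) (rule eventually_ge_at_top)

text \<open>The class \<open>r b\<close> varies with \<open>b\<close>. \<open>E\<close> adds the
  errors over all classes prime to \<open>a\<close>, tends to 0 as a finite sum, and dominates the
  error of the class at hand. The hypotheses on \<open>x b\<close> then change the scale from x / ln
  x to b / ln b.\<close>

lemma count_limit:
  assumes r: "\<forall>\<^sub>F b in F. coprime (r b) a" and x: "filterlim x at_top F"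
    and k: "((\<lambda>b. x b / real b) \<longlongrightarrow> k) F" and l: "((\<lambda>b. ln (real b) / ln (x b)) \<longlongrightarrow> 1) F"
  shows "((\<lambda>b. real (card (primes_cong a (r b) (x b))) * ln (real b) / real b) \<longlongrightarrow> k / real (totient a)) F"
proof -
  define E where "E = (\<lambda>x. \<Sum>q\<in>totatives a. \<bar>real (card (primes_cong a q x)) * ln x / x - 1 / real (totient a)\<bar>)"
  have "((\<lambda>x. E x) \<longlongrightarrow> (\<Sum>q\<in>totatives a. \<bar>1 / real (totient a) - 1 / real (totient a)\<bar>)) at_top"
    unfolding E_def using a by (intro tendsto_intros pi_arithmetic_progression) (auto simp: in_totatives_iff)
  hence "(E \<longlongrightarrow> 0) at_top" by simp
  hence E: "((\<lambda>b. E (x b)) \<longlongrightarrow> 0) F" by (rule filterlim_compose[OF _ x])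
  have "((\<lambda>b. real (card (primes_cong a (r b) (x b))) * ln (x b) / x b - 1 / real (totient a)) \<longlongrightarrow> 0) F"
  proof (rule Lim_null_comparison[OF _ E])
    show "\<forall>\<^sub>F b in F. norm (real (card (primes_cong a (r b) (x b))) * ln (x b) / x b - 1 / real (totient a)) \<le> E (x b)"
      using r
    proof eventually_elim
      case (elim b)
      have q: "r b mod a \<in> totatives a"
        using elim a by (auto simp: in_totatives_iff intro!: Nat.gr0I less_imp_le)
      have eq: "primes_cong a (r b) (x b) = primes_cong a (r b mod a) (x b)"
        by (simp add: primes_cong_def cong_def)
      show ?case unfolding eq E_def real_norm_def by (rule member_le_sum[OF q]) auto
    qed
  qed
  hence "((\<lambda>b. real (card (primes_cong a (r b) (x b))) * ln (x b) / x b) \<longlongrightarrow> 1 / real (totient a)) F"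
    by (simp add: LIM_zero_iff)
  hence "((\<lambda>b. real (card (primes_cong a (r b) (x b))) * ln (x b) / x b * (x b / real b) * (ln (real b) / ln (x b))) \<longlongrightarrow> 1 / real (totient a) * k * 1) F"
    by (intro tendsto_mult k l)
  moreover have "\<forall>\<^sub>F b in F. real (card (primes_cong a (r b) (x b))) * ln (x b) / x b * (x b / real b) * (ln (real b) / ln (x b)) =
      real (card (primes_cong a (r b) (x b))) * ln (real b) / real b"
    using filterlim_at_top_dense[THEN iffD1, OF x, rule_format, of 1]
    by eventually_elim (auto simp: field_simps)
  ultimately show ?thesis by (simp add: tendsto_cong)
qed

lemma count_limit_linear:
  assumes r: "\<forall>\<^sub>F b in F. coprime (r b) a" and k: "k > 0"
  shows "((\<lambda>b. real (card (primes_cong a (r b) (k * real b - d))) * ln (real b) / real b) \<longlongrightarrow> k / real (totient a)) F"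
proof (rule count_limit[OF r])
  show "filterlim (\<lambda>b. k * real b - d) at_top F"
    by (rule filterlim_compose[OF _ real_at_top]) (use k in real_asymp)
  show "((\<lambda>b. (k * real b - d) / real b) \<longlongrightarrow> k) F"
    by (rule filterlim_compose[OF _ real_at_top, of "\<lambda>b. (k * b - d) / b"]) (use k in real_asymp)
  show "((\<lambda>b. ln (real b) / ln (k * real b - d)) \<longlongrightarrow> 1) F"
    by (rule filterlim_compose[OF _ real_at_top, of "\<lambda>b. ln b / ln (k * b - d)"]) (use k in real_asymp)
qed

text \<open>Disposes of bounded errors, such as primes dividing \<open>a\<close> or a doubtful
  endpoint.\<close>

lemma bounded_count_limit:
  assumes "\<forall>\<^sub>F b in F. \<bar>c b\<bar> \<le> K"
  shows "((\<lambda>b. c b * ln (real b) / real b) \<longlongrightarrow> 0) F"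
proof (rule Lim_null_comparison)
  show "((\<lambda>b. K * (ln (real b) / real b)) \<longlongrightarrow> 0) F"
    by (rule filterlim_compose[OF _ real_at_top, of "\<lambda>b. K * (ln b / b)"]) real_asymp
  show "\<forall>\<^sub>F b in F. norm (c b * ln (real b) / real b) \<le> K * (ln (real b) / real b)"
    using assms eventually_ge[of 1]
  proof eventually_elim
    case (elim b)
    hence "\<bar>c b\<bar> * (ln (real b) / real b) \<le> K * (ln (real b) / real b)" by (intro mult_right_mono) auto
    thus ?case using elim by (simp add: abs_mult)
  qed
qed

lemma frobenius_num_real: "real_of_int (frobenius_num a b) = (real a - 1) * real b - real a"
  by (simp add: frobenius_num_def algebra_simps)

text \<open>As \<open>b\<close> is invertible modulo \<open>a\<close>, a prime not dividing
  \<open>a\<close> lies in the class of \<open>b * q\<close> for exactly one totative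
  \<open>q\<close>. Classes are labelled by \<open>q\<close> and not by their residue because
  \<open>q\<close> is the coefficient of \<open>b\<close> in T(a, b); \<open>b = 1\<close> gives the
  ordinary splitting by residues.\<close>

lemma card_primes_by_residue:
  assumes b: "coprime a b" and X: "finite X" "\<And>p. p \<in> X \<Longrightarrow> prime p"
  shows "card X = card {p \<in> X. p dvd a} + (\<Sum>q\<in>totatives a. card {p \<in> X. [p = b * q] (mod a)})"
proof -
  have cop: "coprime p a" if "q \<in> totatives a" "[p = b * q] (mod a)" for p q
    using cong_imp_coprime[OF cong_sym[OF that(2)]] that(1) b by (auto simp: in_totatives_iff coprime_commute)
  have uniq: "i = j" if ij: "i \<in> totatives a" "j \<in> totatives a" "[p = b * i] (mod a)" "[p = b * j] (mod a)" for i j p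
  proof -
    have "[b * i = b * j] (mod a)" using ij(3,4) by (simp add: cong_def)
    hence "[i = j] (mod a)" using b by (simp add: cong_mult_lcancel_nat coprime_commute)
    moreover have "i < a" "j < a" using ij a totatives_less by auto
    ultimately show ?thesis by (simp add: cong_less_modulus_unique_nat)
  qed
  obtain c where c: "[b * c = 1] (mod a)" using cong_solve_coprime_nat[of b a] b by (auto simp: coprime_commute)
  have "p dvd a \<or> (\<exists>q\<in>totatives a. [p = b * q] (mod a))" if "p \<in> X" for p
  proof (rule disjCI)
    assume "\<not> (\<exists>q\<in>totatives a. [p = b * q] (mod a))"
    moreover define q where "q = c * p mod a"
    have q: "[p = b * q] (mod a)" unfolding q_def
      using cong_scalar_right[OF c, of p] by (simp add: cong_def mod_mult_right_eq mult.assoc)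
    have "q < a" using a by (simp add: q_def)
    have "q \<in> totatives a" if "coprime p a"
    proof -
      have "coprime q a" using cong_imp_coprime[OF q that] by simp
      thus ?thesis using a \<open>q < a\<close> by (auto simp: in_totatives_iff intro!: Nat.gr0I)
    qed
    ultimately show "p dvd a" using q prime_imp_coprime[OF X(2)[OF that], of a] by blast
  qed
  hence "X = {p \<in> X. p dvd a} \<union> (\<Union>q\<in>totatives a. {p \<in> X. [p = b * q] (mod a)})" by blast
  hence "card X = card ({p \<in> X. p dvd a} \<union> (\<Union>q\<in>totatives a. {p \<in> X. [p = b * q] (mod a)}))" by simp
  also have "\<dots> = card {p \<in> X. p dvd a} + card (\<Union>q\<in>totatives a. {p \<in> X. [p = b * q] (mod a)})"
  proof (rule card_Un_disjoint)
    have False if "p \<in> X" "p dvd a" "q \<in> totatives a" "[p = b * q] (mod a)" for p q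
      using cop[OF that(3,4)] that(2) X(2)[OF that(1)] by (metis coprime_absorb_left not_prime_unit)
    thus "{p \<in> X. p dvd a} \<inter> (\<Union>q\<in>totatives a. {p \<in> X. [p = b * q] (mod a)}) = {}" by blast
  qed (use X(1) in auto)
  also have "card (\<Union>q\<in>totatives a. {p \<in> X. [p = b * q] (mod a)}) = (\<Sum>q\<in>totatives a. card {p \<in> X. [p = b * q] (mod a)})"
    by (rule card_UN_disjoint) (use X(1) uniq in auto)
  finally show ?thesis .
qed

lemma card_prime_divisors_le:
  assumes "\<And>p. p \<in> X \<Longrightarrow> prime p" shows "card {p \<in> X. p dvd a} \<le> a"
proof -
  have "{p \<in> X. p dvd a} \<subseteq> {1..a}" using a assms by (auto simp: prime_ge_Suc_0_nat intro!: dvd_imp_le)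
  from card_mono[OF _ this] show ?thesis by simp
qed

text \<open>The prime number theorem at s(a, b), obtained by adding up the progressions modulo
  \<open>a\<close>.\<close>

lemma prime_count_limit:
  "((\<lambda>b. real (prime_count (real_of_int (frobenius_num a b))) * ln (real b) / real b) \<longlongrightarrow> real a - 1) F"
proof -
  define C where "C = (\<lambda>x. {p \<in> {p. prime p \<and> real p \<le> x}. p dvd a})"
  have cardC: "card (C x) \<le> a" for x unfolding C_def by (rule card_prime_divisors_le) simp
  have count: "prime_count x = card (C x) + (\<Sum>q\<in>totatives a. card (primes_cong a q x))" for x
  proof -
    have "finite {p. prime p \<and> real p \<le> x}"
      by (rule finite_subset[OF _ finite_nat_le_real[of x "\<lambda>_. True"]]) auto
    from card_primes_by_residue[OF _ this, of 1] show ?thesis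
      by (simp add: prime_count_def C_def primes_cong_def conj_assoc)
  qed
  have "((\<lambda>b. (\<Sum>q\<in>totatives a. real (card (primes_cong a q ((real a - 1) * real b - real a))) * ln (real b) / real b)) \<longlongrightarrow>
          (\<Sum>q\<in>totatives a. (real a - 1) / real (totient a))) F"
    using a by (intro tendsto_sum count_limit_linear) (auto simp: in_totatives_iff)
  moreover have "((\<lambda>b. real (card (C ((real a - 1) * real b - real a))) * ln (real b) / real b) \<longlongrightarrow> 0) F"
    using cardC by (intro bounded_count_limit[of _ "real a"]) auto
  ultimately have "((\<lambda>b. real (card (C ((real a - 1) * real b - real a))) * ln (real b) / real b +
      (\<Sum>q\<in>totatives a. real (card (primes_cong a q ((real a - 1) * real b - real a))) * ln (real b) / real b)) \<longlongrightarrow>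
          0 + (\<Sum>q\<in>totatives a. (real a - 1) / real (totient a))) F"
    by (intro tendsto_add)
  moreover have "(\<Sum>q\<in>totatives a. (real a - 1) / real (totient a)) = real a - 1"
    using a by (simp add: totient_def [symmetric])
  ultimately show ?thesis
    unfolding frobenius_num_real count
    by (simp add: distrib_right add_divide_distrib sum_distrib_right sum_divide_distrib)
qed

text \<open>For \<open>b\<close> coprime to \<open>a\<close> and a totative \<open>y\<close>,
  \<open>in_semigroup_gen_iff\<close> identifies this with the primes counted by
  \<open>prime_count_gen a b\<close> that lie in the class of \<open>b * y\<close>.\<close>

definition residue_part :: "nat \<Rightarrow> nat \<Rightarrow> nat set" where
  "residue_part y b = {p \<in> primes_cong a (b * y) (real_of_int (frobenius_num a b)). b * y \<le> p}"

text \<open>The count is the difference of the counts up to s(a, b) and up to \<open>b * y\<close>,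
  asymptotically in the proportion (a - 1) to \<open>y\<close>.\<close>

lemma residue_part_limit:
  assumes y: "y \<in> totatives a"
  shows "((\<lambda>b. real (card (residue_part y b)) * ln (real b) / real b) \<longlongrightarrow> (real a - 1 - real y) / real (totient a)) F"
proof (cases "y = a - 1")
  \<comment> \<open>Here \<open>b * y\<close> exceeds s(a, b) by \<open>a\<close>, so nothing is
    counted. For smaller \<open>y\<close>, \<open>b * y \<le> s b\<close> as soon as
    \<open>b \<ge> a\<close>.\<close>
  case True
  have "residue_part y b = {}" for b
  proof -
    have "real (b * y) = (real a - 1) * real b" using True a by (simp add: of_nat_diff)
    hence "real_of_int (frobenius_num a b) < real (b * y)" unfolding frobenius_num_real using a by linarith
    moreover have "real (b * y) \<le> real_of_int (frobenius_num a b)" if "p \<in> residue_part y b" for p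
    proof -
      have "real (b * y) \<le> real p" using that by (simp only: residue_part_def of_nat_le_iff mem_Collect_eq)
      also have "\<dots> \<le> real_of_int (frobenius_num a b)" using that by (simp add: residue_part_def primes_cong_def)
      finally show ?thesis .
    qed
    ultimately show ?thesis by fastforce
  qed
  thus ?thesis using True a by (simp add: of_nat_diff)
next
  case False
  have ya: "0 < y" "y < a" "coprime y a" using y a totatives_less[OF y] by (auto simp: in_totatives_iff)
  define s where "s = (\<lambda>b. (real a - 1) * real b - real a)"
  define P where "P = (\<lambda>b x. real (card (primes_cong a (b * y) x)))"
  have cop: "\<forall>\<^sub>F b in F. coprime (b * y) a"
    using eventually_coprime by eventually_elim (use ya in \<open>auto simp: coprime_commute\<close>)
  \<comment> \<open>The error of 1 is the endpoint p = b y, which belongs to both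
    \<open>residue_part\<close> and the subtracted count if it is prime.\<close>
  have bound: "\<forall>\<^sub>F b in F. \<bar>real (card (residue_part y b)) - (P b (s b) - P b (real (b * y)))\<bar> \<le> 1"
    using eventually_ge[of a]
  proof eventually_elim
    case (elim b)
    have le: "real (b * y) \<le> s b"
    proof -
      have "real y \<le> real a - 2" using False ya a by linarith
      hence "real b * real y \<le> real b * (real a - 2)" by (intro mult_left_mono) auto
      also have "\<dots> \<le> s b" using elim by (simp add: s_def algebra_simps)
      finally show ?thesis by simp
    qed
    define D where "D = {p \<in> primes_cong a (b * y) (s b). p < b * y}"
    have finD: "finite D" and finR: "finite (residue_part y b)" by (auto simp: D_def residue_part_def)
    have "primes_cong a (b * y) (s b) = D \<union> residue_part y b" "D \<inter> residue_part y b = {}"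
      by (auto simp: D_def residue_part_def s_def frobenius_num_real)
    hence 1: "P b (s b) = real (card D) + real (card (residue_part y b))"
      using card_Un_disjoint[OF finD finR] by (simp add: P_def)
    have sub: "D \<subseteq> primes_cong a (b * y) (real (b * y))"
      by (auto simp: D_def primes_cong_def simp del: of_nat_mult)
    have sup: "primes_cong a (b * y) (real (b * y)) \<subseteq> insert (b * y) D"
      using le by (auto simp: D_def primes_cong_def simp del: of_nat_mult)
    have "card D \<le> card (primes_cong a (b * y) (real (b * y)))" using sub by (intro card_mono) auto
    moreover have "card (primes_cong a (b * y) (real (b * y))) \<le> Suc (card D)"
      using finD by (intro order_trans[OF card_mono[OF _ sup]]) (auto simp: card_insert_if)
    ultimately show ?case unfolding 1 unfolding P_def by linarith
  qed
  have "((\<lambda>b. (real (card (residue_part y b)) - (P b (s b) - P b (real (b * y)))) * ln (real b) / real b) \<longlongrightarrow> 0) F"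
    by (rule bounded_count_limit[OF bound])
  moreover have "((\<lambda>b. P b (s b) * ln (real b) / real b) \<longlongrightarrow> (real a - 1) / real (totient a)) F"
    unfolding P_def s_def by (rule count_limit_linear[OF cop]) (use a in auto)
  moreover have "((\<lambda>b. P b (real (b * y)) * ln (real b) / real b) \<longlongrightarrow> real y / real (totient a)) F"
    unfolding P_def using count_limit_linear[OF cop, of "real y" 0] ya by (simp add: mult.commute)
  ultimately have "((\<lambda>b. (real (card (residue_part y b)) - (P b (s b) - P b (real (b * y)))) * ln (real b) / real b
      + (P b (s b) * ln (real b) / real b - P b (real (b * y)) * ln (real b) / real b)) \<longlongrightarrow>
      0 + ((real a - 1) / real (totient a) - real y / real (totient a))) F"
    by (intro tendsto_add tendsto_diff)
  thus ?thesis by (simp add: diff_divide_distrib left_diff_distrib)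
qed

text \<open>In any representation p = a x + b z the coefficient \<open>z\<close> is congruent to
  \<open>y\<close> modulo \<open>a\<close>, and \<open>y\<close> is the least such number.
  Conversely p - b y is a multiple of \<open>a\<close>, nonnegative exactly when
  \<open>b * y \<le> p\<close>.\<close>

lemma in_semigroup_gen_iff:
  assumes b: "coprime a b" and y: "y < a" "[p = b * y] (mod a)"
  shows "p \<in> semigroup_gen a b \<longleftrightarrow> b * y \<le> p"
proof
  assume "p \<in> semigroup_gen a b"
  then obtain x z where xz: "p = a * x + b * z" by (auto simp: semigroup_gen_def)
  have "[b * z = b * y] (mod a)" using y(2) unfolding xz by (simp add: cong_def)
  hence "[z = y] (mod a)" using b by (simp add: cong_mult_lcancel_nat coprime_commute)
  hence "y = z mod a" using y(1) by (simp add: cong_def)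
  hence "b * y \<le> b * z" by (intro mult_left_mono) auto
  thus "b * y \<le> p" using xz by linarith
next
  assume "b * y \<le> p"
  then obtain x where "p = x * a + b * y" using y(2) cong_le_nat[of "b * y" p a] by auto
  hence "p = a * x + b * y" by (simp add: mult.commute)
  thus "p \<in> semigroup_gen a b" unfolding semigroup_gen_def by blast
qed

lemma prime_count_gen_eq:
  assumes b: "coprime a b"
  shows "\<exists>c\<le>a. prime_count_gen a b = c + (\<Sum>y\<in>totatives a. card (residue_part y b))"
proof -
  define X where "X = {p \<in> semigroup_gen a b. prime p \<and> int p \<le> frobenius_num a b}"
  have "finite X" by (rule finite_subset[of _ "{..nat (frobenius_num a b)}"]) (auto simp: X_def)
  hence "prime_count_gen a b = card {p \<in> X. p dvd a} + (\<Sum>y\<in>totatives a. card {p \<in> X. [p = b * y] (mod a)})"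
    unfolding prime_count_gen_def X_def [symmetric] by (intro card_primes_by_residue b) (simp_all add: X_def)
  also have "(\<Sum>y\<in>totatives a. card {p \<in> X. [p = b * y] (mod a)}) = (\<Sum>y\<in>totatives a. card (residue_part y b))"
  proof (intro sum.cong refl arg_cong[where f = card] equalityI subsetI)
    fix y p assume y: "y \<in> totatives a"
    have iff: "p \<in> semigroup_gen a b \<longleftrightarrow> b * y \<le> p" if "[p = b * y] (mod a)"
      using in_semigroup_gen_iff[OF b totatives_less[OF y a] that] .
    have le: "real p \<le> real_of_int (frobenius_num a b) \<longleftrightarrow> int p \<le> frobenius_num a b" by linarith
    show "p \<in> residue_part y b" if "p \<in> {p \<in> X. [p = b * y] (mod a)}"
      using that iff le unfolding X_def residue_part_def primes_cong_def by blast
    show "p \<in> {p \<in> X. [p = b * y] (mod a)}" if "p \<in> residue_part y b"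
      using that iff le unfolding X_def residue_part_def primes_cong_def by blast
  qed
  finally show ?thesis using card_prime_divisors_le[of X] by (auto simp: X_def)
qed

lemma prime_count_gen_limit:
  "((\<lambda>b. real (prime_count_gen a b) * ln (real b) / real b) \<longlongrightarrow> real a - 1 - real a / 2) F"
proof -
  define N where "N = (\<lambda>b. \<Sum>y\<in>totatives a. real (card (residue_part y b)))"
  have "((\<lambda>b. (\<Sum>y\<in>totatives a. real (card (residue_part y b)) * ln (real b) / real b)) \<longlongrightarrow>
          (\<Sum>y\<in>totatives a. (real a - 1 - real y) / real (totient a))) F"
    by (intro tendsto_sum residue_part_limit)
  moreover have "(\<Sum>y\<in>totatives a. (real a - 1 - real y) / real (totient a)) = real a - 1 - real a / 2"
  proof -
    have "(\<Sum>y\<in>totatives a. (real a - 1 - real y) / real (totient a)) =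
          (real (totient a) * (real a - 1) - (\<Sum>y\<in>totatives a. real y)) / real (totient a)"
      by (simp add: sum_divide_distrib [symmetric] sum_subtractf totient_def)
    also have "(\<Sum>y\<in>totatives a. real y) = real a * real (totient a) / 2" using sum_totatives[OF a] by simp
    also have "(real (totient a) * (real a - 1) - real a * real (totient a) / 2) / real (totient a) = real a - 1 - real a / 2"
      using a by (simp add: field_simps)
    finally show ?thesis .
  qed
  ultimately have N: "((\<lambda>b. N b * ln (real b) / real b) \<longlongrightarrow> real a - 1 - real a / 2) F"
    by (simp add: N_def sum_distrib_right sum_divide_distrib)
  have "\<forall>\<^sub>F b in F. \<bar>real (prime_count_gen a b) - N b\<bar> \<le> real a"
    using eventually_coprime
  proof eventually_elim
    case (elim b)
    obtain c where c: "c \<le> a" "prime_count_gen a b = c + (\<Sum>y\<in>totatives a. card (residue_part y b))"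
      using prime_count_gen_eq[OF elim] by blast
    hence "real (prime_count_gen a b) = real c + N b" by (simp add: N_def)
    thus ?case using c(1) by simp
  qed
  from tendsto_add[OF N bounded_count_limit[OF this]] show ?thesis
    by (simp add: left_diff_distrib diff_divide_distrib)
qed

lemma prime_count_ratio:
  shows "((\<lambda>b. real (prime_count_gen a b) / real (prime_count (real_of_int (frobenius_num a b)))) \<longlongrightarrow>
           1 / 2 - 1 / (2 * (real a - 1))) F"
    and "\<forall>\<^sub>F b in F. prime_count (real_of_int (frobenius_num a b)) \<noteq> 0"
proof -
  let ?g = "\<lambda>b. real (prime_count (real_of_int (frobenius_num a b)))"
  have pos: "\<forall>\<^sub>F b in F. ?g b * ln (real b) / real b > 0"
    using a by (intro order_tendstoD[OF prime_count_limit]) auto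
  thus "\<forall>\<^sub>F b in F. prime_count (real_of_int (frobenius_num a b)) \<noteq> 0"
    by eventually_elim (auto intro!: Nat.gr0I)
  have "((\<lambda>b. (real (prime_count_gen a b) * ln (real b) / real b) / (?g b * ln (real b) / real b)) \<longlongrightarrow>
          (real a - 1 - real a / 2) / (real a - 1)) F"
    using a by (intro tendsto_divide prime_count_limit prime_count_gen_limit) auto
  also have "(real a - 1 - real a / 2) / (real a - 1) = 1 / 2 - 1 / (2 * (real a - 1))"
    using a by (simp add: field_simps)
  finally show "((\<lambda>b. real (prime_count_gen a b) / ?g b) \<longlongrightarrow> 1 / 2 - 1 / (2 * (real a - 1))) F"
    by (rule Lim_transform_eventually) (use pos in eventually_elim, auto)
qed

end

theorem theorem1p1:
  shows "(\<forall>a::nat. a \<ge> 3 \<longrightarrow>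
           (\<exists>\<epsilon> :: nat \<Rightarrow> real.
              \<epsilon> \<in> o[inf at_top (principal {b. coprime a b})](\<lambda>_. 1) \<and>
              (\<forall>\<^sub>F b in inf at_top (principal {b. coprime a b}).
                 real (prime_count_gen a b) =
                   (1 / 2 - 1 / (2 * (real a - 1)) + \<epsilon> b)
                     * real (prime_count (real_of_int (frobenius_num a b))))))
       \<and> (\<lambda>b::nat. real (prime_count_gen 3 b)
                    - 1 / 4 * real (prime_count (real_of_int (frobenius_num 3 b))))
           \<in> o[inf at_top (principal {b. \<not> 3 dvd b})](\<lambda>b.
                 real (prime_count (real_of_int (frobenius_num 3 b))))"
proof (intro conjI allI impI, goal_cases)
  case (1 a)
  hence a: "a > 1" by simp
  define k where "k = 1 / 2 - 1 / (2 * (real a - 1))"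
  \<comment> \<open>Solving the required equation for the error term; it holds wherever the
    denominator is nonzero, hence eventually.\<close>
  define \<epsilon> where "\<epsilon> = (\<lambda>b. real (prime_count_gen a b) / real (prime_count (real_of_int (frobenius_num a b))) - k)"
  have "(\<epsilon> \<longlongrightarrow> k - k) (inf at_top (principal {b. coprime a b}))"
    unfolding \<epsilon>_def using prime_count_ratio(1)[OF a refl] by (intro tendsto_intros) (simp add: k_def)
  hence "\<epsilon> \<in> o[inf at_top (principal {b. coprime a b})](\<lambda>_. 1)" by (intro smalloI_tendsto) auto
  moreover have "\<forall>\<^sub>F b in inf at_top (principal {b. coprime a b}).
      real (prime_count_gen a b) = (k + \<epsilon> b) * real (prime_count (real_of_int (frobenius_num a b)))"
    using prime_count_ratio(2)[OF a refl] by eventually_elim (simp add: \<epsilon>_def)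
  ultimately show ?case unfolding k_def by blast
next
  case 2
  have "coprime 3 b \<longleftrightarrow> \<not> 3 dvd b" for b :: nat
    using prime_imp_coprime[of 3 b] by (auto simp: coprime_absorb_left)
  hence F: "inf at_top (principal {b::nat. \<not> 3 dvd b}) = inf at_top (principal {b. coprime 3 b})" by simp
  let ?g = "\<lambda>b. real (prime_count (real_of_int (frobenius_num 3 b)))"
  have "(1::nat) < 3" by simp
  note ratio = prime_count_ratio[OF this F]
  have "((\<lambda>b. real (prime_count_gen 3 b) / ?g b - 1 / 4) \<longlongrightarrow> 1 / 4 - 1 / 4) (inf at_top (principal {b. \<not> 3 dvd b}))"
    using tendsto_diff[OF ratio(1) tendsto_const[of "1 / 4"]] by simp
  moreover have "\<forall>\<^sub>F b in inf at_top (principal {b. \<not> 3 dvd b}).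
      real (prime_count_gen 3 b) / ?g b - 1 / 4 = (real (prime_count_gen 3 b) - 1 / 4 * ?g b) / ?g b"
    using ratio(2) by eventually_elim (simp add: diff_divide_distrib)
  ultimately have "((\<lambda>b. (real (prime_count_gen 3 b) - 1 / 4 * ?g b) / ?g b) \<longlongrightarrow> 0) (inf at_top (principal {b. \<not> 3 dvd b}))"
    by (simp add: tendsto_cong)
  thus ?case using ratio(2) by (intro smalloI_tendsto) auto
qed

end
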